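(* Let $s$ and $\alpha$ be real numbers and let $0<p\le\infty$. Then $$F_{\alpha,s}^p=\widetilde F_{\alpha,s}^p=\begin{cases}F_{\alpha-sp}^p & \text{if } 0<p<\infty,\\ F_{\alpha-s}^\infty & \text{if } p=\infty,\end{cases}$$ with equivalent norms. (That is, the three sets of entire functions coincide and their norms are bounded by constant multiples of each other, with constants depending only on $n,p,\alpha,s$.)
   Context: Fix an integer $n\ge1$. $dV$ is Lebesgue volume measure on $\mathbb{C}^n$ normalized so that $\int_{\mathbb{C}^n}e^{-|z|^2}dV(z)=1$, and $H(\mathbb{C}^n)$ is the space of entire functions on $\mathbb{C}^n$. For $\alpha$ real put $dV_\alpha(z)=(1+|z|)^{-\alpha}dV(z)$. For $0<p<\infty$, $L_\alpha^p$ is the space of measurable $\psi$ on $\mathbb{C}^n$ with $\|\psi\|_{L_\alpha^p}=\left\{\int_{\mathbb{C}^n}|\psi(z)e^{-|z|^2/2}|^p\,dV_\alpha(z)\right\}^{1/p}<\infty$; $L_\alpha^\infty$ is the space of measurable $\psi$ with $\|\psi\|_{L_\alpha^\infty}=\operatorname{esssup}_{z}\frac{|\psi(z)|e^{-|z|^2/2}}{(1+|z|)^\alpha}<\infty$. For $0<p\le\infty$, $F_\alpha^p=L_\alpha^p\cap H(\mathbb{C}^n)$ with $\|f\|_{F_\alpha^p}=\|f\|_{L_\alpha^p}$ (called a "norm" even for $p<1$). Let $f\in H(\mathbb{C}^n)$ have homogeneous expansion $f=\sum_{k\ge0}f_k$, with $f_k$ a homogeneous polynomial of degree $k$. For $s$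 real define $\mathcal D^sf=\sum_{k}\frac{\Gamma(n+s+k)}{\Gamma(n+k)}f_k$ and $\mathcal I^sf=\sum_{k}\frac{\Gamma(n+k)}{\Gamma(n+s+k)}f_k$, where the sums are over all $k\ge0$ if $s\ge0$ and over $k>|s|$ only if $s<0$; these are entire functions. Put $f_s^-=\sum_{k\le|s|}f_k$. Define $\mathcal R^sf(z)=(1+|z|)^{-s}\mathcal D^sf(z)$ and $\widetilde{\mathcal R}^sf(z)=(1+|z|)^{-s}\mathcal I^{-s}f(z)$. The weighted Fock-Sobolev space $F_{\alpha,s}^p$ is the space of all $f\in H(\mathbb{C}^n)$ with $\mathcal R^sf\in L_\alpha^p$, with norm $\|f\|_{F_{\alpha,s}^p}=\|\mathcal R^sf\|_{L_\alpha^p}$ if $s\ge0$ and $\|f\|_{F_{\alpha,s}^p}=\|\mathcal R^sf\|_{L_\alpha^p}+\|f_s^-\|_{F_\alpha^p}$ if $s<0$. The space $\widetilde F_{\alpha,s}^p$ is the space of all $f\in H(\mathbb{C}^n)$ with $\widetilde{\mathcal R}^sf\in L_\alpha^p$, with norm $\|f\|_{\widetilde F_{\alpha,s}^p}=\|\widetilde{\mathcal R}^sf\|_{L_\alpha^p}$ if $s\le0$ and $\|f\|_{\widetilde F_{\alpha,s}^p}=\|\widetilde{\mathcal R}^sf\|_{L_\alpha^p}+\|f_s^-\|_{F_\alpha^p}$ if $s>0$. *)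

theory Defs
  imports "HOL-Analysis.Analysis" "HOL-Probability.Essential_Supremum"
begin

text \<open>
  Complex n-space is \<^typ>\<open>complex^'n\<close> with \<open>n = CARD('n)\<close>; its norm is the Euclidean norm.
  An exponent p with \<open>0 < p \<le> \<infinity>\<close> is an element of \<^typ>\<open>ennreal\<close>.  All norms take values in
  \<^typ>\<open>ennreal\<close>, so that membership in a space is finiteness of the norm.
\<close>

definition entire :: "(complex^'n \<Rightarrow> complex) \<Rightarrow> bool" where
  "entire f \<longleftrightarrow>
     (\<forall>z. \<exists>D. (f has_derivative D) (at z) \<and> (\<forall>c v. D (c *s v) = c * D v))"

text \<open>Lebesgue measure, rescaled so that the Gaussian \<open>exp (-|z|\<^sup>2)\<close> has integral 1.\<close>

definition dV :: "(complex^'n) measure" where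
  "dV = scale_measure
     (inverse (\<integral>\<^sup>+ z. ennreal (exp (- (norm z)\<^sup>2)) \<partial>(lebesgue :: (complex^'n) measure))) lebesgue"

definition dV_weighted :: "real \<Rightarrow> (complex^'n) measure" where
  "dV_weighted \<alpha> = density dV (\<lambda>z. ennreal ((1 + norm z) powr (- \<alpha>)))"

text \<open>Powers with a positive exponent, extended by \<open>\<infinity>\<^sup>r = \<infinity>\<close>.\<close>

definition ennreal_powr :: "ennreal \<Rightarrow> real \<Rightarrow> ennreal" where
  "ennreal_powr x r = (if x = \<infinity> then \<infinity> else ennreal (enn2real x powr r))"

definition L_norm :: "ennreal \<Rightarrow> real \<Rightarrow> (complex^'n \<Rightarrow> complex) \<Rightarrow> ennreal" where
  "L_norm p \<alpha> \<psi> =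
     (if p = \<infinity>
      then esssup dV (\<lambda>z. ennreal (cmod (\<psi> z) * exp (- (norm z)\<^sup>2 / 2) / (1 + norm z) powr \<alpha>))
      else ennreal_powr
             (\<integral>\<^sup>+ z. ennreal (cmod (\<psi> z * of_real (exp (- (norm z)\<^sup>2 / 2))) powr enn2real p)
                \<partial>dV_weighted \<alpha>)
             (1 / enn2real p))"

definition L_space :: "ennreal \<Rightarrow> real \<Rightarrow> (complex^'n \<Rightarrow> complex) set" where
  "L_space p \<alpha> = {\<psi>. \<psi> \<in> borel_measurable lebesgue \<and> L_norm p \<alpha> \<psi> < \<infinity>}"

definition fock :: "ennreal \<Rightarrow> real \<Rightarrow> (complex^'n \<Rightarrow> complex) set" where
  "fock p \<alpha> = L_space p \<alpha> \<inter> {f. entire f}"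

definition homogeneous_poly :: "nat \<Rightarrow> (complex^'n \<Rightarrow> complex) \<Rightarrow> bool" where
  "homogeneous_poly k P \<longleftrightarrow>
     (\<exists>c :: ('n \<Rightarrow> nat) \<Rightarrow> complex.
        \<forall>z. P z = (\<Sum>m | (\<Sum>i\<in>UNIV. m i) = k. c m * (\<Prod>i\<in>UNIV. (z $ i) ^ m i)))"

definition homogeneous_expansion ::
    "(complex^'n \<Rightarrow> complex) \<Rightarrow> (nat \<Rightarrow> complex^'n \<Rightarrow> complex) \<Rightarrow> bool" where
  "homogeneous_expansion f F \<longleftrightarrow>
     (\<forall>k. homogeneous_poly k (F k)) \<and> (\<forall>z. (\<lambda>k. F k z) sums f z)"

text \<open>
  Every entire function has exactly one homogeneous expansion: restricted to a complex line through
  the origin, the expansion becomes the Taylor series of a function of one variable.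
\<close>

definition hom_part :: "(complex^'n \<Rightarrow> complex) \<Rightarrow> nat \<Rightarrow> complex^'n \<Rightarrow> complex" where
  "hom_part f = (THE F. homogeneous_expansion f F)"

definition frac_indices :: "real \<Rightarrow> nat set" where
  "frac_indices s = {k. s \<ge> 0 \<or> real k > \<bar>s\<bar>}"

definition frac_D :: "real \<Rightarrow> (complex^'n \<Rightarrow> complex) \<Rightarrow> complex^'n \<Rightarrow> complex" where
  "frac_D s f z =
     (\<Sum>k. if k \<in> frac_indices s
           then of_real (Gamma (real CARD('n) + s + real k) / Gamma (real CARD('n) + real k))
                  * hom_part f k z
           else 0)"

definition frac_I :: "real \<Rightarrow> (complex^'n \<Rightarrow> complex) \<Rightarrow> complex^'n \<Rightarrow> complex" where
  "frac_I s f z =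
     (\<Sum>k. if k \<in> frac_indices s
           then of_real (Gamma (real CARD('n) + real k) / Gamma (real CARD('n) + s + real k))
                  * hom_part f k z
           else 0)"

definition low_part :: "real \<Rightarrow> (complex^'n \<Rightarrow> complex) \<Rightarrow> complex^'n \<Rightarrow> complex" where
  "low_part s f z = (\<Sum>k | real k \<le> \<bar>s\<bar>. hom_part f k z)"

definition R_op :: "real \<Rightarrow> (complex^'n \<Rightarrow> complex) \<Rightarrow> complex^'n \<Rightarrow> complex" where
  "R_op s f z = of_real ((1 + norm z) powr (- s)) * frac_D s f z"

definition R_tilde_op :: "real \<Rightarrow> (complex^'n \<Rightarrow> complex) \<Rightarrow> complex^'n \<Rightarrow> complex" where
  "R_tilde_op s f z = of_real ((1 + norm z) powr (- s)) * frac_I (- s) f z"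

definition fock_sobolev :: "ennreal \<Rightarrow> real \<Rightarrow> real \<Rightarrow> (complex^'n \<Rightarrow> complex) set" where
  "fock_sobolev p \<alpha> s = {f. entire f \<and> R_op s f \<in> L_space p \<alpha>}"

definition fock_sobolev_norm ::
    "ennreal \<Rightarrow> real \<Rightarrow> real \<Rightarrow> (complex^'n \<Rightarrow> complex) \<Rightarrow> ennreal" where
  "fock_sobolev_norm p \<alpha> s f =
     (if s \<ge> 0 then L_norm p \<alpha> (R_op s f)
      else L_norm p \<alpha> (R_op s f) + L_norm p \<alpha> (low_part s f))"

definition fock_sobolev_tilde :: "ennreal \<Rightarrow> real \<Rightarrow> real \<Rightarrow> (complex^'n \<Rightarrow> complex) set" where
  "fock_sobolev_tilde p \<alpha> s = {f. entire f \<and> R_tilde_op s f \<in> L_space p \<alpha>}"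

definition fock_sobolev_tilde_norm ::
    "ennreal \<Rightarrow> real \<Rightarrow> real \<Rightarrow> (complex^'n \<Rightarrow> complex) \<Rightarrow> ennreal" where
  "fock_sobolev_tilde_norm p \<alpha> s f =
     (if s \<le> 0 then L_norm p \<alpha> (R_tilde_op s f)
      else L_norm p \<alpha> (R_tilde_op s f) + L_norm p \<alpha> (low_part s f))"

definition equivalent_norms_on :: "'f set \<Rightarrow> ('f \<Rightarrow> ennreal) \<Rightarrow> ('f \<Rightarrow> ennreal) \<Rightarrow> bool" where
  "equivalent_norms_on X N N' \<longleftrightarrow>
     (\<exists>C>0. \<exists>C'>0. \<forall>f\<in>X. N f \<le> ennreal C * N' f \<and> N' f \<le> ennreal C' * N f)"

text \<open>The weight \<open>\<beta>\<close> for which the Fock-Sobolev spaces of parameters \<open>p, \<alpha>, s\<close> are \<open>fock p \<beta>\<close>.\<close>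

definition shifted_weight :: "ennreal \<Rightarrow> real \<Rightarrow> real \<Rightarrow> real" where
  "shifted_weight p \<alpha> s = (if p = \<infinity> then \<alpha> - s else \<alpha> - s * enn2real p)"

end

theory Submission
  imports Defs "HOL-Complex_Analysis.Complex_Analysis" "HOL-Probability.Distributions"
begin

text \<open>
  All operators in question multiply the homogeneous parts \<open>f\<^sub>k\<close> by a sequence \<open>c\<^sub>k\<close>.  Such an operator \<open>T\<close>
  has order \<open>\<sigma>\<close> if \<open>f \<mapsto> (1 + |z|)\<^bsup>-2\<sigma>\<^esup> T f\<close> is bounded on every weighted space.  Orders add under
  composition, so the theorem reduces to: \<open>\<Gamma>(a + k) / \<Gamma>(b + k)\<close> has order \<open>a - b\<close> for all real \<open>a\<close> and \<open>b\<close>.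
  Since \<open>\<Gamma>(b + m + k) / \<Gamma>(b + k)\<close> is a product of \<open>m\<close> linear factors, two cases suffice.  A linear
  factor \<open>k + \<gamma>\<close> is a radial derivative and has order 1 by a Cauchy estimate at distance
  \<open>1 / (1 + |z|)\<close>, where the Gaussian weight is almost constant.  If \<open>d = b - a \<ge> 2\<close>, the quotient is a Beta
  integral, and the operator is an average of \<open>f (t z)\<close> over \<open>0 < t < 1\<close>; the part \<open>t \<ge> 1/2\<close> has order \<open>- d\<close>
  since the Gaussian weight concentrates it at \<open>1 - t = O(1 / |z|\<^sup>2)\<close>, and the part \<open>t < 1/2\<close>
  multiplies \<open>f\<^sub>k\<close> by \<open>O(2\<^bsup>-k\<^esup>)\<close>, which maps any weighted space into any other.

  In both cases \<open>(1 + |z|)\<^bsup>-2\<sigma>\<^esup> |T f z|\<close> is dominated by a single value of the weighted \<open>|f|\<close> near some \<open>t z\<close>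
  with \<open>1/2 \<le> t \<le> 1\<close>, up to the factor \<open>exp (- q (1 - t\<^sup>2) |z|\<^sup>2)\<close>.  By subharmonicity of \<open>|f|\<^bsup>p\<^esup>\<close>, which holds
  up to a constant for all \<open>p > 0\<close>, this value is controlled by local averages, so that the case \<open>p < 1\<close>
  needs no separate treatment.
\<close>

section \<open>Slice-holomorphic functions and homogeneous expansions\<close>

text \<open>Minkowski's integral inequality fails for p < 1, so an average of \<open>f (t z)\<close>
  over t cannot be estimated inside the norm. Instead half of the Gaussian decay available along the
  ray is kept with \<open>f\<close>, the maximum over t of the damped value is taken, and the other
  half pays for the integral over t. Orders count in units of (1 + |z|)^2, because a radial
  derivative of a function of size exp(|z|^2/2) costs a factor |z|^2; an operator of order s
  combined with the factor (1 + |z|)^(-s) then shifts the weight by exactly s. The indices dropped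
  for s < 0, and those at which a Gamma quotient meets a pole, are finite in number; they change a
  sequence only by one of finite support, which is smoothing. \<open>hom_part\<close> is a definite
  description over explicit monomial sums, so an expansion into genuine polynomials must be
  constructed before any operator can be evaluated. Apart from that, only continuity and holomorphy
  on complex lines are used.\<close>

lemma norm_smult_complex: "norm (c *s (z :: complex^'n)) = cmod c * norm z"
  by (simp add: norm_vec_def norm_mult L2_set_right_distrib)

lemma bounded_linear_smult_left: "bounded_linear (\<lambda>c. c *s (z :: complex^'n))"
  by (intro bounded_linear_intro[where K = "norm z"])
     (auto simp: vec_eq_iff algebra_simps norm_smult_complex scaleR_conv_of_real[where 'a=complex])

lemma continuous_on_smult [continuous_intros]:
  fixes g :: "_ \<Rightarrow> complex^'n"
  assumes "continuous_on S f" "continuous_on S g"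
  shows "continuous_on S (\<lambda>x. f x *s g x)"
  unfolding vector_scalar_mult_def
  by (intro continuous_on_vec_lambda continuous_intros assms
        continuous_on_compose2[OF continuous_on_component assms(2)]) auto

lemma of_real_smult: "of_real t *s (z :: complex^'n) = t *\<^sub>R z"
  by (auto simp: vec_eq_iff scaleR_conv_of_real[where 'a=complex])

text \<open>Circle averages and Cauchy estimates take place on complex lines, so this is the
  regularity they use; both conditions pass to locally uniform limits by one-variable
  theorems.\<close>

definition slice_holomorphic :: "(complex^'n \<Rightarrow> complex) \<Rightarrow> bool" where
  "slice_holomorphic f \<longleftrightarrow>
     continuous_on UNIV f \<and> (\<forall>a v. (\<lambda>\<zeta>. f (a + \<zeta> *s v)) holomorphic_on UNIV)"

lemma slice_holomorphic_cont: "slice_holomorphic f \<Longrightarrow> continuous_on S f"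
  unfolding slice_holomorphic_def using continuous_on_subset by blast

lemma slice_holomorphic_slice: "slice_holomorphic f \<Longrightarrow> (\<lambda>\<zeta>. f (a + \<zeta> *s v)) holomorphic_on S"
  unfolding slice_holomorphic_def using holomorphic_on_subset by blast

lemma slice_holomorphic_slice0:
  assumes "slice_holomorphic f"
  shows "(\<lambda>\<zeta>. f (\<zeta> *s v)) holomorphic_on S"
  using slice_holomorphic_slice[OF assms, of 0 v S] by simp

lemma entire_imp_slice_holomorphic:
  assumes "entire f"
  shows "slice_holomorphic f"
  unfolding slice_holomorphic_def
proof (intro conjI allI)
  show "continuous_on UNIV f"
    using assms unfolding entire_def
    by (meson continuous_at_imp_continuous_on has_derivative_continuous)
next
  fix a v
  have "(\<lambda>\<zeta>. f (a + \<zeta> *s v)) field_differentiable at \<zeta>" for \<zeta>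
  proof -
    obtain D where D: "(f has_derivative D) (at (a + \<zeta> *s v))" "\<And>c w. D (c *s w) = c * D w"
      using assms unfolding entire_def by blast
    have "((\<lambda>\<zeta>. a + \<zeta> *s v) has_derivative (\<lambda>\<zeta>. \<zeta> *s v)) (at \<zeta>)"
      by (auto intro!: derivative_eq_intros bounded_linear.has_derivative[OF bounded_linear_smult_left])
    from diff_chain_at[OF this D(1)]
    have "((\<lambda>\<zeta>. f (a + \<zeta> *s v)) has_derivative (\<lambda>h. D v * h)) (at \<zeta>)"
      by (simp add: o_def D(2) mult.commute)
    then show ?thesis
      unfolding field_differentiable_def has_field_derivative_def by blast
  qed
  then show "(\<lambda>\<zeta>. f (a + \<zeta> *s v)) holomorphic_on UNIV"
    by (simp add: holomorphic_on_def)
qed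

lemma slice_holomorphic_diff:
  assumes "slice_holomorphic f" "slice_holomorphic g"
  shows "slice_holomorphic (\<lambda>z. f z - g z)"
  using assms unfolding slice_holomorphic_def by (auto intro!: continuous_intros holomorphic_intros)

lemma slice_holomorphic_cmult:
  assumes "slice_holomorphic f"
  shows "slice_holomorphic (\<lambda>z. c * f z)"
  using assms unfolding slice_holomorphic_def by (auto intro!: continuous_intros holomorphic_intros)

lemma slice_holomorphic_sum:
  assumes "\<And>i. i \<in> I \<Longrightarrow> slice_holomorphic (f i)"
  shows "slice_holomorphic (\<lambda>z. \<Sum>i\<in>I. f i z)"
  using assms unfolding slice_holomorphic_def by (auto intro!: continuous_intros holomorphic_intros)

lemma slice_holomorphic_power:
  assumes "slice_holomorphic f"
  shows "slice_holomorphic (\<lambda>z. f z ^ m)"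
  using assms unfolding slice_holomorphic_def by (auto intro!: continuous_intros holomorphic_intros)

lemma slice_holomorphic_dilation:
  assumes "slice_holomorphic f"
  shows "slice_holomorphic (\<lambda>z. f (c *s z))"
  unfolding slice_holomorphic_def
proof (intro conjI allI)
  show "continuous_on UNIV (\<lambda>z. f (c *s z))"
    by (rule continuous_on_compose2[OF slice_holomorphic_cont[OF assms, of UNIV]])
       (auto intro!: continuous_intros)
  show "(\<lambda>\<zeta>. f (c *s (a + \<zeta> *s v))) holomorphic_on UNIV" for a v
    using slice_holomorphic_slice[OF assms, of "c *s a" "c *s v"]
    by (simp add: vector_add_ldistrib mult.commute)
qed

text \<open>A disc of radius 1 on a line stays in one large ball, so the one-variable convergence
  theorem applies on each line.\<close>

lemma slice_holomorphic_uniform_limit: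
  assumes g: "\<And>m. slice_holomorphic (g m)"
    and lim: "\<And>R. uniform_limit (cball 0 R) g h sequentially"
  shows "slice_holomorphic h"
  unfolding slice_holomorphic_def
proof (intro conjI allI)
  have "continuous_on (ball 0 R) h" for R
    by (rule uniform_limit_theorem[OF _ uniform_limit_on_subset[OF lim[of R] ball_subset_cball]])
       (auto intro!: always_eventually slice_holomorphic_cont g)
  then have "continuous_on (\<Union>R. ball 0 R) h"
    by (intro continuous_on_open_UN) auto
  moreover have "(\<Union>R. ball (0::complex^'a) R) = UNIV"
    using gt_ex by (auto simp: mem_ball_0)
  ultimately show "continuous_on UNIV h" by simp
next
  fix a v
  show "(\<lambda>\<zeta>. h (a + \<zeta> *s v)) holomorphic_on UNIV"
  proof (rule holomorphic_uniform_sequence[where f = "\<lambda>m \<zeta>. g m (a + \<zeta> *s v)"])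
    fix x :: complex
    have "uniform_limit (cball x 1) (\<lambda>m \<zeta>. g m (a + \<zeta> *s v)) (\<lambda>\<zeta>. h (a + \<zeta> *s v)) sequentially"
    proof (rule uniform_limit_compose'[OF lim[of "norm a + (cmod x + 1) * norm v"]])
      show "(\<lambda>\<zeta>. a + \<zeta> *s v) \<in> cball x 1 \<rightarrow> cball 0 (norm a + (cmod x + 1) * norm v)"
      proof
        fix \<zeta> assume "\<zeta> \<in> cball x 1"
        then have "cmod \<zeta> \<le> cmod x + 1"
          using norm_triangle_ineq[of x "\<zeta> - x"] by (simp add: dist_norm norm_minus_commute)
        then have "cmod \<zeta> * norm v \<le> (cmod x + 1) * norm v"
          by (simp add: mult_right_mono)
        then show "a + \<zeta> *s v \<in> cball 0 (norm a + (cmod x + 1) * norm v)"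
          using norm_triangle_ineq[of a "\<zeta> *s v"] by (simp add: norm_smult_complex)
      qed
    qed
    then show "\<exists>d>0. cball x d \<subseteq> UNIV \<and>
        uniform_limit (cball x d) (\<lambda>m \<zeta>. g m (a + \<zeta> *s v)) (\<lambda>\<zeta>. h (a + \<zeta> *s v)) sequentially"
      by (intro exI[of _ 1]) auto
  qed (auto intro: slice_holomorphic_slice g)
qed

text \<open>Uniqueness of homogeneous terms rests on this: on a line through the origin they must be
  the Taylor coefficients at 0.\<close>

lemma power_series_unique_deriv:
  fixes g :: "complex \<Rightarrow> complex"
  assumes "\<And>\<zeta>. (\<lambda>k. a k * \<zeta> ^ k) sums g \<zeta>"
  shows "a k = (deriv ^^ k) g 0 / fact k"
proof -
  have "summable (\<lambda>k. a k * 1 ^ k)"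
    using assms[of 1] by (rule sums_summable)
  then have "fps_conv_radius (Abs_fps a) \<ge> 1"
    unfolding fps_conv_radius_def using conv_radius_geI[of a "1::complex"]
    by (simp add: one_ereal_def)
  then have "fps_conv_radius (Abs_fps a) > 0"
    using less_le_trans[of "0::ereal" 1] by simp
  moreover have "eval_fps (Abs_fps a) \<zeta> = g \<zeta>" for \<zeta>
    using assms[of \<zeta>] by (simp add: eval_fps_def sums_unique[symmetric])
  ultimately have "g has_fps_expansion Abs_fps a"
    by (simp add: has_fps_expansion_def)
  from fps_nth_fps_expansion[OF this, of k] show ?thesis by simp
qed

text \<open>The terms are only asked to be homogeneous and slice-holomorphic, not polynomial. In
  this form the notion is stable under multiplying the terms by scalars; polynomiality matters only
  for identifying \<open>hom_part\<close>.\<close>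

definition expansion :: "(complex^'n \<Rightarrow> complex) \<Rightarrow> (nat \<Rightarrow> complex^'n \<Rightarrow> complex) \<Rightarrow> bool" where
  "expansion f F \<longleftrightarrow> slice_holomorphic f \<and> (\<forall>k. slice_holomorphic (F k)) \<and>
     (\<forall>k t z. F k (t *s z) = t ^ k * F k z) \<and> (\<forall>z. (\<lambda>k. F k z) sums f z)"

lemma expansion_slice_sums:
  assumes "expansion f F"
  shows "(\<lambda>k. F k z * \<zeta> ^ k) sums f (\<zeta> *s z)"
proof -
  have "(\<lambda>k. F k (\<zeta> *s z)) sums f (\<zeta> *s z)" "\<And>k. F k (\<zeta> *s z) = \<zeta> ^ k * F k z"
    using assms unfolding expansion_def by blast+
  then show ?thesis by (simp only: mult.commute)
qed

text \<open>Cauchy's inequality on the circle of radius \<open>R\<close> in the slice through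
  \<open>z\<close>, which runs in the sphere of radius \<open>R * norm z\<close>. The freedom in
  \<open>R\<close> matters: a large \<open>R\<close> beats a growing sequence, and
  \<open>R = 3/4\<close> stays strictly inside the sphere through \<open>z\<close>.\<close>

lemma taylor_coeff_bound:
  assumes hol: "(\<lambda>\<zeta>. f (\<zeta> *s z)) holomorphic_on UNIV" and R: "R > 0"
    and B: "\<And>w. norm w = R * norm z \<Longrightarrow> cmod (f w) \<le> B"
  shows "cmod ((deriv ^^ k) (\<lambda>\<zeta>. f (\<zeta> *s z)) 0 / fact k) * R ^ k \<le> B"
proof -
  have "cmod ((deriv ^^ k) (\<lambda>\<zeta>. f (\<zeta> *s z)) 0) \<le> fact k * B / R ^ k"
    using hol R
    by (intro Cauchy_inequality holomorphic_on_subset[OF hol])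
       (auto intro!: B holomorphic_on_imp_continuous_on holomorphic_on_subset[OF hol]
         simp: norm_smult_complex)
  then show ?thesis using R by (simp add: norm_divide field_simps)
qed

lemma expansion_coeff_bound:
  assumes f: "expansion f F" and R: "R > 0"
    and B: "\<And>w. norm w = R * norm z \<Longrightarrow> cmod (f w) \<le> B"
  shows "cmod (F k z) * R ^ k \<le> B"
proof -
  have "F k z = (deriv ^^ k) (\<lambda>\<zeta>. f (\<zeta> *s z)) 0 / fact k"
    by (rule power_series_unique_deriv) (rule expansion_slice_sums[OF f])
  moreover have "(\<lambda>\<zeta>. f (\<zeta> *s z)) holomorphic_on UNIV"
    using f unfolding expansion_def by (simp add: slice_holomorphic_slice0)
  ultimately show ?thesis
    using taylor_coeff_bound[of f z R B k] R B by simp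
qed

lemma slice_holomorphic_bounded:
  assumes "slice_holomorphic f"
  obtains B where "B > 0" "\<And>w. norm w \<le> R \<Longrightarrow> cmod (f w) \<le> B"
proof -
  have "compact (f ` cball 0 R)"
    by (intro compact_continuous_image slice_holomorphic_cont assms) auto
  then have "bounded (f ` cball 0 R)" by (rule compact_imp_bounded)
  then obtain B where "B > 0" "\<forall>x\<in>f ` cball 0 R. norm x \<le> B"
    by (auto simp: bounded_pos)
  with that show ?thesis by simp
qed

section \<open>Coefficient multipliers of exponential growth\<close>

definition multiplier :: "(nat \<Rightarrow> real) \<Rightarrow> (nat \<Rightarrow> complex^'n \<Rightarrow> complex) \<Rightarrow> complex^'n \<Rightarrow> complex" where
  "multiplier c F z = (\<Sum>k. of_real (c k) * F k z)"

text \<open>The homogeneous terms of an entire function decay faster than every geometric sequence,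
  so exponential growth of the coefficients preserves convergence; the class is also closed under
  products and sums.\<close>

definition exp_bounded :: "(nat \<Rightarrow> real) \<Rightarrow> bool" where
  "exp_bounded c \<longleftrightarrow> (\<exists>C R. C > 0 \<and> R > 0 \<and> (\<forall>k. \<bar>c k\<bar> \<le> C * R ^ k))"

text \<open>The Cauchy estimate at radius \<open>2 * R\<close> gains \<open>(2 * R) ^ k\<close>: the
  factor \<open>R ^ k\<close> absorbs the growth of \<open>c k\<close>, and what remains is a
  geometric majorant uniform on the ball of radius \<open>\<rho>\<close>.\<close>

lemma multiplier_terms_bound:
  assumes f: "expansion f F" and c: "\<And>k. \<bar>c k\<bar> \<le> C * R ^ k" and C: "C > 0" and R: "R > 0"
    and B: "\<And>w. norm w \<le> 2 * R * \<rho> \<Longrightarrow> cmod (f w) \<le> B" and z: "norm z \<le> \<rho>"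
  shows "cmod (of_real (c k) * F k z) \<le> C * B * (1/2) ^ k"
proof -
  have "cmod (F k z) * (2 * R) ^ k \<le> B"
    by (rule expansion_coeff_bound[OF f]) (use R z in \<open>auto intro!: B\<close>)
  then have "R ^ k * cmod (F k z) \<le> B * (1/2) ^ k"
    by (simp add: power_mult_distrib field_simps)
  then have "C * (R ^ k * cmod (F k z)) \<le> C * (B * (1/2) ^ k)"
    using C by (simp add: mult_left_mono)
  moreover have "\<bar>c k\<bar> * cmod (F k z) \<le> C * R ^ k * cmod (F k z)"
    using c by (intro mult_right_mono) auto
  ultimately show ?thesis by (simp add: norm_mult mult_ac)
qed

lemma multiplier_expansion:
  assumes f: "expansion f F" and c: "exp_bounded c"
  shows "expansion (multiplier c F) (\<lambda>k z. of_real (c k) * F k z)"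
proof -
  obtain C R where C: "C > 0" and R: "R > 0" and cb: "\<And>k. \<bar>c k\<bar> \<le> C * R ^ k"
    using c unfolding exp_bounded_def by blast
  have sh: "slice_holomorphic f" "\<And>k. slice_holomorphic (F k)"
    using f by (auto simp: expansion_def)
  have lim: "uniform_limit (cball 0 \<rho>) (\<lambda>m z. \<Sum>k<m. of_real (c k) * F k z) (multiplier c F) sequentially"
    and summ: "z \<in> cball 0 \<rho> \<Longrightarrow> summable (\<lambda>k. of_real (c k) * F k z)" for \<rho> z
  proof -
    obtain B where B: "B > 0" "\<And>w. norm w \<le> 2 * R * \<rho> \<Longrightarrow> cmod (f w) \<le> B"
      using slice_holomorphic_bounded[OF sh(1)] by blast
    have bd: "cmod (of_real (c k) * F k z) \<le> C * B * (1/2) ^ k" if "z \<in> cball 0 \<rho>" for k z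
      by (rule multiplier_terms_bound[OF f cb C R B(2)]) (use that in auto)
    have sm: "summable (\<lambda>k. C * B * (1/2) ^ k)"
      by (intro summable_mult summable_geometric) auto
    show "uniform_limit (cball 0 \<rho>) (\<lambda>m z. \<Sum>k<m. of_real (c k) * F k z) (multiplier c F) sequentially"
      unfolding multiplier_def using bd sm by (rule Weierstrass_m_test)
    show "summable (\<lambda>k. of_real (c k) * F k z)" if "z \<in> cball 0 \<rho>"
      using bd[OF that] sm by (rule summable_comparison_test'[rotated, where N=0])
  qed
  show ?thesis
    unfolding expansion_def
  proof (intro conjI allI)
    show "slice_holomorphic (multiplier c F)"
      by (rule slice_holomorphic_uniform_limit[OF _ lim])
         (intro slice_holomorphic_sum slice_holomorphic_cmult sh)
    show "(\<lambda>k. of_real (c k) * F k z) sums multiplier c F z" for z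
      unfolding multiplier_def using summ[of z "norm z"] by (simp add: summable_sums)
  qed (use f in \<open>auto simp: expansion_def intro: slice_holomorphic_cmult\<close>)
qed

lemma multiplier_cont:
  assumes "expansion f F" "exp_bounded c"
  shows "continuous_on S (multiplier c F)"
  using multiplier_expansion[OF assms] slice_holomorphic_cont unfolding expansion_def by blast

lemma multiplier_sums:
  assumes "expansion f F" "exp_bounded c"
  shows "(\<lambda>k. of_real (c k) * F k z) sums multiplier c F z"
  using multiplier_expansion[OF assms] unfolding expansion_def by blast

lemma multiplier_multiplier:
  "multiplier c (\<lambda>k z. of_real (d k) * F k z) = multiplier (\<lambda>k. c k * d k) F"
  by (simp add: multiplier_def fun_eq_iff mult.assoc)

lemma multiplier_add:
  assumes "expansion f F" "exp_bounded c" "exp_bounded d"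
  shows "multiplier (\<lambda>k. c k + d k) F z = multiplier c F z + multiplier d F z"
  using sums_unique[OF sums_add[OF multiplier_sums[OF assms(1,2)] multiplier_sums[OF assms(1,3)]]]
  by (simp add: multiplier_def algebra_simps)

lemma exp_boundedI: "C > 0 \<Longrightarrow> R > 0 \<Longrightarrow> (\<And>k. \<bar>c k\<bar> \<le> C * R ^ k) \<Longrightarrow> exp_bounded c"
  unfolding exp_bounded_def by blast

lemma exp_bounded_mult:
  assumes "exp_bounded c" "exp_bounded d"
  shows "exp_bounded (\<lambda>k. c k * d k)"
proof -
  obtain C R C' R' where *: "C > 0" "R > 0" "\<And>k. \<bar>c k\<bar> \<le> C * R ^ k"
      "C' > 0" "R' > 0" "\<And>k. \<bar>d k\<bar> \<le> C' * R' ^ k"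
    using assms unfolding exp_bounded_def by blast
  have "\<bar>c k * d k\<bar> \<le> (C * R ^ k) * (C' * R' ^ k)" for k
    unfolding abs_mult using * by (intro mult_mono) auto
  then show ?thesis using *
    by (intro exp_boundedI[of "C * C'" "R * R'"]) (auto simp: power_mult_distrib mult_ac)
qed

lemma exp_bounded_add:
  assumes "exp_bounded c" "exp_bounded d"
  shows "exp_bounded (\<lambda>k. c k + d k)"
proof -
  obtain C R C' R' where *: "C > 0" "R > 0" "\<And>k. \<bar>c k\<bar> \<le> C * R ^ k"
      "C' > 0" "R' > 0" "\<And>k. \<bar>d k\<bar> \<le> C' * R' ^ k"
    using assms unfolding exp_bounded_def by blast
  have "\<bar>c k + d k\<bar> \<le> (C + C') * (max R R') ^ k" for k
  proof -
    have "C * R ^ k \<le> C * max R R' ^ k" "C' * R' ^ k \<le> C' * max R R' ^ k"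
      using * by (auto intro!: mult_left_mono power_mono)
    then show ?thesis using *(3)[of k] *(6)[of k] by (simp add: algebra_simps)
  qed
  then show ?thesis using *
    by (intro exp_boundedI[of "C + C'" "max R R'"]) auto
qed

section \<open>Existence of the homogeneous expansion\<close>

definition taylor_part :: "(complex^'n \<Rightarrow> complex) \<Rightarrow> nat \<Rightarrow> complex^'n \<Rightarrow> complex" where
  "taylor_part f k z = (deriv ^^ k) (\<lambda>\<zeta>. f (\<zeta> *s z)) 0 / fact k"

lemma taylor_part_sums:
  assumes "slice_holomorphic f"
  shows "(\<lambda>k. taylor_part f k z * \<zeta> ^ k) sums f (\<zeta> *s z)"
  using holomorphic_power_series[OF slice_holomorphic_slice0[OF assms], of \<zeta> 0 "cmod \<zeta> + 1" z]
  by (simp add: taylor_part_def)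

lemma taylor_part_unique:
  assumes "\<And>\<zeta>. (\<lambda>k. a k * \<zeta> ^ k) sums f (\<zeta> *s z)"
  shows "taylor_part f k z = a k"
  unfolding taylor_part_def using power_series_unique_deriv[OF assms] by metis

lemma taylor_part_homogeneous:
  assumes "slice_holomorphic f"
  shows "taylor_part f k (t *s z) = t ^ k * taylor_part f k z"
proof (rule taylor_part_unique)
  show "(\<lambda>k. t ^ k * taylor_part f k z * \<zeta> ^ k) sums f (\<zeta> *s (t *s z))" for \<zeta>
    using taylor_part_sums[OF assms, of z "\<zeta> * t"] by (simp add: power_mult_distrib mult_ac)
qed

lemma taylor_part_bound:
  assumes "slice_holomorphic f" "\<And>w. norm w \<le> \<rho> \<Longrightarrow> cmod (f w) \<le> B" "norm z \<le> \<rho>"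
  shows "cmod (taylor_part f k z) \<le> B"
  using taylor_coeff_bound[OF slice_holomorphic_slice0[OF assms(1)], of 1 z B k] assms(2,3)
  by (simp add: taylor_part_def)

text \<open>Rescaling the Taylor remainder at \<open>\<epsilon> z\<close> leaves the k-th term plus
  higher terms carrying positive powers of \<open>\<epsilon>\<close>. All terms are bounded by
  \<open>B\<close>, and the geometric series of ratio \<open>1 / (m + 2)\<close> sums to
  \<open>B / (m + 1)\<close>. Each Taylor term is thus a locally uniform limit of expressions in
  \<open>f\<close> and the earlier terms. The offset 2 keeps the ratio below 1 already at
  \<open>m = 0\<close>.\<close>

lemma taylor_part_tail_bound:
  fixes f :: "complex^'n \<Rightarrow> complex" and m k :: nat
  assumes f: "slice_holomorphic f" and B: "\<And>w. norm w \<le> \<rho> \<Longrightarrow> cmod (f w) \<le> B"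
    and z: "norm z \<le> \<rho>"
  defines "\<epsilon> \<equiv> (1 / of_nat (m + 2) :: complex)"
  shows "cmod (of_nat (m + 2) ^ k * (f (\<epsilon> *s z) - (\<Sum>j<k. taylor_part f j z * \<epsilon> ^ j))
      - taylor_part f k z) \<le> B / real (m + 1)"
proof -
  let ?M = "of_nat (m + 2) :: complex"
  have M: "?M \<noteq> 0" by (metis of_nat_eq_0_iff add_is_0 zero_neq_numeral)
  have \<epsilon>: "cmod \<epsilon> = 1 / real (m + 2)" "?M * \<epsilon> = 1"
    using M by (simp_all only: \<epsilon>_def norm_divide norm_one norm_of_nat) auto
  have s: "(\<lambda>k. taylor_part f k z * \<epsilon> ^ k) sums f (\<epsilon> *s z)"
    by (rule taylor_part_sums[OF f])
  have "(\<lambda>i. taylor_part f (i + Suc k) z * \<epsilon> ^ (i + Suc k)) sums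
      (f (\<epsilon> *s z) - (\<Sum>j<Suc k. taylor_part f j z * \<epsilon> ^ j))"
    by (rule sums_split_initial_segment[OF s])
  from sums_mult[OF this, of "?M ^ k"]
  have "(\<lambda>i. ?M ^ k * (taylor_part f (i + Suc k) z * \<epsilon> ^ (i + Suc k))) sums
      (?M ^ k * (f (\<epsilon> *s z) - (\<Sum>j<Suc k. taylor_part f j z * \<epsilon> ^ j)))" .
  moreover have "?M ^ k * (taylor_part f (i + Suc k) z * \<epsilon> ^ (i + Suc k)) =
      taylor_part f (i + Suc k) z * \<epsilon> ^ Suc i" for i
  proof -
    have "?M ^ k * \<epsilon> ^ (i + Suc k) = (?M * \<epsilon>) ^ k * \<epsilon> ^ Suc i"
      by (simp add: power_add power_mult_distrib)
    then show ?thesis using \<epsilon>(2) by (metis mult.left_commute mult_1 power_one)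
  qed
  moreover have "?M ^ k * (f (\<epsilon> *s z) - (\<Sum>j<Suc k. taylor_part f j z * \<epsilon> ^ j)) =
      ?M ^ k * (f (\<epsilon> *s z) - (\<Sum>j<k. taylor_part f j z * \<epsilon> ^ j)) - taylor_part f k z"
  proof -
    have "?M ^ k * \<epsilon> ^ k = 1" using \<epsilon>(2) by (metis power_mult_distrib power_one)
    then have "?M ^ k * (taylor_part f k z * \<epsilon> ^ k) = taylor_part f k z"
      by (metis mult.left_commute mult.right_neutral)
    then show ?thesis by (simp add: algebra_simps)
  qed
  ultimately have s1: "(\<lambda>i. taylor_part f (i + Suc k) z * \<epsilon> ^ Suc i) sums
     (?M ^ k * (f (\<epsilon> *s z) - (\<Sum>j<k. taylor_part f j z * \<epsilon> ^ j)) - taylor_part f k z)"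
    by (simp only:)
  have lt: "\<bar>1 / real (m + 2)\<bar> < 1" by simp
  have s2: "(\<lambda>i. B * (1 / real (m + 2)) ^ Suc i) sums (B / real (m + 1))"
  proof -
    have "(\<lambda>i. (1 / real (m + 2)) ^ i) sums (1 / (1 - 1 / real (m + 2)))"
      using lt by (intro geometric_sums) auto
    from sums_mult[OF this, of "B * (1 / real (m + 2))"]
    have "(\<lambda>i. B * (1 / real (m + 2)) ^ Suc i) sums
        (B * (1 / real (m + 2)) * (1 / (1 - 1 / real (m + 2))))"
      by (simp only: power_Suc mult.assoc)
    moreover have "B * (1 / M) * (1 / (1 - 1 / M)) = B / (M - 1)" if "M > 1" for M :: real
      using that by (simp add: divide_simps)
    from this[of "real (m + 2)"]
    have "B * (1 / real (m + 2)) * (1 / (1 - 1 / real (m + 2))) = B / real (m + 1)"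
      by simp
    ultimately show ?thesis by (simp only:)
  qed
  have "cmod (taylor_part f (i + Suc k) z * \<epsilon> ^ Suc i) \<le> B * (1 / real (m + 2)) ^ Suc i" for i
    unfolding norm_mult norm_power \<epsilon>(1)
    by (intro mult_right_mono taylor_part_bound[OF f B z]) auto
  from norm_sums_le[OF s1 s2 this] show ?thesis .
qed

lemma slice_holomorphic_taylor_part:
  assumes f: "slice_holomorphic f"
  shows "slice_holomorphic (taylor_part f k)"
\<comment> \<open>Course-of-values induction, because the approximants \<open>g m\<close> of the
  k-th term contain all earlier terms.\<close>
proof (induction k rule: less_induct)
  case (less k)
  define \<epsilon> where "\<epsilon> m = (1 / of_nat (m + 2) :: complex)" for m
  define g where "g m z = of_nat (m + 2) ^ k * (f (\<epsilon> m *s z) - (\<Sum>j<k. taylor_part f j z * \<epsilon> m ^ j))"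
    for m z
  show ?case
  proof (rule slice_holomorphic_uniform_limit[of g])
    show "slice_holomorphic (g m)" for m
      unfolding g_def mult.commute[of _ "\<epsilon> m ^ _"]
      by (intro slice_holomorphic_cmult slice_holomorphic_diff slice_holomorphic_sum
            slice_holomorphic_dilation f less) auto
    show "uniform_limit (cball 0 \<rho>) g (taylor_part f k) sequentially" for \<rho>
    proof (rule uniform_limitI)
      fix e :: real assume "e > 0"
      obtain B where B: "B > 0" "\<And>w. norm w \<le> \<rho> \<Longrightarrow> cmod (f w) \<le> B"
        using slice_holomorphic_bounded[OF f] by blast
      have "(\<lambda>m. B / real (m + 1)) \<longlonglongrightarrow> 0"
        using LIMSEQ_Suc[OF lim_const_over_n[of B]] by simp
      then have "\<forall>\<^sub>F m in sequentially. B / real (m + 1) < e"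
        using \<open>e > 0\<close> by (rule order_tendstoD)
      then show "\<forall>\<^sub>F m in sequentially. \<forall>z\<in>cball 0 \<rho>. dist (g m z) (taylor_part f k z) < e"
      proof eventually_elim
        case (elim m)
        show ?case
        proof
          fix z assume "z \<in> cball (0 :: complex^'a) \<rho>"
          then have "dist (g m z) (taylor_part f k z) \<le> B / real (m + 1)"
            unfolding dist_norm g_def \<epsilon>_def
            by (intro taylor_part_tail_bound[OF f B(2)]) auto
          then show "dist (g m z) (taylor_part f k z) < e" using elim by simp
        qed
      qed
    qed
  qed
qed

lemma expansion_taylor_part:
  assumes "slice_holomorphic f"
  shows "expansion f (taylor_part f)"
  unfolding expansion_def
  using assms taylor_part_sums[OF assms, of _ 1]
  by (auto simp: slice_holomorphic_taylor_part taylor_part_homogeneous)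

section \<open>Homogeneous slice-holomorphic functions are polynomials, by interpolation\<close>

definition lagrange_poly :: "nat \<Rightarrow> nat \<Rightarrow> complex poly" where
  "lagrange_poly k x =
     (\<Prod>j\<in>{..k} - {x}. smult (1 / (of_nat x - of_nat j)) [:- of_nat j, 1:])"

lemma degree_lagrange_poly: "x \<le> k \<Longrightarrow> degree (lagrange_poly k x) \<le> k"
proof -
  assume x: "x \<le> k"
  have "degree (lagrange_poly k x) \<le>
      (\<Sum>j\<in>{..k} - {x}. degree (smult (1 / (of_nat x - of_nat j)) [:- of_nat j, 1 :: complex:]))"
    unfolding lagrange_poly_def
    by (rule order.trans[OF degree_prod_sum_le]) (auto simp: o_def)
  also have "\<dots> \<le> (\<Sum>j\<in>{..k} - {x}. 1)"
    by (intro sum_mono order.trans[OF degree_smult_le]) auto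
  also have "\<dots> = k" using x by simp
  finally show ?thesis .
qed

lemma poly_lagrange_poly:
  assumes "x \<le> k" "y \<le> k"
  shows "poly (lagrange_poly k x) (of_nat y) = (if x = y then 1 else 0)"
proof (cases "x = y")
  case True
  then show ?thesis
    by (auto simp: lagrange_poly_def poly_prod diff_divide_distrib[symmetric] intro!: prod.neutral)
next
  case False
  then have "\<exists>j\<in>{..k} - {x}. poly (smult (1 / (of_nat x - of_nat j)) [:- of_nat j, 1 :: complex:]) (of_nat y) = 0"
    using assms by (intro bexI[of _ y]) auto
  then have "poly (lagrange_poly k x) (of_nat y) = 0"
    unfolding lagrange_poly_def poly_prod by (intro prod_zero) auto
  then show ?thesis using False by simp
qed

lemma lagrange_interpolation:
  assumes "degree q \<le> k"
  shows "poly q \<zeta> = (\<Sum>x\<le>k. poly q (of_nat x) * poly (lagrange_poly k x) \<zeta>)"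
proof -
  define r where "r = (\<Sum>x\<le>k. smult (poly q (of_nat x)) (lagrange_poly k x))"
  have "q = r"
  proof (rule poly_eqI_degree[of "of_nat ` {..k}"])
    have card: "card (of_nat ` {..k} :: complex set) = Suc k"
      by (subst card_image) (auto simp: inj_on_def)
    have "degree r \<le> k"
      unfolding r_def using degree_lagrange_poly
      by (intro degree_sum_le order.trans[OF degree_smult_le]) auto
    then show "degree q < card (of_nat ` {..k} :: complex set)"
      "degree r < card (of_nat ` {..k} :: complex set)"
      using assms card by auto
    show "poly q x = poly r x" if x: "x \<in> of_nat ` {..k}" for x
    proof -
      obtain y where y: "x = of_nat y" "y \<le> k" using x by auto
      have "poly r x = (\<Sum>i\<le>k. if i = y then poly q (of_nat y) else 0)"
        unfolding r_def poly_sum y(1) using y(2)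
        by (intro sum.cong) (auto simp: poly_lagrange_poly)
      then show ?thesis using y by simp
    qed
  qed
  then have "poly q \<zeta> = poly r \<zeta>" by simp
  also have "\<dots> = (\<Sum>x\<le>k. poly q (of_nat x) * poly (lagrange_poly k x) \<zeta>)"
    by (simp add: r_def poly_sum)
  finally show ?thesis .
qed

text \<open>One coordinate after another is replaced by the nodes \<open>0..k\<close>. A function
  that is polynomial in each coordinate separately thus becomes a finite sum of products of
  one-variable polynomials, without partial derivatives.\<close>

lemma multivariate_lagrange_interpolation:
  fixes h :: "complex^'n \<Rightarrow> complex"
  assumes h: "\<And>z j. \<exists>q. degree q \<le> k \<and> (\<forall>\<zeta>. h (\<chi> i. if i = j then \<zeta> else z $ i) = poly q \<zeta>)"
    and S: "finite S"
  shows "h z = (\<Sum>x\<in>S \<rightarrow>\<^sub>E {..k}. h (\<chi> i. if i \<in> S then of_nat (x i) else z $ i)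
                * (\<Prod>i\<in>S. poly (lagrange_poly k (x i)) (z $ i)))"
  using S
proof (induction S arbitrary: z)
  case empty
  then show ?case by simp
next
  case (insert j S)
  \<comment> \<open>Interpolation in coordinate \<open>j\<close> alone; it is applied below at a
    point whose coordinates in \<open>S\<close> are already nodes.\<close>
  have one: "h w = (\<Sum>y\<le>k. h (\<chi> i. if i = j then of_nat y else w $ i)
      * poly (lagrange_poly k y) (w $ j))" for w
  proof -
    obtain q where q: "degree q \<le> k" "\<And>\<zeta>. h (\<chi> i. if i = j then \<zeta> else w $ i) = poly q \<zeta>"
      using h by blast
    have "(\<chi> i. if i = j then w $ j else w $ i) = w" by (simp add: vec_eq_iff)
    then have "h w = poly q (w $ j)" using q(2)[of "w $ j"] by (simp only:)
    then show ?thesis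
      using lagrange_interpolation[OF q(1), of "w $ j"] by (simp only: q(2))
  qed
  define G where "G x z = h (\<chi> i. if i \<in> insert j S then of_nat (x i) else z $ i)
                * (\<Prod>i\<in>insert j S. poly (lagrange_poly k (x i)) (z $ i))" for x z
  have G: "G (x(j := y)) z = h (\<chi> i. if i = j then of_nat y else
          (\<chi> i. if i \<in> S then of_nat (x i) else z $ i) $ i) * poly (lagrange_poly k y) (z $ j)
        * (\<Prod>i\<in>S. poly (lagrange_poly k (x i)) (z $ i))" for x y
  proof -
    have "(\<Prod>i\<in>S. poly (lagrange_poly k ((x(j := y)) i)) (z $ i)) =
        (\<Prod>i\<in>S. poly (lagrange_poly k (x i)) (z $ i))"
      using insert.hyps by (intro prod.cong) auto
    moreover have "(\<chi> i. if i \<in> insert j S then of_nat ((x(j := y)) i) else z $ i) =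
        (\<chi> i. if i = j then of_nat y else
          (\<chi> i. if i \<in> S then of_nat (x i) else z $ i) $ i)"
      by (auto simp: vec_eq_iff)
    ultimately show ?thesis using insert.hyps by (simp add: G_def)
  qed
  have "(\<Sum>x\<in>insert j S \<rightarrow>\<^sub>E {..k}. G x z) =
      (\<Sum>(y, x)\<in>{..k} \<times> (S \<rightarrow>\<^sub>E {..k}). G (x(j := y)) z)"
    unfolding PiE_insert_eq
    by (subst sum.reindex[OF inj_combinator])
       (use insert.hyps in \<open>auto intro!: sum.cong\<close>)
  also have "\<dots> = (\<Sum>x\<in>S \<rightarrow>\<^sub>E {..k}. \<Sum>y\<le>k. G (x(j := y)) z)"
    by (subst sum.cartesian_product[symmetric]) (rule sum.swap)
  also have "\<dots> = (\<Sum>x\<in>S \<rightarrow>\<^sub>E {..k}. h (\<chi> i. if i \<in> S then of_nat (x i) else z $ i)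
                * (\<Prod>i\<in>S. poly (lagrange_poly k (x i)) (z $ i)))"
  proof (rule sum.cong[OF refl])
    fix x
    define w where "w = (\<chi> i. if i \<in> S then of_nat (x i) else z $ i)"
    have "w $ j = z $ j" using insert.hyps by (simp add: w_def)
    then show "(\<Sum>y\<le>k. G (x(j := y)) z) = h (\<chi> i. if i \<in> S then of_nat (x i) else z $ i)
                * (\<Prod>i\<in>S. poly (lagrange_poly k (x i)) (z $ i))"
      unfolding G sum_distrib_right[symmetric] w_def[symmetric] using one[of w] by simp
  qed
  also have "\<dots> = h z" by (rule insert.IH[symmetric])
  finally show ?case by (simp only: G_def)
qed

lemma homogeneous_growth:
  assumes h: "slice_holomorphic h" and hom: "\<And>t z. h (t *s z) = t ^ k * h z"
  obtains B where "B > 0" "\<And>z. cmod (h z) \<le> B * norm z ^ k"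
proof -
  obtain B where B: "B > 0" "\<And>w. norm w \<le> 1 \<Longrightarrow> cmod (h w) \<le> B"
    using slice_holomorphic_bounded[OF h] by blast
  have "cmod (h z) \<le> B * norm z ^ k" for z
  proof (cases "z = 0")
    case True
    \<comment> \<open>For \<open>k = 0\<close> the convention \<open>0 ^ 0 = 1\<close> makes this
      the bound for a constant; for \<open>k > 0\<close> both sides vanish.\<close>
    have "cmod (h z) = 0 ^ k * cmod (h 0)"
      using hom[of 0 0] True by (metis norm_mult norm_power norm_zero vector_smult_rzero)
    also have "\<dots> \<le> 0 ^ k * B" using B by (intro mult_left_mono) auto
    finally show ?thesis using True by (simp add: mult.commute)
  next
    case False
    define w where "w = of_real (1 / norm z) *s z"
    have z: "z = of_real (norm z) *s w"
      using False by (simp add: w_def vector_smult_assoc flip: of_real_mult)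
    have "norm w = 1" using False unfolding w_def norm_smult_complex norm_of_real by simp
    then have "cmod (h w) \<le> B" using B by simp
    moreover have "cmod (h z) = norm z ^ k * cmod (h w)"
      by (subst z, subst hom) (simp add: norm_mult norm_power)
    ultimately show ?thesis by (simp add: mult.commute[of "norm z ^ k"] mult_right_mono)
  qed
  with B(1) show ?thesis by (rule that)
qed

text \<open>On a line parallel to a coordinate axis the growth is still at most of k-th power, so
  Liouville's theorem for polynomial growth applies.\<close>

lemma homogeneous_poly_in_coordinate:
  assumes h: "slice_holomorphic h" and hom: "\<And>t z. h (t *s z) = t ^ k * h z"
  shows "\<exists>q. degree q \<le> k \<and> (\<forall>\<zeta>. h (\<chi> i. if i = j then \<zeta> else z $ i) = poly q \<zeta>)"
proof -
  obtain B where B: "B > 0" "\<And>z. cmod (h z) \<le> B * norm z ^ k"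
    using homogeneous_growth[OF h hom] by blast
  define a where "a = (\<chi> i. if i = j then 0 else z $ i)"
  define g where "g \<zeta> = h (a + \<zeta> *s axis j 1)" for \<zeta>
  have eq: "(\<chi> i. if i = j then \<zeta> else z $ i) = a + \<zeta> *s axis j 1" for \<zeta>
    by (auto simp: a_def axis_def vec_eq_iff)
  have hol: "g holomorphic_on UNIV"
    unfolding g_def by (rule slice_holomorphic_slice[OF h])
  have "cmod (g \<zeta>) \<le> B * (norm a + 1) ^ k * cmod \<zeta> ^ k" if "1 \<le> cmod \<zeta>" for \<zeta>
  proof -
    have "norm (a + \<zeta> *s axis j 1) \<le> norm a + cmod \<zeta>"
      using norm_triangle_ineq[of a "\<zeta> *s axis j 1"] by (simp add: norm_smult_complex norm_axis_1)
    also have "norm a \<le> norm a * cmod \<zeta>" using that by (simp add: mult_left_le_imp_le mult_le_cancel_left1)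
    finally have "norm (a + \<zeta> *s axis j 1) \<le> (norm a + 1) * cmod \<zeta>" by (simp add: algebra_simps)
    then have "norm (a + \<zeta> *s axis j 1) ^ k \<le> ((norm a + 1) * cmod \<zeta>) ^ k" by (intro power_mono) auto
    then have "B * norm (a + \<zeta> *s axis j 1) ^ k \<le> B * ((norm a + 1) * cmod \<zeta>) ^ k"
      using B by (intro mult_left_mono) auto
    then show ?thesis using B(2)[of "a + \<zeta> *s axis j 1"] by (simp add: g_def power_mult_distrib mult.assoc)
  qed
  from Liouville_polynomial[OF hol this]
  have g: "g \<zeta> = (\<Sum>i\<le>k. (deriv ^^ i) g 0 / fact i * \<zeta> ^ i)" for \<zeta> .
  define q where "q = (\<Sum>i\<le>k. monom ((deriv ^^ i) g 0 / fact i) i)"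
  have "degree q \<le> k"
    unfolding q_def by (intro degree_sum_le) (auto intro: order.trans[OF degree_monom_le])
  moreover have "poly q \<zeta> = g \<zeta>" for \<zeta>
    by (subst g) (simp add: q_def poly_sum poly_monom)
  ultimately show ?thesis unfolding eq g_def by metis
qed

lemma poly_eq_sum_le:
  fixes x :: "'a :: comm_ring_1"
  assumes "degree q \<le> k"
  shows "poly q x = (\<Sum>i\<le>k. coeff q i * x ^ i)"
proof -
  have "poly q x = (\<Sum>i\<le>degree q. coeff q i * x ^ i)" by (rule poly_altdef)
  also have "\<dots> = (\<Sum>i\<le>k. coeff q i * x ^ i)"
    using assms by (intro sum.mono_neutral_left) (auto simp: coeff_eq_0)
  finally show ?thesis .
qed

text \<open>Interpolation gives a finite sum of monomials whose individual exponents are at most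
  \<open>k\<close> but whose total degree is not controlled; homogeneity removes every total degree
  other than \<open>k\<close>.\<close>

lemma homogeneous_polyI:
  fixes h :: "complex^'n \<Rightarrow> complex"
  assumes h: "slice_holomorphic h" and hom: "\<And>t z. h (t *s z) = t ^ k * h z"
  shows "homogeneous_poly k h"
proof -
  define A where "A = (UNIV :: 'n set) \<rightarrow>\<^sub>E {..k}"
  have finA: "finite A" unfolding A_def by (intro finite_PiE) auto
  define c where "c m = (\<Sum>x\<in>A. h (\<chi> i. of_nat (x i)) * (\<Prod>i\<in>UNIV. coeff (lagrange_poly k (x i)) (m i)))" for m
  have rep: "h z = (\<Sum>m\<in>A. c m * (\<Prod>i\<in>UNIV. (z $ i) ^ m i))" for z
  proof -
    have "h z = (\<Sum>x\<in>A. h (\<chi> i. of_nat (x i)) * (\<Prod>i\<in>UNIV. poly (lagrange_poly k (x i)) (z $ i)))"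
      using multivariate_lagrange_interpolation[OF homogeneous_poly_in_coordinate[OF h hom], of UNIV z]
      by (simp add: A_def)
    also have "\<dots> = (\<Sum>x\<in>A. \<Sum>m\<in>A. h (\<chi> i. of_nat (x i)) *
        (\<Prod>i\<in>UNIV. coeff (lagrange_poly k (x i)) (m i) * (z $ i) ^ m i))"
    proof (rule sum.cong[OF refl])
      fix x assume x: "x \<in> A"
      have "(\<Prod>i\<in>UNIV. poly (lagrange_poly k (x i)) (z $ i)) =
          (\<Prod>i\<in>UNIV. \<Sum>m\<le>k. coeff (lagrange_poly k (x i)) m * (z $ i) ^ m)"
        using x by (intro prod.cong refl poly_eq_sum_le degree_lagrange_poly) (auto simp: A_def)
      also have "\<dots> = (\<Sum>m\<in>A. \<Prod>i\<in>UNIV. coeff (lagrange_poly k (x i)) (m i) * (z $ i) ^ m i)"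
        unfolding A_def by (rule prod_sum_PiE) auto
      finally show "h (\<chi> i. of_nat (x i)) * (\<Prod>i\<in>UNIV. poly (lagrange_poly k (x i)) (z $ i)) =
        (\<Sum>m\<in>A. h (\<chi> i. of_nat (x i)) *
          (\<Prod>i\<in>UNIV. coeff (lagrange_poly k (x i)) (m i) * (z $ i) ^ m i))"
        by (simp add: sum_distrib_left)
    qed
    also have "\<dots> = (\<Sum>m\<in>A. c m * (\<Prod>i\<in>UNIV. (z $ i) ^ m i))"
      by (subst sum.swap) (simp add: c_def sum_distrib_right prod.distrib mult.assoc)
    finally show ?thesis .
  qed
  have "h z = (\<Sum>m | (\<Sum>i\<in>UNIV. m i) = k. c m * (\<Prod>i\<in>UNIV. (z $ i) ^ m i))" for z
  proof -
    \<comment> \<open>A polynomial in \<open>t\<close> comparing the monomial sum at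
      \<open>t z\<close> with \<open>t ^ k * h z\<close>. It vanishes identically, and its
      coefficient at \<open>k\<close> isolates the monomials of total degree
      \<open>k\<close>.\<close>
    define Q where "Q = (\<Sum>m\<in>A. monom (c m * (\<Prod>i\<in>UNIV. (z $ i) ^ m i)) (\<Sum>i\<in>UNIV. m i))
        - monom (h z) k"
    have "poly Q t = 0" for t
    proof -
      have "t ^ k * h z = (\<Sum>m\<in>A. c m * (\<Prod>i\<in>UNIV. (z $ i) ^ m i) * t ^ (\<Sum>i\<in>UNIV. m i))"
        unfolding hom[symmetric] rep[of "t *s z"]
        by (simp add: power_mult_distrib prod.distrib power_sum mult_ac)
      then show ?thesis by (simp add: Q_def poly_sum poly_monom mult.commute)
    qed
    then have "Q = 0" using poly_all_0_iff_0 by blast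
    then have "coeff Q k = 0" by simp
    then have "h z = (\<Sum>m\<in>A. if (\<Sum>i\<in>UNIV. m i) = k then c m * (\<Prod>i\<in>UNIV. (z $ i) ^ m i) else 0)"
      by (simp add: Q_def coeff_sum coeff_monom)
    also have "\<dots> = (\<Sum>m\<in>A \<inter> {m. (\<Sum>i\<in>UNIV. m i) = k}. c m * (\<Prod>i\<in>UNIV. (z $ i) ^ m i))"
      using finA by (subst sum.inter_restrict) (auto intro!: sum.cong)
    \<comment> \<open>No monomial of total degree \<open>k\<close> is lost: each exponent is at most
      the sum of all of them, so the multi-index lies in \<open>A\<close>.\<close>
    also have "A \<inter> {m. (\<Sum>i\<in>UNIV. m i) = k} = {m. (\<Sum>i\<in>UNIV. m i) = k}"
    proof -
      have "m i \<le> (\<Sum>i\<in>UNIV. m i)" for m :: "'n \<Rightarrow> nat" and i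
        by (rule member_le_sum) auto
      then show ?thesis by (auto simp: A_def)
    qed
    finally show ?thesis .
  qed
  then show ?thesis unfolding homogeneous_poly_def by blast
qed

lemma homogeneous_poly_scale:
  assumes "homogeneous_poly k P"
  shows "P (t *s z) = t ^ k * P z"
proof -
  obtain c where P: "\<And>z. P z = (\<Sum>m | (\<Sum>i\<in>UNIV. m i) = k. c m * (\<Prod>i\<in>UNIV. (z $ i) ^ m i))"
    using assms unfolding homogeneous_poly_def by blast
  show ?thesis
    unfolding P sum_distrib_left
    by (intro sum.cong) (auto simp: power_mult_distrib prod.distrib power_sum[symmetric])
qed

lemma homogeneous_expansion_unique:
  assumes "homogeneous_expansion f F"
  shows "F = taylor_part f"
proof (intro ext)
  fix k z
  have "(\<lambda>k. F k z * \<zeta> ^ k) sums f (\<zeta> *s z)" for \<zeta>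
  proof -
    have "(\<lambda>k. F k (\<zeta> *s z)) sums f (\<zeta> *s z)" "\<And>k. F k (\<zeta> *s z) = \<zeta> ^ k * F k z"
      using assms homogeneous_poly_scale unfolding homogeneous_expansion_def by blast+
    then show ?thesis by (simp only: mult.commute)
  qed
  then show "F k z = taylor_part f k z" by (rule taylor_part_unique[symmetric])
qed

text \<open>Existence and uniqueness together evaluate the definite description behind
  \<open>hom_part\<close>.\<close>

lemma hom_part_entire:
  assumes "entire f"
  shows "hom_part f = taylor_part f"
proof -
  have f: "slice_holomorphic f" by (rule entire_imp_slice_holomorphic[OF assms])
  have "homogeneous_expansion f (taylor_part f)"
    unfolding homogeneous_expansion_def
    using expansion_taylor_part[OF f]
    by (auto simp: expansion_def intro!: homogeneous_polyI)
  then show ?thesis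
    unfolding hom_part_def using homogeneous_expansion_unique by (intro the_equality) auto
qed

lemma expansion_hom_part: "entire f \<Longrightarrow> expansion f (hom_part f)"
  by (simp add: hom_part_entire expansion_taylor_part entire_imp_slice_holomorphic)

section \<open>Sub-mean value inequalities\<close>

lemma distr_lborel_Complex:
  "distr (lborel :: (real^2) measure) borel (\<lambda>x. Complex (x $ 1) (x $ 2)) = lborel"
proof (rule lborel_eqI[symmetric])
  have [measurable]: "(\<lambda>x :: real^2. Complex (x $ 1) (x $ 2)) \<in> borel_measurable borel"
    by (intro borel_measurable_continuous_onI continuous_intros)
  fix l u :: complex assume le: "\<And>b. b \<in> Basis \<Longrightarrow> l \<bullet> b \<le> u \<bullet> b"
  define l' u' where "l' = (vector [Re l, Im l] :: real^2)" and "u' = (vector [Re u, Im u] :: real^2)"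
  have Basis2: "(Basis :: (real^2) set) = {axis 1 1, axis 2 1}"
    by (auto simp: Basis_vec_def UNIV_2)
  have "(\<lambda>x :: real^2. Complex (x $ 1) (x $ 2)) -` box l u = box l' u'"
    by (auto simp: box_def Basis2 Basis_complex_def l'_def u'_def vector_2 inner_axis)
  moreover have "emeasure lborel (box l' u') = (\<Prod>b\<in>Basis. (u' - l') \<bullet> b)"
    using le[of 1] le[of \<i>]
    by (intro emeasure_lborel_box)
       (auto simp: Basis2 l'_def u'_def vector_2 inner_axis Basis_complex_def)
  moreover have "(\<Prod>b\<in>Basis. (u' - l') \<bullet> b) = (\<Prod>b\<in>Basis. (u - l) \<bullet> b)"
    by (simp add: Basis2 Basis_complex_def axis_eq_axis l'_def u'_def inner_axis)
  ultimately show "emeasure (distr lborel borel (\<lambda>x :: real^2. Complex (x $ 1) (x $ 2))) (box l u) =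
      (\<Prod>b\<in>Basis. (u - l) \<bullet> b)"
    by (simp add: emeasure_distr)
qed simp

text \<open>Multiplication by a unit complex number is an orthogonal map of the plane, so invariance
  is transported from \<open>real^2\<close> through the coordinate map \<open>J\<close>.\<close>

lemma emeasure_lborel_rotation_complex:
  assumes u: "cmod u = 1" and A: "A \<in> sets borel"
  shows "emeasure lborel ((\<lambda>z. u * z) -` A) = emeasure lborel A"
proof -
  have "distr lborel borel (\<lambda>z. u * z) = (lborel :: complex measure)"
  proof (rule lborel_eqI[symmetric])
    fix a b :: complex assume le: "\<And>x. x \<in> Basis \<Longrightarrow> a \<bullet> x \<le> b \<bullet> x"
    define J where "J = (\<lambda>x :: real^2. Complex (x $ 1) (x $ 2))"
    define K where "K = (\<lambda>z. vector [Re z, Im z] :: real^2)"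
    have JK: "J (K z) = z" "K (J x) = x" for x z
      by (auto simp: J_def K_def vector_2 vec_eq_iff forall_2)
    have [measurable]: "J \<in> borel_measurable borel"
      unfolding J_def by (intro borel_measurable_continuous_onI continuous_intros)
    have [measurable]: "(\<lambda>z. u * z) \<in> borel_measurable borel"
      by (intro borel_measurable_continuous_onI continuous_intros)
    have em: "emeasure lborel B = emeasure lborel (J -` B)" if "B \<in> sets borel" for B
      using that by (subst distr_lborel_Complex[symmetric]) (simp add: emeasure_distr J_def[symmetric])
    define R where "R x = K (cnj u * J x)" for x
    have orth: "orthogonal_transformation R"
      unfolding orthogonal_transformation
    proof
      show "linear R"
        by (rule linearI) (auto simp: R_def K_def J_def vec_eq_iff forall_2 algebra_simps)
      have nK: "norm (K z) = cmod z" for z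
        by (simp add: norm_vec_def L2_set_def K_def UNIV_2 cmod_def)
      have "norm x = cmod (J x)" for x using nK[of "J x"] by (simp add: JK)
      then show "\<forall>v. norm (R v) = norm v" by (simp add: R_def norm_mult u JK)
    qed
    have uu: "u * (cnj u * z) = z" "cnj u * (u * z) = z" for z
      using u complex_norm_square[of u] by (simp_all add: mult.assoc[symmetric] mult.commute[of "cnj u"])
    have img: "J -` ((\<lambda>z. u * z) -` box a b) = R ` (J -` box a b)"
    proof (intro set_eqI iffI)
      fix x assume "x \<in> J -` ((\<lambda>z. u * z) -` box a b)"
      then have "K (u * J x) \<in> J -` box a b" "x = R (K (u * J x))"
        by (auto simp: JK R_def uu)
      then show "x \<in> R ` (J -` box a b)" by blast
    qed (auto simp: JK R_def uu)
    have Jbox: "J -` box a b = box (K a) (K b)"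
      by (auto simp: box_def Basis_vec_def UNIV_2 Basis_complex_def J_def K_def vector_2 inner_axis)
    have meas: "box (K a) (K b) \<in> lmeasurable" by simp
    have "emeasure lborel ((\<lambda>z. u * z) -` box a b) = emeasure lborel (J -` ((\<lambda>z. u * z) -` box a b))"
      by (intro em measurable_sets_borel[of _ borel]) auto
    also have "J -` ((\<lambda>z. u * z) -` box a b) = R ` box (K a) (K b)"
      unfolding img Jbox ..
    also have "emeasure lborel (R ` box (K a) (K b)) = emeasure lebesgue (R ` box (K a) (K b))"
    proof -
      have "J -` ((\<lambda>z. u * z) -` box a b) \<in> sets borel"
        by (intro measurable_sets_borel[of _ borel]) auto
      then show ?thesis by (simp add: img Jbox)
    qed
    also have "\<dots> = emeasure lebesgue (box (K a) (K b))"
      using measurable_orthogonal_image[OF orth meas] measure_orthogonal_image[OF orth meas] meas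
      by (simp add: emeasure_eq_measure2 fmeasurableD2)
    also have "\<dots> = emeasure lborel (J -` box a b)" by (simp add: Jbox)
    also have "\<dots> = emeasure lborel (box a b)" by (intro em[symmetric]) auto
    also have "\<dots> = (\<Prod>x\<in>Basis. (b - a) \<bullet> x)" using le by simp
    finally show "emeasure (distr lborel borel (\<lambda>z. u * z)) (box a b) = (\<Prod>x\<in>Basis. (b - a) \<bullet> x)"
      by (simp add: emeasure_distr)
  qed simp
  then have "emeasure lborel A = emeasure (distr lborel borel (\<lambda>z. u * z)) A" by simp
  also have "\<dots> = emeasure lborel ((\<lambda>z. u * z) -` A)"
    using A by (subst emeasure_distr) (auto intro!: borel_measurable_continuous_onI continuous_intros)
  finally show ?thesis by simp
qed

lemma measurable_vec_lambda_complex [measurable]: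
  "(\<lambda>x. \<chi> i. x i) \<in> measurable (\<Pi>\<^sub>M i\<in>(UNIV :: 'n set). lborel) (borel :: (complex^'n) measure)"
  by (subst borel_measurable_euclidean_space) (auto simp: Basis_vec_def inner_axis)

text \<open>Scalar multiplication acts on each complex coordinate separately, so a product
  representation over the coordinates reduces rotation invariance to the plane.\<close>

lemma lborel_vec_complex:
  "distr (\<Pi>\<^sub>M i\<in>(UNIV :: 'n set). lborel) borel (\<lambda>x. \<chi> i. x i) = (lborel :: (complex^'n) measure)"
proof (rule lborel_eqI[symmetric])
  interpret product_sigma_finite "\<lambda>_ :: 'n. lborel :: complex measure" ..
  fix l u :: "complex^'n" assume le: "\<And>b. b \<in> Basis \<Longrightarrow> l \<bullet> b \<le> u \<bullet> b"
  have le': "l $ i \<bullet> b \<le> u $ i \<bullet> b" if "b \<in> Basis" for i b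
    using le[of "axis i b"] that by (auto simp: Basis_vec_def inner_axis)
  have "(\<lambda>x. \<chi> i. x i) -` box l u \<inter> space (\<Pi>\<^sub>M i\<in>(UNIV :: 'n set). lborel :: complex measure) =
      (\<Pi>\<^sub>E i\<in>UNIV. box (l $ i) (u $ i))"
    by (auto simp: box_def Basis_vec_def inner_axis space_PiM PiE_UNIV_domain)
  then have "emeasure (distr (\<Pi>\<^sub>M i\<in>(UNIV :: 'n set). lborel) borel (\<lambda>x. \<chi> i. x i)) (box l u) =
      (\<Prod>i\<in>UNIV. emeasure lborel (box (l $ i) (u $ i)))"
    by (simp add: emeasure_distr emeasure_PiM)
  also have "\<dots> = ennreal (\<Prod>i\<in>UNIV. \<Prod>b\<in>Basis. (u $ i - l $ i) \<bullet> b)"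
    using le' by (simp add: prod_ennreal prod_nonneg inner_diff_left)
  also have "(\<Prod>i\<in>UNIV. \<Prod>b\<in>Basis. (u $ i - l $ i) \<bullet> b) = (\<Prod>b\<in>Basis. (u - l) \<bullet> b)"
  proof -
    have "(\<Prod>b\<in>Basis. (u - l) \<bullet> b) = (\<Prod>b\<in>(\<Union>i\<in>UNIV. (\<lambda>b. axis i b) ` Basis). (u - l) \<bullet> b)"
      by (intro prod.cong) (auto simp: Basis_vec_def)
    also have "\<dots> = (\<Prod>i\<in>UNIV. \<Prod>b\<in>(\<lambda>b. axis i b) ` Basis. (u - l) \<bullet> b)"
      by (intro prod.UNION_disjoint) (auto simp: axis_eq_axis nonzero_Basis)
    also have "\<dots> = (\<Prod>i\<in>UNIV. \<Prod>b\<in>Basis. (u $ i - l $ i) \<bullet> b)"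
      by (intro prod.cong refl, subst prod.reindex) (auto simp: inj_on_def axis_eq_axis inner_axis nonzero_Basis)
    finally show ?thesis by simp
  qed
  finally show "emeasure (distr (\<Pi>\<^sub>M i\<in>(UNIV :: 'n set). lborel) borel (\<lambda>x. \<chi> i. x i)) (box l u) =
      (\<Prod>b\<in>Basis. (u - l) \<bullet> b)" .
qed simp

lemma distr_lborel_smult:
  assumes u: "cmod u = 1"
  shows "distr lborel borel (\<lambda>z. u *s z) = (lborel :: (complex^'n) measure)"
proof -
  interpret product_sigma_finite "\<lambda>_ :: 'n. lborel :: complex measure" ..
  let ?P = "\<Pi>\<^sub>M i\<in>(UNIV :: 'n set). lborel :: complex measure"
  let ?m = "\<lambda>x :: 'n \<Rightarrow> complex. \<lambda>i\<in>UNIV. u * x i"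
  have [measurable]: "(\<lambda>z :: complex^'n. u *s z) \<in> borel_measurable borel"
    by (intro borel_measurable_continuous_onI continuous_intros)
  have [measurable]: "?m \<in> measurable ?P ?P"
    by measurable
  have rot: "distr ?P ?P ?m = ?P"
  proof (rule PiM_eqI)
    fix A :: "'n \<Rightarrow> complex set" assume A: "\<And>i. i \<in> UNIV \<Longrightarrow> A i \<in> sets lborel"
    have "?m -` Pi\<^sub>E UNIV A \<inter> space ?P = (\<Pi>\<^sub>E i\<in>UNIV. (\<lambda>z. u * z) -` A i)"
      by (auto simp: space_PiM PiE_UNIV_domain)
    moreover have "(\<lambda>z. u * z) -` A i \<in> sets borel" for i
      using A by (intro measurable_sets_borel[of _ borel] borel_measurable_continuous_onI continuous_intros) auto
    moreover have "Pi\<^sub>E UNIV A \<in> sets ?P" using A by (intro sets_PiM_I_finite) auto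
    ultimately show "emeasure (distr ?P ?P ?m) (Pi\<^sub>E UNIV A) = (\<Prod>i\<in>UNIV. emeasure lborel (A i))"
      using A by (simp add: emeasure_distr emeasure_PiM emeasure_lborel_rotation_complex[OF u])
  qed auto
  have "distr lborel borel (\<lambda>z :: complex^'n. u *s z) = distr ?P borel (\<lambda>x. u *s (\<chi> i. x i))"
    by (subst lborel_vec_complex[symmetric]) (simp add: distr_distr o_def)
  also have "\<dots> = distr ?P borel (\<lambda>x. \<chi> i. ?m x i)"
    by (intro distr_cong refl) (auto simp: vec_eq_iff)
  also have "\<dots> = distr (distr ?P ?P ?m) borel (\<lambda>x. \<chi> i. x i)"
    by (subst distr_distr) (auto simp: o_def)
  also have "\<dots> = lborel" unfolding rot by (rule lborel_vec_complex)
  finally show ?thesis .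
qed

lemma nn_integral_lborel_smult:
  fixes g :: "complex^'n \<Rightarrow> ennreal"
  assumes u: "cmod u = 1" and g: "g \<in> borel_measurable borel"
  shows "(\<integral>\<^sup>+w. g (u *s w) \<partial>lborel) = (\<integral>\<^sup>+w. g w \<partial>lborel)"
proof -
  have "(\<lambda>z :: complex^'n. u *s z) \<in> borel_measurable borel"
    by (intro borel_measurable_continuous_onI continuous_intros)
  then show ?thesis
    using g by (subst (2) distr_lborel_smult[OF u, symmetric]) (simp add: nn_integral_distr)
qed

section \<open>From circle averages to averages over balls\<close>

lemma holomorphic_mean_value_le:
  assumes g: "g holomorphic_on UNIV"
  shows "ennreal (cmod (g 0)) \<le>
    (\<integral>\<^sup>+t. ennreal (cmod (g (exp (2 * of_real pi * \<i> * of_real t)))) * indicator {0..1} t \<partial>lborel)"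
proof -
  let ?h = "\<lambda>t::real. g (exp (2 * of_real pi * \<i> * of_real t))"
  have cont: "continuous_on A ?h" for A
    by (intro continuous_on_compose2[OF holomorphic_on_imp_continuous_on[OF g]] continuous_intros) auto
  have "((\<lambda>u. g u / (u - 0)) has_contour_integral (2 * of_real pi * \<i> * g 0)) (circlepath 0 1)"
    by (rule Cauchy_integral_circlepath_simple) (auto intro: holomorphic_on_subset[OF g])
  then have "((\<lambda>t. 2 * of_real pi * \<i> * ?h t) has_integral (2 * of_real pi * \<i> * g 0)) {0..1}"
    unfolding has_contour_integral_def
    by (rule has_integral_eq[rotated])
       (auto simp: vector_derivative_circlepath01, simp add: circlepath mult_ac)
  from has_integral_mult_right[OF this, of "1 / (2 * of_real pi * \<i>)"]
  have hi: "(?h has_integral g 0) {0..1}" by simp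
  have "cmod (g 0) \<le> integral {0..1} (\<lambda>t. cmod (?h t))"
    using integral_norm_bound_integral[of ?h "{0..1}" "\<lambda>t. cmod (?h t)"] integral_unique[OF hi]
    by (metis cont continuous_on_norm integrable_continuous_real order_refl)
  also have "ennreal (integral {0..1} (\<lambda>t. cmod (?h t))) =
      (\<integral>\<^sup>+t. ennreal (cmod (?h t)) * indicator {0..1} t \<partial>lborel)"
    by (rule nn_integral_has_integral_lebesgue'[symmetric])
       (auto intro!: integrable_integral integrable_continuous_real continuous_intros cont)
  finally show ?thesis by (simp add: ennreal_leI)
qed

text \<open>The circle inequality holds on the line through \<open>z\<close> in every direction
  \<open>w\<close> of the centred ball. After integrating over \<open>w\<close> and swapping the
  integrals, each \<open>t\<close> contributes the same integral, because ball and measure are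
  invariant under unit scalars.\<close>

lemma mean_value_ball:
  fixes f :: "complex^'n \<Rightarrow> complex"
  assumes f: "slice_holomorphic f" and R: "R > 0"
  shows "ennreal (cmod (f z)) * emeasure lborel (ball z R) \<le>
    (\<integral>\<^sup>+w. ennreal (cmod (f w)) * indicator (ball z R) w \<partial>lborel)"
proof -
  let ?e = "\<lambda>t::real. exp (2 * of_real pi * \<i> * of_real t)"
  have fm [measurable]: "f \<in> borel_measurable borel"
    by (intro borel_measurable_continuous_onI slice_holomorphic_cont f)
  have [measurable]: "ball c R \<in> sets borel" for c :: "complex^'n" by simp
  have tr: "(\<integral>\<^sup>+w. g w * indicator (ball z R) w \<partial>lborel) = (\<integral>\<^sup>+w. g (z + w) * indicator (ball 0 R) w \<partial>lborel)"
    if [measurable]: "g \<in> borel_measurable borel" for g :: "complex^'n \<Rightarrow> ennreal"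
    by (subst lborel_distr_plus[of z, symmetric])
       (auto simp: nn_integral_distr indicator_def dist_norm intro!: nn_integral_cong)
  have "(\<lambda>(t, w). f (z + ?e t *s w)) \<in> borel_measurable (borel :: (real \<times> (complex^'n)) measure)"
    unfolding case_prod_unfold
    by (intro borel_measurable_continuous_onI continuous_on_compose2[OF slice_holomorphic_cont[OF f, of UNIV]]
          continuous_intros) auto
  then have "(\<lambda>(t, w). f (z + ?e t *s w)) \<in> borel_measurable (borel \<Otimes>\<^sub>M borel)"
    by (simp add: borel_prod)
  then have joint: "(\<lambda>(t, w). ennreal (cmod (f (z + ?e t *s w))) * indicator {0..1} t * indicator (ball 0 R) w)
      \<in> borel_measurable (lborel \<Otimes>\<^sub>M lborel)" (is "?H \<in> _")
  proof -
    define h where "h = (\<lambda>(t, w). f (z + ?e t *s w))"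
    assume "(\<lambda>(t, w). f (z + ?e t *s w)) \<in> borel_measurable (borel \<Otimes>\<^sub>M borel)"
    then have [measurable]: "h \<in> borel_measurable (borel \<Otimes>\<^sub>M borel)" by (simp add: h_def)
    have "?H = (\<lambda>x. ennreal (cmod (h x)) * indicator {0..1} (fst x) * indicator (ball 0 R) (snd x))"
      by (auto simp: h_def)
    moreover have [measurable]: "(\<lambda>x. indicator {0..1::real} (fst x) :: ennreal) \<in> borel_measurable (borel \<Otimes>\<^sub>M (borel :: (complex^'n) measure))"
      by (rule measurable_compose[OF measurable_fst]) simp
    moreover have [measurable]: "(\<lambda>x. indicator (ball 0 R) (snd x) :: ennreal) \<in> borel_measurable ((borel :: real measure) \<Otimes>\<^sub>M (borel :: (complex^'n) measure))"
      by (rule measurable_compose[OF measurable_snd]) (auto intro!: borel_measurable_indicator borel_open)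
    moreover have "(\<lambda>x. ennreal (cmod (h x)) * indicator {0..1} (fst x) * indicator (ball 0 R) (snd x))
        \<in> borel_measurable (borel \<Otimes>\<^sub>M borel)"
      by measurable
    ultimately show ?thesis by (simp cong: measurable_cong_sets sets_pair_measure_cong)
  qed
  have "ennreal (cmod (f z)) * emeasure lborel (ball z R) =
      (\<integral>\<^sup>+w. ennreal (cmod (f z)) * indicator (ball z R) w \<partial>lborel)"
    by (simp add: nn_integral_cmult_indicator)
  also have "\<dots> = (\<integral>\<^sup>+w. ennreal (cmod (f z)) * indicator (ball 0 R) w \<partial>(lborel :: (complex^'n) measure))"
    by (subst tr) auto
  also have "\<dots> \<le> (\<integral>\<^sup>+w. (\<integral>\<^sup>+t. ennreal (cmod (f (z + ?e t *s w))) * indicator {0..1} t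
      * indicator (ball 0 R) w \<partial>lborel) \<partial>lborel)"
  proof (rule nn_integral_mono)
    fix w :: "complex^'n"
    show "ennreal (cmod (f z)) * indicator (ball 0 R) w \<le>
       (\<integral>\<^sup>+t. ennreal (cmod (f (z + ?e t *s w))) * indicator {0..1} t * indicator (ball 0 R) w \<partial>lborel)"
      using holomorphic_mean_value_le[OF slice_holomorphic_slice[OF f, of z w UNIV]]
      by (auto simp: indicator_def)
  qed
  also have "\<dots> = (\<integral>\<^sup>+t. (\<integral>\<^sup>+w. ennreal (cmod (f (z + ?e t *s w))) * indicator {0..1} t
      * indicator (ball 0 R) w \<partial>lborel) \<partial>lborel)"
    by (rule lborel_pair.Fubini'[OF joint])
  also have "\<dots> = (\<integral>\<^sup>+t. indicator {0..1} t * (\<integral>\<^sup>+w. ennreal (cmod (f w)) * indicator (ball z R) w \<partial>lborel) \<partial>(lborel :: real measure))"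
  proof (rule nn_integral_cong)
    fix t :: real
    have e: "cmod (?e t) = 1" by (simp add: norm_exp_eq_Re)
    have "(\<integral>\<^sup>+w. ennreal (cmod (f (z + ?e t *s w))) * indicator {0..1} t * indicator (ball 0 R) w \<partial>lborel) =
      (\<integral>\<^sup>+w. indicator {0..1} t * (ennreal (cmod (f (z + ?e t *s w))) * indicator (ball 0 R) (?e t *s w)) \<partial>lborel)"
      by (intro nn_integral_cong) (auto simp: indicator_def norm_smult_complex e)
    also have "\<dots> = (\<integral>\<^sup>+w. indicator {0..1} t * (ennreal (cmod (f (z + w))) * indicator (ball 0 R) w) \<partial>lborel)"
      by (rule nn_integral_lborel_smult[OF e, of "\<lambda>w. indicator {0..1} t * (ennreal (cmod (f (z + w))) * indicator (ball 0 R) w)"])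
         measurable
    also have "\<dots> = indicator {0..1} t * (\<integral>\<^sup>+w. ennreal (cmod (f (z + w))) * indicator (ball 0 R) w \<partial>lborel)"
      by (rule nn_integral_cmult) measurable
    also have "(\<integral>\<^sup>+w. ennreal (cmod (f (z + w))) * indicator (ball 0 R) w \<partial>lborel) =
        (\<integral>\<^sup>+w. ennreal (cmod (f w)) * indicator (ball z R) w \<partial>lborel)"
      by (subst tr) auto
    finally show "(\<integral>\<^sup>+w. ennreal (cmod (f (z + ?e t *s w))) * indicator {0..1} t * indicator (ball 0 R) w \<partial>lborel) =
      indicator {0..1} t * (\<integral>\<^sup>+w. ennreal (cmod (f w)) * indicator (ball z R) w \<partial>lborel)" .
  qed
  also have "\<dots> = (\<integral>\<^sup>+w. ennreal (cmod (f w)) * indicator (ball z R) w \<partial>lborel)"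
    by (simp add: nn_integral_multc)
  finally show ?thesis .
qed

lemma emeasure_ball_complex_vec:
  "R > 0 \<Longrightarrow> emeasure lborel (ball (z :: complex^'n) R) =
     ennreal (unit_ball_vol (2 * real CARD('n)) * R powr (2 * real CARD('n)))"
proof -
  assume R: "R > 0"
  have d: "DIM(complex^'n) = 2 * CARD('n)" by simp
  have "R powr (2 * real CARD('n)) = R ^ (2 * CARD('n))"
    using powr_realpow[OF R, of "2 * CARD('n)"] by simp
  then show ?thesis using emeasure_ball[of R z] R unfolding d by (simp add: mult.commute)
qed

text \<open>For \<open>p \<le> 1\<close> the mean value inequality is applied at the maximum point of
  \<open>(R - |w - z|)\<^bsup>2n/p\<^esup> |f w|\<close>; this trades the factor \<open>|f|\<^bsup>1-p\<^esup>\<close> for a power of the maximum.\<close>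

lemma submean_powr_le_1:
  fixes f :: "complex^'n \<Rightarrow> complex" and p :: real
  assumes f: "slice_holomorphic f" and p: "0 < p" "p \<le> 1" and R: "R > 0"
  defines "D \<equiv> 2 * real CARD('n)"
  shows "ennreal (cmod (f z) powr p * R powr D) \<le> ennreal (2 powr (D / p) / unit_ball_vol D) *
    (\<integral>\<^sup>+w. ennreal (cmod (f w) powr p) * indicator (ball z R) w \<partial>lborel)"
proof -
  define \<omega> where "\<omega> = unit_ball_vol D"
  have D: "D > 0" by (simp add: D_def)
  have \<omega>: "\<omega> > 0" unfolding \<omega>_def using D by (intro unit_ball_vol_pos) auto
  define h where "h w = (R - norm (w - z)) powr (D / p) * cmod (f w)" for w
  have fm [measurable]: "f \<in> borel_measurable borel"
    by (intro borel_measurable_continuous_onI slice_holomorphic_cont f)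
  have [measurable]: "ball c r \<in> sets borel" for c :: "complex^'n" and r by simp
  have "continuous_on (cball z R) h"
    unfolding h_def using D p
    by (intro continuous_intros continuous_on_powr' slice_holomorphic_cont f)
       (auto simp: dist_norm norm_minus_commute)
  then obtain w0 where w0: "w0 \<in> cball z R" "\<And>w. w \<in> cball z R \<Longrightarrow> h w \<le> h w0"
    using continuous_attains_sup[of "cball z R" h] R by (auto simp: less_imp_le)
  define S where "S = h w0"
  have hz: "h z \<le> S" unfolding S_def using R by (intro w0) auto
  have hz_eq: "h z powr p = cmod (f z) powr p * R powr D"
    using R p by (simp add: h_def powr_mult powr_powr mult.commute)
  have S0: "S \<ge> 0" by (simp add: S_def h_def)
  show ?thesis
  proof (cases "S = 0")
    case True
    moreover have "h z \<ge> 0" by (simp add: h_def)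
    ultimately have "h z = 0" using hz by linarith
    then show ?thesis unfolding hz_eq[symmetric] using p by simp
  next
    case False
    then have S: "S > 0" using S0 by simp
    \<comment> \<open>Half of the distance from \<open>w0\<close> to the sphere. On
      \<open>ball w0 \<rho>\<close> that distance is still at least \<open>\<rho>\<close>, so
      maximality of \<open>h\<close> at \<open>w0\<close> bounds |f| there by
      \<open>S * \<rho> powr (- D / p)\<close>.\<close>
    define \<rho> where "\<rho> = (R - norm (w0 - z)) / 2"
    have "R - norm (w0 - z) \<noteq> 0" using S by (auto simp: S_def h_def)
    then have \<rho>: "\<rho> > 0" using w0(1) by (auto simp: \<rho>_def dist_norm norm_minus_commute)
    \<comment> \<open>An upper bound for |f|^(1-p) on that ball; it turns |f| into \<open>K\<close>
      times |f|^p under the integral.\<close>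
    define K where "K = (S * \<rho> powr (- D / p)) powr (1 - p)"
    define I where "I = (\<integral>\<^sup>+w. ennreal (cmod (f w) powr p) * indicator (ball z R) w \<partial>lborel)"
    have bd: "ball z R \<supseteq> ball w0 \<rho>" "\<And>w. w \<in> ball w0 \<rho> \<Longrightarrow> cmod (f w) \<le> K * cmod (f w) powr p"
    proof -
      have r: "\<rho> \<le> R - norm (w - z)" if "w \<in> ball w0 \<rho>" for w
        using that norm_triangle_ineq[of "w - w0" "w0 - z"]
        by (simp add: \<rho>_def dist_norm norm_minus_commute field_simps)
      then show "ball w0 \<rho> \<subseteq> ball z R" using \<rho> by (fastforce simp: dist_norm norm_minus_commute)
      fix w assume w: "w \<in> ball w0 \<rho>"
      then have "w \<in> cball z R" using r[OF w] \<rho> by (simp add: dist_norm norm_minus_commute)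
      then have "h w \<le> S" unfolding S_def by (rule w0)
      moreover have "\<rho> powr (D / p) * cmod (f w) \<le> h w"
        unfolding h_def using r[OF w] \<rho> D p by (intro mult_right_mono powr_mono2) auto
      ultimately have "\<rho> powr (D / p) * cmod (f w) \<le> S" by simp
      then have le: "cmod (f w) \<le> S * \<rho> powr (- D / p)"
        using \<rho> by (simp add: powr_minus field_simps)
      show "cmod (f w) \<le> K * cmod (f w) powr p"
      proof (cases "f w = 0")
        case False
        have "cmod (f w) = cmod (f w) powr (1 - p) * cmod (f w) powr p"
          using False by (simp add: powr_add[symmetric])
        also have "\<dots> \<le> K * cmod (f w) powr p"
          unfolding K_def using le p by (intro mult_right_mono powr_mono2) auto
        finally show ?thesis .
      qed (use p in auto)
    qed
    have "ennreal (cmod (f w0)) * emeasure lborel (ball w0 \<rho>) \<le>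
        (\<integral>\<^sup>+w. ennreal (cmod (f w)) * indicator (ball w0 \<rho>) w \<partial>lborel)"
      by (rule mean_value_ball[OF f \<rho>])
    also have "\<dots> \<le> (\<integral>\<^sup>+w. ennreal K * (ennreal (cmod (f w) powr p) * indicator (ball z R) w) \<partial>lborel)"
    proof (rule nn_integral_mono)
      fix w show "ennreal (cmod (f w)) * indicator (ball w0 \<rho>) w \<le>
          ennreal K * (ennreal (cmod (f w) powr p) * indicator (ball z R) w)"
        using bd(1) bd(2)[of w]
        by (auto simp: indicator_def K_def ennreal_mult'[symmetric] intro!: ennreal_leI)
    qed
    also have "\<dots> = ennreal K * I" unfolding I_def by (rule nn_integral_cmult) measurable
    finally have le: "ennreal (cmod (f w0)) * ennreal (\<omega> * \<rho> powr D) \<le> ennreal K * I"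
      unfolding emeasure_ball_complex_vec[OF \<rho>] \<omega>_def D_def .
    show ?thesis
    proof (cases "I = \<infinity>")
      case True
      have "ennreal (2 powr (D / p) / \<omega>) * I = \<infinity>"
        using \<omega> True by (simp add: ennreal_mult_eq_top_iff)
      then show ?thesis unfolding I_def \<omega>_def by simp
    next
      case False
      then obtain i where i: "I = ennreal i" "i \<ge> 0" by (cases I) auto
      have "cmod (f w0) * (\<omega> * \<rho> powr D) \<le> K * i"
        using le \<omega> i unfolding i(1) by (simp add: ennreal_mult'[symmetric] K_def ennreal_le_iff)
      then have "(2 * \<rho>) powr (D / p) * (cmod (f w0) * (\<omega> * \<rho> powr D)) \<le> (2 * \<rho>) powr (D / p) * (K * i)"
        by (intro mult_left_mono) auto
      moreover have "(2 * \<rho>) powr (D / p) * cmod (f w0) = S"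
      proof -
        have "2 * \<rho> = R - norm (w0 - z)" by (simp add: \<rho>_def)
        then show ?thesis by (simp add: S_def h_def)
      qed
      ultimately have "S * (\<omega> * \<rho> powr D) \<le> (2 * \<rho>) powr (D / p) * (K * i)"
        by (simp only: mult.assoc[symmetric])
      also have "\<dots> = 2 powr (D / p) * S powr (1 - p) * i * (\<rho> powr (D / p) * \<rho> powr (- D / p * (1 - p)))"
        unfolding K_def using S \<rho> by (simp add: powr_mult powr_powr)
      also have "\<rho> powr (D / p) * \<rho> powr (- D / p * (1 - p)) = \<rho> powr D"
        unfolding powr_add[symmetric] using p by (simp add: field_simps)
      finally have "S * \<omega> * \<rho> powr D \<le> 2 powr (D / p) * S powr (1 - p) * i * \<rho> powr D"
        by (simp add: mult_ac)
      \<comment> \<open>All powers of \<open>\<rho>\<close> have cancelled, so the unknown position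
        of \<open>w0\<close> has left the estimate; dividing by \<open>S powr (1 - p)\<close> will
        leave \<open>S powr p\<close>.\<close>
      then have "S * \<omega> \<le> 2 powr (D / p) * S powr (1 - p) * i"
        using \<rho> by (simp add: mult_le_cancel_right)
      moreover have "S = S powr p * S powr (1 - p)" using S by (simp add: powr_add[symmetric])
      ultimately have "S powr p * \<omega> * S powr (1 - p) \<le> 2 powr (D / p) * i * S powr (1 - p)"
        by (metis (no_types, lifting) mult.assoc mult.commute)
      then have "S powr p * \<omega> \<le> 2 powr (D / p) * i" using S by (simp add: mult_le_cancel_right)
      then have "S powr p \<le> 2 powr (D / p) / \<omega> * i" using \<omega> by (simp add: field_simps)
      moreover have "h z powr p \<le> S powr p"
        using hz p by (intro powr_mono2) (auto simp: h_def)
      ultimately have "cmod (f z) powr p * R powr D \<le> 2 powr (D / p) / \<omega> * i"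
        unfolding hz_eq by linarith
      then show ?thesis
        unfolding I_def[symmetric] i(1) \<omega>_def[symmetric] using \<omega>
        by (subst ennreal_mult'[symmetric]) (auto intro!: ennreal_leI)
    qed
  qed
qed

text \<open>Exponents above 1 are reduced to the previous case by applying it to
  \<open>f ^ m\<close> with exponent \<open>p / m\<close>, where \<open>m\<close> is
  \<open>p\<close> rounded up.\<close>

lemma submean_powr:
  fixes p :: real
  assumes p: "0 < p"
  obtains C where "C > 0"
    "\<And>(f :: complex^'n \<Rightarrow> complex) z R. slice_holomorphic f \<Longrightarrow> R > 0 \<Longrightarrow>
      ennreal (cmod (f z) powr p * R powr (2 * real CARD('n))) \<le> ennreal C *
      (\<integral>\<^sup>+w. ennreal (cmod (f w) powr p) * indicator (ball z R) w \<partial>lborel)"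
proof -
  define m where "m = nat \<lceil>p\<rceil>"
  have m: "m > 0" "p \<le> real m" using p by (auto simp: m_def)
  define C where "C = 2 powr (2 * real CARD('n) / (p / real m)) / unit_ball_vol (2 * real CARD('n))"
  have "C > 0" unfolding C_def by (intro divide_pos_pos unit_ball_vol_pos) auto
  moreover have "ennreal (cmod (f z) powr p * R powr (2 * real CARD('n))) \<le> ennreal C *
      (\<integral>\<^sup>+w. ennreal (cmod (f w) powr p) * indicator (ball z R) w \<partial>lborel)"
    if f: "slice_holomorphic f" and R: "R > 0" for f :: "complex^'n \<Rightarrow> complex" and z R
  proof -
    have eq: "cmod (f w ^ m) powr (p / real m) = cmod (f w) powr p" for w
      using m p by (cases "f w = 0") (auto simp: norm_power powr_realpow[symmetric] powr_powr)
    show ?thesis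
      using submean_powr_le_1[OF slice_holomorphic_power[OF f, of m], of "p / real m" R z] m p R
      unfolding eq C_def by simp
  qed
  ultimately show ?thesis by (rule that)
qed

section \<open>Domination along rays\<close>

definition gauss_abs :: "(complex^'n \<Rightarrow> complex) \<Rightarrow> complex^'n \<Rightarrow> real" where
  "gauss_abs f z = cmod (f z) * exp (- (norm z)\<^sup>2 / 2)"

lemma gauss_abs_nonneg [simp]: "gauss_abs f z \<ge> 0"
  by (simp add: gauss_abs_def)

lemma continuous_on_gauss_abs: "continuous_on S f \<Longrightarrow> continuous_on S (gauss_abs f)"
  unfolding gauss_abs_def by (intro continuous_intros) auto

lemma borel_measurable_gauss_abs:
  "continuous_on UNIV f \<Longrightarrow> gauss_abs f \<in> borel_measurable borel"
  by (intro borel_measurable_continuous_onI continuous_on_gauss_abs)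

text \<open>One two-sided comparison serves exponents of either sign; the sign decides which half is
  used.\<close>

lemma powr_le_of_comparable:
  fixes a b k \<gamma> :: real
  assumes "a > 0" "b > 0" "k \<ge> 1" "a \<le> k * b" "b \<le> k * a"
  shows "a powr \<gamma> \<le> k powr \<bar>\<gamma>\<bar> * b powr \<gamma>"
proof (cases "\<gamma> \<ge> 0")
  case True
  then have "a powr \<gamma> \<le> (k * b) powr \<gamma>" using assms by (intro powr_mono2) auto
  then show ?thesis using True assms by (simp add: powr_mult)
next
  case False
  then have "(k * a) powr \<gamma> \<le> b powr \<gamma>" using assms by (intro powr_mono2') auto
  then have "k powr (-\<gamma>) * (k powr \<gamma> * a powr \<gamma>) \<le> k powr (-\<gamma>) * b powr \<gamma>"
    using assms by (intro mult_left_mono) (auto simp: powr_mult)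
  moreover have "k powr (-\<gamma>) * k powr \<gamma> = 1" using assms by (simp add: powr_minus)
  ultimately show ?thesis using False by (simp add: mult.assoc[symmetric])
qed

text \<open>The displacement shrinks like \<open>1 / (1 + norm x)\<close>, so the cross term
  \<open>2 * norm x * norm (y - x)\<close> stays below \<open>2 * c\<close> however large
  \<open>x\<close> is.\<close>

lemma norm_sq_near:
  fixes x :: "'a::real_normed_vector"
  assumes "norm (y - x) \<le> c / (1 + norm x)" "0 \<le> c"
  shows "(norm y)\<^sup>2 \<le> (norm x)\<^sup>2 + 2 * c + c\<^sup>2"
proof -
  let ?a = "norm x"
  let ?d = "c / (1 + ?a)"
  have "norm y \<le> ?a + ?d" using assms norm_triangle_ineq[of x "y - x"] by simp
  then have "(norm y)\<^sup>2 \<le> (?a + ?d)\<^sup>2" by (intro power_mono) auto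
  also have "\<dots> = ?a\<^sup>2 + 2 * (?a * ?d) + ?d\<^sup>2" by (simp add: power2_sum algebra_simps)
  also have "?a * ?d \<le> c"
  proof -
    have "?a * c \<le> (1 + ?a) * c" using assms by (intro mult_right_mono) auto
    then show ?thesis by (simp add: field_simps add_pos_nonneg)
  qed
  also have "?d\<^sup>2 \<le> c\<^sup>2"
  proof -
    have "c * 1 \<le> c * (1 + ?a)" using assms by (intro mult_left_mono) auto
    then have "?d \<le> c" by (simp add: field_simps add_pos_nonneg)
    then show ?thesis using assms by (intro power_mono) auto
  qed
  finally show ?thesis by simp
qed

text \<open>On a ball of radius \<open>1 / (1 + |z|)\<close> the Gaussian weight changes by a bounded factor only.\<close>

lemma gauss_abs_local_estimate:
  fixes p :: real
  assumes p: "0 < p"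
  obtains C where "C > 0"
    "\<And>(f :: complex^'n \<Rightarrow> complex) z. slice_holomorphic f \<Longrightarrow>
      ennreal (gauss_abs f z powr p) \<le> ennreal (C * (1 + norm z) powr (2 * real CARD('n))) *
      (\<integral>\<^sup>+w. ennreal (gauss_abs f w powr p) * indicator (ball z (1 / (1 + norm z))) w \<partial>lborel)"
proof -
  let ?D = "2 * real CARD('n)"
  obtain C where C: "C > 0"
    "\<And>(f :: complex^'n \<Rightarrow> complex) z R. slice_holomorphic f \<Longrightarrow> R > 0 \<Longrightarrow>
      ennreal (cmod (f z) powr p * R powr ?D) \<le> ennreal C *
      (\<integral>\<^sup>+w. ennreal (cmod (f w) powr p) * indicator (ball z R) w \<partial>lborel)"
    using submean_powr[OF p] by blast
  have "ennreal (gauss_abs f z powr p) \<le> ennreal (C * exp (p * 3 / 2) * (1 + norm z) powr ?D) *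
      (\<integral>\<^sup>+w. ennreal (gauss_abs f w powr p) * indicator (ball z (1 / (1 + norm z))) w \<partial>lborel)"
    if f: "slice_holomorphic f" for f :: "complex^'n \<Rightarrow> complex" and z
  proof -
    define \<tau> where "\<tau> = 1 / (1 + norm z)"
    have \<tau>: "\<tau> > 0" by (simp add: \<tau>_def add_pos_nonneg)
    have fm [measurable]: "gauss_abs f \<in> borel_measurable borel"
      by (intro borel_measurable_gauss_abs slice_holomorphic_cont f)
    have [measurable]: "ball c r \<in> sets borel" for c :: "complex^'n" and r by simp
    \<comment> \<open>The 3 is \<open>2 * c + c\<^sup>2\<close> from \<open>norm_sq_near\<close> at
      \<open>c = 1\<close>.\<close>
    define E where "E = exp (p * ((norm z)\<^sup>2 + 3) / 2)"
    define J where "J = (\<integral>\<^sup>+w. ennreal (gauss_abs f w powr p) * indicator (ball z \<tau>) w \<partial>lborel)"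
    have u: "gauss_abs f w powr p = cmod (f w) powr p * exp (- p * (norm w)\<^sup>2 / 2)" for w
      by (simp add: gauss_abs_def powr_mult exp_powr_real)
    have "(\<integral>\<^sup>+w. ennreal (cmod (f w) powr p) * indicator (ball z \<tau>) w \<partial>lborel) \<le>
        (\<integral>\<^sup>+w. ennreal E * (ennreal (gauss_abs f w powr p) * indicator (ball z \<tau>) w) \<partial>lborel)"
    proof (rule nn_integral_mono)
      fix w
      have "cmod (f w) powr p \<le> E * gauss_abs f w powr p" if "w \<in> ball z \<tau>"
      proof -
        have "(norm w)\<^sup>2 \<le> (norm z)\<^sup>2 + 3"
          using norm_sq_near[of w z 1] that by (simp add: \<tau>_def dist_norm norm_minus_commute)
        then have "p * (norm w)\<^sup>2 \<le> p * ((norm z)\<^sup>2 + 3)" using p by (intro mult_left_mono) auto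
        then have "1 \<le> exp (p * ((norm z)\<^sup>2 + 3) / 2 - p * (norm w)\<^sup>2 / 2)" by simp
        then have "1 \<le> E * exp (- p * (norm w)\<^sup>2 / 2)" by (simp add: E_def exp_diff exp_minus field_simps)
        then have "cmod (f w) powr p * 1 \<le> cmod (f w) powr p * (E * exp (- p * (norm w)\<^sup>2 / 2))"
          by (intro mult_left_mono) auto
        then show ?thesis unfolding u by (simp add: mult_ac)
      qed
      then show "ennreal (cmod (f w) powr p) * indicator (ball z \<tau>) w \<le>
          ennreal E * (ennreal (gauss_abs f w powr p) * indicator (ball z \<tau>) w)"
        by (auto simp: indicator_def E_def ennreal_mult'[symmetric] intro!: ennreal_leI)
    qed
    also have "\<dots> = ennreal E * J" unfolding J_def by (rule nn_integral_cmult) measurable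
    finally have 1: "ennreal (cmod (f z) powr p * \<tau> powr ?D) \<le> ennreal C * (ennreal E * J)"
      using C(2)[OF f \<tau>, of z] by (meson mult_left_mono order_trans zero_le)
    have "gauss_abs f z powr p = (exp (- p * (norm z)\<^sup>2 / 2) * (1 + norm z) powr ?D) * (cmod (f z) powr p * \<tau> powr ?D)"
    proof -
      have "\<tau> * (1 + norm z) = 1" unfolding \<tau>_def using add_pos_nonneg[of 1 "norm z"] by simp
      then have "\<tau> powr ?D * (1 + norm z) powr ?D = 1"
        using \<tau> by (subst powr_mult[symmetric]) auto
      moreover have "(exp (- p * (norm z)\<^sup>2 / 2) * (1 + norm z) powr ?D) * (cmod (f z) powr p * \<tau> powr ?D) =
          cmod (f z) powr p * exp (- p * (norm z)\<^sup>2 / 2) * (\<tau> powr ?D * (1 + norm z) powr ?D)"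
        by (simp only: mult_ac)
      ultimately show ?thesis unfolding u by (simp only: mult_1_right)
    qed
    then have "ennreal (gauss_abs f z powr p) =
      ennreal (exp (- p * (norm z)\<^sup>2 / 2) * (1 + norm z) powr ?D) * ennreal (cmod (f z) powr p * \<tau> powr ?D)"
      by (simp add: ennreal_mult)
    also have "\<dots> \<le> ennreal (exp (- p * (norm z)\<^sup>2 / 2) * (1 + norm z) powr ?D) * (ennreal C * (ennreal E * J))"
      using 1 by (rule mult_left_mono) simp
    also have "\<dots> = ennreal (exp (- p * (norm z)\<^sup>2 / 2) * (1 + norm z) powr ?D * (C * E)) * J"
      using C(1) by (simp add: ennreal_mult E_def mult_ac)
    also have "exp (- p * (norm z)\<^sup>2 / 2) * (1 + norm z) powr ?D * (C * E) = C * exp (p * 3 / 2) * (1 + norm z) powr ?D"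
    proof -
      have "exp (- p * (norm z)\<^sup>2 / 2) * E = exp (p * 3 / 2)"
        unfolding E_def exp_add[symmetric] by (simp add: field_simps)
      moreover have "exp (- p * (norm z)\<^sup>2 / 2) * (1 + norm z) powr ?D * (C * E) =
          C * (exp (- p * (norm z)\<^sup>2 / 2) * E) * (1 + norm z) powr ?D"
        by (simp only: mult_ac)
      ultimately show ?thesis by (simp only:)
    qed
    finally show ?thesis unfolding J_def \<tau>_def .
  qed
  moreover have "C * exp (p * 3 / 2) > 0" using C(1) by simp
  ultimately show ?thesis using that by blast
qed

text \<open>The points \<open>t\<close> and \<open>w\<close> may depend on \<open>z\<close> in any
  way, without measurability. Since many \<open>z\<close> along a ray can be served by the same
  \<open>w\<close>, a bare bound by such a value would lose powers of |z| under integration; the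
  exponential factor effectively restricts \<open>1 - t\<close> to \<open>O(1 / |z|^2)\<close>. A
  constant in front is supplied by scaling \<open>\<Psi>\<close>.\<close>

definition gauss_dominated :: "real \<Rightarrow> (complex^'n \<Rightarrow> real) \<Rightarrow> (complex^'n \<Rightarrow> complex) \<Rightarrow> bool" where
  "gauss_dominated q \<Psi> f \<longleftrightarrow>
     (\<forall>z. \<exists>t\<in>{1/2..1}. \<exists>w. norm (w - t *\<^sub>R z) \<le> 1 / (1 + norm z) \<and>
        0 \<le> \<Psi> z \<and> \<Psi> z \<le> exp (- q * (1 - t\<^sup>2) * (norm z)\<^sup>2) * gauss_abs f w)"

text \<open>The averaged form of domination, with \<open>t\<close> and \<open>w\<close> as
  integration variables. The lower end 1/4 and the factor 5 leave room for averaging around a point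
  with \<open>t \<ge> 1/2\<close>; the radius refers to \<open>t z\<close>, whose size is comparable
  with that of \<open>w\<close>.\<close>

definition tube_kernel :: "real \<Rightarrow> real \<Rightarrow> complex^'n \<Rightarrow> real \<times> (complex^'n) \<Rightarrow> ennreal" where
  "tube_kernel \<kappa> \<gamma> z x =
     (if 1/4 \<le> fst x \<and> fst x \<le> 1 \<and> norm (snd x - fst x *\<^sub>R z) < 5 / (1 + fst x * norm z)
      then ennreal ((1 + norm z) powr \<gamma> * exp (- \<kappa> * (1 - (fst x)\<^sup>2) * (norm z)\<^sup>2)) else 0)"

lemma tube_kernel_measurable:
  "(\<lambda>(z, x). tube_kernel \<kappa> \<gamma> z x) \<in> borel_measurable (borel \<Otimes>\<^sub>M borel)"
proof -
  have "(\<lambda>y :: (complex^'n) \<times> real \<times> (complex^'n). tube_kernel \<kappa> \<gamma> (fst y) (snd y)) \<in>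
      borel_measurable (borel \<Otimes>\<^sub>M (borel \<Otimes>\<^sub>M borel))"
    unfolding tube_kernel_def by measurable
  then show ?thesis by (simp add: borel_prod case_prod_unfold)
qed

text \<open>Moving \<open>t\<close> by at most \<open>\<rho>\<close> shifts \<open>t z\<close> by no
  more than the ball scale and changes \<open>(t * norm z)\<^sup>2\<close> by a bounded
  amount.\<close>

lemma step_size_bounds:
  fixes a :: real
  assumes "0 \<le> a"
  defines "\<rho> \<equiv> 1 / (4 * (1 + a)\<^sup>2)"
  shows "0 < \<rho>" "\<rho> \<le> 1/4" "\<rho> * a \<le> 1 / (4 * (1 + a))" "\<rho> * a\<^sup>2 \<le> 1/4"
proof -
  define b where "b = 1 + a"
  have b: "b \<ge> 1" "a \<le> b" using assms by (auto simp: b_def)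
  have \<rho>: "\<rho> = 1 / (4 * b\<^sup>2)" by (simp add: \<rho>_def b_def)
  show "0 < \<rho>" using b by (simp add: \<rho>)
  have "1 \<le> b\<^sup>2" using b by (simp add: one_le_power)
  then show "\<rho> \<le> 1/4" using b by (simp add: \<rho> field_simps)
  have "\<rho> * a \<le> \<rho> * b" using b \<open>0 < \<rho>\<close> by (intro mult_left_mono) auto
  also have "\<rho> * b = 1 / (4 * b)" using b by (simp add: \<rho> power2_eq_square)
  finally show "\<rho> * a \<le> 1 / (4 * (1 + a))" by (simp add: b_def)
  have "\<rho> * a\<^sup>2 \<le> \<rho> * b\<^sup>2" using b \<open>0 < \<rho>\<close> assms(1) by (intro mult_left_mono power_mono) auto
  also have "\<rho> * b\<^sup>2 = 1 / 4" using b by (simp add: \<rho>)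
  finally show "\<rho> * a\<^sup>2 \<le> 1/4" .
qed

text \<open>Distance budget in units of \<open>1 / (1 + t * norm z)\<close>: 2 for the ball around
  \<open>w0\<close>, 1 for \<open>w0\<close> against \<open>t0 z\<close>, 1 for moving
  \<open>t0\<close> to \<open>t\<close>; the kernel radius 5 covers it. The loss
  \<open>exp (- \<kappa> / 2)\<close> comes from
  \<open>(t0\<^sup>2 - t\<^sup>2) * (norm z)\<^sup>2 \<le> 1/2\<close>.\<close>

lemma tube_kernel_lower_bound:
  fixes z w w0 :: "complex^'n"
  assumes t0: "1/2 \<le> t0" "t0 \<le> 1" and w0: "norm (w0 - t0 *\<^sub>R z) \<le> 1 / (1 + norm z)" and \<kappa>: "\<kappa> > 0"
    and t: "t0 - 1 / (4 * (1 + norm z)\<^sup>2) \<le> t" "t \<le> t0" and w: "norm (w - w0) < 1 / (1 + norm w0)"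
  shows "ennreal ((1 + norm z) powr \<gamma> * exp (- \<kappa> * (1 - t0\<^sup>2) * (norm z)\<^sup>2) * exp (- \<kappa> / 2))
    \<le> tube_kernel \<kappa> \<gamma> z (t, w)"
proof -
  let ?a = "norm z"
  define \<rho> where "\<rho> = 1 / (4 * (1 + ?a)\<^sup>2)"
  have a0: "?a \<ge> 0" by simp
  then have a1: "1 + ?a > 0" by linarith
  note \<rho> = step_size_bounds[OF a0, folded \<rho>_def]
  note \<rho>a = \<rho>(3) and \<rho>a2 = \<rho>(4)
  have t': "t0 - \<rho> \<le> t" using t by (simp add: \<rho>_def)
  have tq: "1/4 \<le> t" "t \<le> 1" using t' t t0 \<rho> by auto
  have y: "t * ?a \<le> ?a" using tq a0 by (simp add: mult_left_le_one_le)
  have y0: "0 \<le> t * ?a" using tq a0 by simp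
  have inv: "1 / (1 + ?a) \<le> 1 / (1 + t * ?a)"
    using y y0 by (intro divide_left_mono) (auto intro: mult_pos_pos)
  have "1 / (1 + ?a) \<le> 1" using a0 a1 by (simp add: field_simps)
  moreover have "t0 * ?a \<le> norm w0 + 1 / (1 + ?a)"
    using norm_triangle_ineq[of w0 "t0 *\<^sub>R z - w0"] w0 t0 by (simp add: norm_minus_commute)
  moreover have "t * ?a \<le> t0 * ?a" using t a0 by (intro mult_right_mono) auto
  ultimately have "t * ?a \<le> norm w0 + 1" by (meson add_left_mono order_trans)
  then have "1 + t * ?a \<le> 2 * (1 + norm w0)" using norm_ge_zero[of w0] unfolding distrib_left by linarith
  then have "1 / (1 + norm w0) \<le> 2 / (1 + t * ?a)"
    using y0 by (simp add: field_simps add_pos_nonneg)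
  moreover have "norm (w - t *\<^sub>R z) \<le> norm (w - w0) + norm (w0 - t0 *\<^sub>R z) + (t0 - t) * ?a"
  proof -
    have "norm (w - t *\<^sub>R z) \<le> norm (w - w0) + (norm (w0 - t0 *\<^sub>R z) + norm ((t0 - t) *\<^sub>R z))"
      using norm_triangle_ineq[of "w - w0" "w0 - t *\<^sub>R z"]
        norm_triangle_ineq[of "w0 - t0 *\<^sub>R z" "(t0 - t) *\<^sub>R z"] by (simp add: algebra_simps)
    then show ?thesis using t by simp
  qed
  moreover have "(t0 - t) * ?a \<le> \<rho> * ?a" using t' a0 by (intro mult_right_mono) auto
  moreover have "\<rho> * ?a \<le> 1 / (1 + t * ?a)"
  proof -
    have "1 / (4 * (1 + ?a)) \<le> 1 / (1 + ?a)" using a1 by (simp add: field_simps)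
    then show ?thesis using \<rho>a inv by linarith
  qed
  moreover have "5 / (1 + t * ?a) = 2 / (1 + t * ?a) + 3 * (1 / (1 + t * ?a))"
    by (simp add: add_divide_distrib[symmetric])
  moreover have "1 / (1 + t * ?a) > 0" using y0 by (simp add: add_pos_nonneg)
  ultimately have cond: "norm (w - t *\<^sub>R z) < 5 / (1 + t * ?a)"
    using w w0 inv by linarith
  have "(t0\<^sup>2 - t\<^sup>2) * ?a\<^sup>2 \<le> 1/2"
  proof -
    have "t0\<^sup>2 - t\<^sup>2 = (t0 - t) * (t0 + t)" by (simp add: power2_eq_square algebra_simps)
    also have "\<dots> \<le> \<rho> * 2" using t' t t0 tq by (intro mult_mono) auto
    finally have "(t0\<^sup>2 - t\<^sup>2) * ?a\<^sup>2 \<le> (\<rho> * 2) * ?a\<^sup>2" by (intro mult_right_mono) auto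
    then show ?thesis using \<rho>a2 by linarith
  qed
  then have "\<kappa> * ((t0\<^sup>2 - t\<^sup>2) * ?a\<^sup>2) \<le> \<kappa> * (1/2)" using \<kappa> by (intro mult_left_mono) auto
  then have "exp (- \<kappa> * (1 - t0\<^sup>2) * ?a\<^sup>2 + - \<kappa> / 2) \<le> exp (- \<kappa> * (1 - t\<^sup>2) * ?a\<^sup>2)"
    by (simp add: algebra_simps)
  then have "(1 + ?a) powr \<gamma> * (exp (- \<kappa> * (1 - t0\<^sup>2) * ?a\<^sup>2) * exp (- \<kappa> / 2)) \<le>
      (1 + ?a) powr \<gamma> * exp (- \<kappa> * (1 - t\<^sup>2) * ?a\<^sup>2)"
    unfolding exp_add by (intro mult_left_mono) auto
  then show ?thesis
    using cond tq by (simp add: tube_kernel_def ennreal_leI mult.assoc)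
qed

text \<open>The bound by the value at one unknown \<open>t0\<close> is averaged over \<open>t0 - \<rho> \<le> t \<le> t0\<close> with
  \<open>\<rho> = 1 / (4 (1 + |z|)\<^sup>2)\<close>. This costs a factor \<open>(1 + |z|)\<^sup>2\<close>, which the later integration over \<open>t\<close> of
  \<open>exp (- \<kappa> (1 - t\<^sup>2) |z|\<^sup>2)\<close> gains back, and leaves an integral kernel to which Tonelli applies.\<close>

lemma dominated_pointwise:
  fixes p q :: real
  assumes p: "0 < p" and q: "0 < q"
  obtains C where "C > 0"
    "\<And>(f :: complex^'n \<Rightarrow> complex) \<Psi> z \<beta>. slice_holomorphic f \<Longrightarrow> gauss_dominated q \<Psi> f \<Longrightarrow>
      ennreal (\<Psi> z powr p * (1 + norm z) powr (- \<beta>)) \<le> ennreal C *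
      (\<integral>\<^sup>+x. tube_kernel (p * q) (2 * real CARD('n) + 2 - \<beta>) z x * ennreal (gauss_abs f (snd x) powr p) \<partial>lborel)"
proof -
  let ?D = "2 * real CARD('n)"
  let ?\<kappa> = "p * q"
  obtain C where C: "C > 0"
    "\<And>(f :: complex^'n \<Rightarrow> complex) z. slice_holomorphic f \<Longrightarrow>
      ennreal (gauss_abs f z powr p) \<le> ennreal (C * (1 + norm z) powr ?D) *
      (\<integral>\<^sup>+w. ennreal (gauss_abs f w powr p) * indicator (ball z (1 / (1 + norm z))) w \<partial>lborel)"
    using gauss_abs_local_estimate[OF p] by blast
  \<comment> \<open>The 4 undoes the one in \<open>\<rho>\<close>,
    \<open>exp (?\<kappa> / 2)\<close> the loss in the lower bound of the kernel, and
    \<open>2 powr ?D\<close> compares \<open>1 + norm w0\<close> with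
    \<open>1 + norm z\<close>.\<close>
  define C1 where "C1 = 4 * exp (?\<kappa> / 2) * C * 2 powr ?D"
  have "ennreal (\<Psi> z powr p * (1 + norm z) powr (- \<beta>)) \<le> ennreal C1 *
      (\<integral>\<^sup>+x. tube_kernel ?\<kappa> (?D + 2 - \<beta>) z x * ennreal (gauss_abs f (snd x) powr p) \<partial>lborel)"
    if f: "slice_holomorphic f" and dom: "gauss_dominated q \<Psi> f"
    for f :: "complex^'n \<Rightarrow> complex" and \<Psi> z \<beta>
  proof -
    let ?a = "norm z"
    have a0: "?a \<ge> 0" by simp
    then have a1: "1 + ?a > 0" by linarith
    have fm [measurable]: "gauss_abs f \<in> borel_measurable borel"
      by (intro borel_measurable_gauss_abs slice_holomorphic_cont f)
    have [measurable]: "ball c r \<in> sets borel" for c :: "complex^'n" and r by simp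
    obtain t0 w0 where t0: "1/2 \<le> t0" "t0 \<le> 1" and w0: "norm (w0 - t0 *\<^sub>R z) \<le> 1 / (1 + ?a)"
      and \<Psi>: "0 \<le> \<Psi> z" "\<Psi> z \<le> exp (- q * (1 - t0\<^sup>2) * ?a\<^sup>2) * gauss_abs f w0"
      using dom unfolding gauss_dominated_def by (meson atLeastAtMost_iff)
    define \<rho> where "\<rho> = 1 / (4 * (1 + ?a)\<^sup>2)"
    define e where "e = exp (- ?\<kappa> * (1 - t0\<^sup>2) * ?a\<^sup>2)"
    define A where "A = (1 + ?a) powr (?D + 2 - \<beta>) * e * exp (- ?\<kappa> / 2)"
    define B where "B = ball w0 (1 / (1 + norm w0))"
    have [measurable]: "B \<in> sets borel" by (simp add: B_def)
    define I0 where "I0 = (\<integral>\<^sup>+w. ennreal (gauss_abs f w powr p) * indicator B w \<partial>lborel)"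
    have "ennreal A * (ennreal \<rho> * I0) =
        (\<integral>\<^sup>+t. \<integral>\<^sup>+w. ennreal A * (indicator {t0 - \<rho>..t0} t * (ennreal (gauss_abs f w powr p) * indicator B w))
          \<partial>lborel \<partial>lborel)"
      by (simp add: nn_integral_cmult nn_integral_multc I0_def[symmetric] \<rho>_def)
    also have "\<dots> \<le> (\<integral>\<^sup>+t. \<integral>\<^sup>+w. tube_kernel ?\<kappa> (?D + 2 - \<beta>) z (t, w) * ennreal (gauss_abs f w powr p) \<partial>lborel \<partial>lborel)"
    proof (intro nn_integral_mono)
      fix t :: real and w :: "complex^'n"
      have "ennreal A \<le> tube_kernel ?\<kappa> (?D + 2 - \<beta>) z (t, w)" if "t \<in> {t0 - \<rho>..t0}" "w \<in> B"
        unfolding A_def e_def using that p q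
        by (intro tube_kernel_lower_bound[OF t0 w0])
           (auto simp: \<rho>_def B_def dist_norm norm_minus_commute)
      then show "ennreal A * (indicator {t0 - \<rho>..t0} t * (ennreal (gauss_abs f w powr p) * indicator B w)) \<le>
          tube_kernel ?\<kappa> (?D + 2 - \<beta>) z (t, w) * ennreal (gauss_abs f w powr p)"
        by (auto simp: indicator_def intro: mult_right_mono)
    qed
    also have "\<dots> = (\<integral>\<^sup>+x. tube_kernel ?\<kappa> (?D + 2 - \<beta>) z x * ennreal (gauss_abs f (snd x) powr p) \<partial>(lborel \<Otimes>\<^sub>M lborel))"
    proof -
      have "(\<lambda>x. tube_kernel ?\<kappa> (?D + 2 - \<beta>) z x) \<in> borel_measurable borel"
        using measurable_compose[OF measurable_Pair1'[of z borel borel]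
            tube_kernel_measurable[of ?\<kappa> "?D + 2 - \<beta>"]] by simp
      then have "(\<lambda>x. tube_kernel ?\<kappa> (?D + 2 - \<beta>) z x) \<in> borel_measurable (borel \<Otimes>\<^sub>M borel)"
        by (simp add: borel_prod)
      then have "(\<lambda>x. tube_kernel ?\<kappa> (?D + 2 - \<beta>) z x * ennreal (gauss_abs f (snd x) powr p)) \<in> borel_measurable (borel \<Otimes>\<^sub>M borel)"
        by measurable
      then have "(\<lambda>x. tube_kernel ?\<kappa> (?D + 2 - \<beta>) z x * ennreal (gauss_abs f (snd x) powr p)) \<in> borel_measurable (lborel \<Otimes>\<^sub>M lborel)"
        by (simp cong: measurable_cong_sets sets_pair_measure_cong)
      from lborel.nn_integral_fst[OF this] show ?thesis by simp
    qed
    also have "\<dots> = (\<integral>\<^sup>+x. tube_kernel ?\<kappa> (?D + 2 - \<beta>) z x * ennreal (gauss_abs f (snd x) powr p) \<partial>lborel)" (is "_ = ?T")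
      by (simp add: lborel_prod)
    finally have le: "ennreal A * (ennreal \<rho> * I0) \<le> ?T" .
    have "\<Psi> z powr p \<le> (exp (- q * (1 - t0\<^sup>2) * ?a\<^sup>2) * gauss_abs f w0) powr p"
      using \<Psi> p by (intro powr_mono2) auto
    also have "\<dots> = e * gauss_abs f w0 powr p"
      by (simp add: powr_mult exp_powr_real e_def mult_ac)
    finally have "\<Psi> z powr p * (1 + ?a) powr (- \<beta>) \<le> e * gauss_abs f w0 powr p * (1 + ?a) powr (- \<beta>)"
      by (intro mult_right_mono) auto
    then have "ennreal (\<Psi> z powr p * (1 + ?a) powr (- \<beta>)) \<le> ennreal (e * gauss_abs f w0 powr p * (1 + ?a) powr (- \<beta>))"
      by (rule ennreal_leI)
    also have "\<dots> = ennreal (e * (1 + ?a) powr (- \<beta>)) * ennreal (gauss_abs f w0 powr p)"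
      by (simp add: ennreal_mult'[symmetric] e_def mult_ac)
    also have "\<dots> \<le> ennreal (e * (1 + ?a) powr (- \<beta>)) * (ennreal (C * (1 + norm w0) powr ?D) * I0)"
      unfolding I0_def B_def by (intro mult_left_mono C(2) f) simp
    also have "\<dots> = ennreal (e * (1 + ?a) powr (- \<beta>) * (C * (1 + norm w0) powr ?D)) * I0"
      using C(1) by (simp add: ennreal_mult e_def mult_ac)
    also have "\<dots> \<le> ennreal (C1 * (A * \<rho>)) * I0"
    proof (intro mult_right_mono ennreal_leI)
      have "norm w0 \<le> t0 * ?a + 1 / (1 + ?a)"
        using norm_triangle_ineq[of "t0 *\<^sub>R z" "w0 - t0 *\<^sub>R z"] w0 t0 by simp
      moreover have "t0 * ?a \<le> ?a" using t0 a0 by (simp add: mult_left_le_one_le)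
      moreover have "1 / (1 + ?a) \<le> 1" using a0 a1 by (simp add: field_simps)
      ultimately have "norm w0 \<le> ?a + 1" by (meson add_mono order_trans)
      then have "1 + norm w0 \<le> 2 * (1 + ?a)" using a0 unfolding distrib_left by linarith
      then have "(1 + norm w0) powr ?D \<le> (2 * (1 + ?a)) powr ?D" by (intro powr_mono2) auto
      also have "\<dots> = 2 powr ?D * (1 + ?a) powr ?D" by (rule powr_mult)
      finally have "e * (1 + ?a) powr (- \<beta>) * (C * (1 + norm w0) powr ?D) \<le>
          e * (1 + ?a) powr (- \<beta>) * (C * (2 powr ?D * (1 + ?a) powr ?D))"
        using C(1) by (intro mult_left_mono) (auto simp: e_def)
      also have "\<dots> = C1 * (A * \<rho>)"
      proof -
        have "(1 + ?a) powr (?D + 2 - \<beta>) * \<rho> = (1 + ?a) powr (- \<beta>) * (1 + ?a) powr ?D / 4"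
        proof -
          have "(1 + ?a) powr (?D + 2 - \<beta>) = (1 + ?a) powr (- \<beta>) * (1 + ?a) powr ?D * (1 + ?a) powr 2"
            unfolding powr_add[symmetric] by (simp add: algebra_simps)
          moreover have "(1 + ?a) powr 2 = (1 + ?a)\<^sup>2" using powr_realpow[OF a1, of 2] by simp
          ultimately show ?thesis using a1 by (simp add: \<rho>_def)
        qed
        moreover have "exp (?\<kappa> / 2) * exp (- ?\<kappa> / 2) = 1" by (simp add: exp_add[symmetric])
        moreover have "C1 * (A * \<rho>) = 4 * C * 2 powr ?D * e * (exp (?\<kappa> / 2) * exp (- ?\<kappa> / 2))
            * ((1 + ?a) powr (?D + 2 - \<beta>) * \<rho>)"
          by (simp add: C1_def A_def mult_ac)
        ultimately have "C1 * (A * \<rho>) = 4 * C * 2 powr ?D * e * 1 *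
            ((1 + ?a) powr (- \<beta>) * (1 + ?a) powr ?D / 4)" by (simp only:)
        then show ?thesis by (simp add: mult_ac)
      qed
      finally show "e * (1 + ?a) powr (- \<beta>) * (C * (1 + norm w0) powr ?D) \<le> C1 * (A * \<rho>)" .
    qed simp
    also have "\<dots> = ennreal C1 * (ennreal A * (ennreal \<rho> * I0))"
    proof -
      have "0 \<le> C1" "0 \<le> A" "0 \<le> \<rho>" using C(1) by (auto simp: C1_def A_def e_def \<rho>_def)
      then show ?thesis by (simp add: ennreal_mult mult.assoc)
    qed
    also have "\<dots> \<le> ennreal C1 * ?T" using le by (rule mult_left_mono) simp
    finally show ?thesis .
  qed
  moreover have "C1 > 0" using C(1) by (simp add: C1_def)
  ultimately show ?thesis using that by blast
qed

text \<open>For fixed \<open>t\<close> and \<open>w\<close> the kernel lives on a ball about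
  \<open>w / t\<close> of radius comparable with \<open>1 / (1 + norm w)\<close>. There
  \<open>1 + norm z\<close> is comparable with \<open>1 + norm w\<close>, and the volume supplies
  \<open>(1 + norm w) powr (- D)\<close>.\<close>

lemma tube_kernel_integral_bound:
  fixes w :: "complex^'n"
  assumes \<kappa>: "0 < \<kappa>" and t: "1/4 \<le> t" "t \<le> 1"
  defines "D \<equiv> 2 * real CARD('n)"
  shows "(\<integral>\<^sup>+z. tube_kernel \<kappa> \<gamma> z (t, w) \<partial>lborel) \<le>
    ennreal (24 powr \<bar>\<gamma>\<bar> * exp (36 * \<kappa>) * (unit_ball_vol D * 120 powr D) *
      (1 + norm w) powr (\<gamma> - D) * exp (- \<kappa> * (1 - t) * (1 + (norm w)\<^sup>2)))"
proof -
  let ?b = "norm w"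
  have b0: "?b \<ge> 0" by simp
  then have b1: "1 + ?b > 0" by linarith
  \<comment> \<open>24 compares \<open>1 + norm z\<close> with \<open>1 + norm w\<close> in both
    directions; 36 is the 35 of \<open>norm_sq_near\<close> at \<open>c = 5\<close> plus the 1 in
    \<open>1 + ?b\<^sup>2\<close>.\<close>
  define M where "M = 24 powr \<bar>\<gamma>\<bar> * (1 + ?b) powr \<gamma> * (exp (36 * \<kappa>) * exp (- \<kappa> * (1 - t) * (1 + ?b\<^sup>2)))"
  \<comment> \<open>120 is the product of 5 (kernel radius), 4 (division by
    \<open>t \<ge> 1/4\<close>) and 6 (from
    \<open>1 + ?b \<le> 6 * (1 + t * norm z)\<close>).\<close>
  define r where "r = 120 / (1 + ?b)"
  have r: "r > 0" using b1 by (simp add: r_def)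
  have "tube_kernel \<kappa> \<gamma> z (t, w) \<le> ennreal M * indicator (ball ((1/t) *\<^sub>R w) r) z" for z :: "complex^'n"
  proof (cases "norm (w - t *\<^sub>R z) < 5 / (1 + t * norm z)")
    case True
    let ?a = "norm z"
    define y where "y = t * ?a"
    have a0: "?a \<ge> 0" by simp
    have y: "0 \<le> y" "y \<le> ?a" "?a \<le> 4 * y"
      using t a0 mult_right_mono[of "1/4" t ?a] by (auto simp: y_def mult_left_le_one_le)
    have ny: "norm (t *\<^sub>R z) = y" using t by (simp add: y_def)
    have lt: "norm (w - t *\<^sub>R z) < 5 / (1 + y)" using True by (simp add: y_def)
    have le5: "5 / (1 + y) \<le> 5" using y by (simp add: field_simps)
    have wy: "?b \<le> y + 5" "y \<le> ?b + 5"
      using norm_triangle_ineq[of "t *\<^sub>R z" "w - t *\<^sub>R z"] norm_triangle_ineq[of w "t *\<^sub>R z - w"]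
        lt le5 ny by (auto simp: norm_minus_commute)
    have cmp: "1 + ?a \<le> 24 * (1 + ?b)" using wy y b0 unfolding distrib_left by linarith
    have "1 + ?b \<le> 24 * (1 + ?a)" using wy y a0 unfolding distrib_left by linarith
    with cmp have pw: "(1 + ?a) powr \<gamma> \<le> 24 powr \<bar>\<gamma>\<bar> * (1 + ?b) powr \<gamma>"
      using a0 b1 by (intro powr_le_of_comparable) auto
    have "?b\<^sup>2 \<le> y\<^sup>2 + 35"
      using norm_sq_near[of w "t *\<^sub>R z" 5] lt unfolding ny by simp
    moreover have "(1 - t) * 36 \<le> 36" using t by simp
    ultimately have "(1 - t) * (1 + ?b\<^sup>2) \<le> (1 - t) * y\<^sup>2 + 36"
      using mult_left_mono[of "1 + ?b\<^sup>2" "y\<^sup>2 + 36" "1 - t"] t by (simp add: algebra_simps)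
    \<comment> \<open>The exponent becomes linear in \<open>t\<close>, so that it can later be
      integrated in closed form.\<close>
    moreover have "(1 - t) * y\<^sup>2 \<le> (1 - t\<^sup>2) * ?a\<^sup>2"
    proof (rule mult_mono)
      have "t\<^sup>2 \<le> t" using t by (simp add: power2_eq_square mult_left_le_one_le)
      then show "1 - t \<le> 1 - t\<^sup>2" "0 \<le> 1 - t\<^sup>2" using t by auto
      show "y\<^sup>2 \<le> ?a\<^sup>2" using y by (intro power_mono) auto
    qed simp
    ultimately have "(1 - t) * (1 + ?b\<^sup>2) - 36 \<le> (1 - t\<^sup>2) * ?a\<^sup>2" by linarith
    then have "\<kappa> * ((1 - t) * (1 + ?b\<^sup>2) - 36) \<le> \<kappa> * ((1 - t\<^sup>2) * ?a\<^sup>2)"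
      using \<kappa> by (intro mult_left_mono) auto
    then have "- \<kappa> * (1 - t\<^sup>2) * ?a\<^sup>2 \<le> 36 * \<kappa> + - \<kappa> * (1 - t) * (1 + ?b\<^sup>2)"
      by (simp add: algebra_simps)
    then have ex: "exp (- \<kappa> * (1 - t\<^sup>2) * ?a\<^sup>2) \<le> exp (36 * \<kappa>) * exp (- \<kappa> * (1 - t) * (1 + ?b\<^sup>2))"
      unfolding exp_add[symmetric] by (simp only: exp_le_cancel_iff)
    have "(1 + ?a) powr \<gamma> * exp (- \<kappa> * (1 - t\<^sup>2) * ?a\<^sup>2) \<le> M"
      unfolding M_def using pw ex by (intro mult_mono) auto
    then have "tube_kernel \<kappa> \<gamma> z (t, w) \<le> ennreal M"
      using True t by (simp add: tube_kernel_def ennreal_leI)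
    moreover have "z \<in> ball ((1/t) *\<^sub>R w) r"
    proof -
      have "(1/t) *\<^sub>R w - z = (1/t) *\<^sub>R (w - t *\<^sub>R z)" using t by (simp add: algebra_simps)
      then have "dist ((1/t) *\<^sub>R w) z = norm (w - t *\<^sub>R z) / t"
        unfolding dist_norm using t by simp
      also have "\<dots> \<le> norm (w - t *\<^sub>R z) * 4"
        using t mult_left_mono[of "1/t" 4 "norm (w - t *\<^sub>R z)"] by (simp add: field_simps)
      also have "\<dots> < 5 / (1 + y) * 4" using lt by simp
      also have "\<dots> \<le> r"
      proof -
        have "1 + ?b \<le> 6 * (1 + y)" using wy y by simp
        then show ?thesis unfolding r_def using b1 y by (simp add: field_simps)
      qed
      finally show ?thesis by simp
    qed
    ultimately show ?thesis by simp
  qed (simp add: tube_kernel_def)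
  then have "(\<integral>\<^sup>+z. tube_kernel \<kappa> \<gamma> z (t, w) \<partial>lborel) \<le>
      (\<integral>\<^sup>+z. ennreal M * indicator (ball ((1/t) *\<^sub>R w) r) z \<partial>lborel)"
    by (rule nn_integral_mono)
  also have "\<dots> = ennreal M * ennreal (unit_ball_vol D * r powr D)"
    unfolding D_def by (simp add: nn_integral_cmult_indicator emeasure_ball_complex_vec[OF r])
  also have "\<dots> = ennreal (M * (unit_ball_vol D * r powr D))"
    by (simp add: ennreal_mult'[symmetric] M_def)
  also have "r powr D = 120 powr D * (1 + ?b) powr (- D)"
    using b1 by (simp add: r_def powr_divide powr_minus field_simps)
  also have "M * (unit_ball_vol D * (120 powr D * (1 + ?b) powr (- D))) =
      24 powr \<bar>\<gamma>\<bar> * exp (36 * \<kappa>) * (unit_ball_vol D * 120 powr D) *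
      (1 + ?b) powr (\<gamma> - D) * exp (- \<kappa> * (1 - t) * (1 + ?b\<^sup>2))"
    using b1 by (simp add: M_def powr_diff powr_minus field_simps)
  finally show ?thesis .
qed

lemma nn_integral_exp_le:
  fixes c :: real
  assumes "c > 0"
  shows "(\<integral>\<^sup>+t. ennreal (exp (- c * (1 - t))) * indicator {1/4..1} t \<partial>lborel) \<le> ennreal (1 / c)"
proof -
  have "(\<integral>\<^sup>+t. ennreal (exp (- c * (1 - t))) * indicator {1/4..1} t \<partial>lborel) =
      ennreal (exp (- c * (1 - 1)) / c - exp (- c * (1 - 1/4)) / c)"
    using assms by (intro nn_integral_FTC_Icc) (auto intro!: derivative_eq_intros)
  also have "\<dots> \<le> ennreal (1 / c)" using assms by (intro ennreal_leI) simp
  finally show ?thesis .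
qed

text \<open>Power count: the kernel carries \<open>1 + norm z\<close> to the power
  \<open>D + 2 - \<beta>\<close>. The integral over \<open>z\<close> removes \<open>D\<close>
  through the ball volume, and the integral over \<open>t\<close> gives a factor comparable with
  \<open>1 / (1 + norm w)\<^sup>2\<close>, which removes the 2 and leaves the original
  weight.\<close>

lemma gauss_dominated_estimate:
  fixes p q \<beta> :: real
  assumes p: "0 < p" and q: "0 < q"
  obtains C where "C > 0"
    "\<And>(f :: complex^'n \<Rightarrow> complex) \<Psi>. slice_holomorphic f \<Longrightarrow> gauss_dominated q \<Psi> f \<Longrightarrow>
      (\<integral>\<^sup>+z. ennreal (\<Psi> z powr p * (1 + norm z) powr (- \<beta>)) \<partial>lborel) \<le> ennreal C *
      (\<integral>\<^sup>+z. ennreal (gauss_abs f z powr p * (1 + norm z) powr (- \<beta>)) \<partial>lborel)"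
proof -
  define D where "D = 2 * real CARD('n)"
  define \<kappa> where "\<kappa> = p * q"
  define \<gamma> where "\<gamma> = D + 2 - \<beta>"
  have \<kappa>: "\<kappa> > 0" using p q by (simp add: \<kappa>_def)
  obtain C1 where C1: "C1 > 0"
    "\<And>(f :: complex^'n \<Rightarrow> complex) \<Psi> z \<beta>. slice_holomorphic f \<Longrightarrow> gauss_dominated q \<Psi> f \<Longrightarrow>
      ennreal (\<Psi> z powr p * (1 + norm z) powr (- \<beta>)) \<le> ennreal C1 *
      (\<integral>\<^sup>+x. tube_kernel (p * q) (2 * real CARD('n) + 2 - \<beta>) z x * ennreal (gauss_abs f (snd x) powr p) \<partial>lborel)"
    using dominated_pointwise[OF p q, where 'n='n] by blast
  note C1' = C1(2)[of _ _ _ \<beta>, folded D_def \<kappa>_def, folded \<gamma>_def]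
  define C2 where "C2 = 24 powr \<bar>\<gamma>\<bar> * exp (36 * \<kappa>) * (unit_ball_vol D * 120 powr D)"
  have "unit_ball_vol D > 0" by (intro unit_ball_vol_pos) (simp add: D_def)
  then have C2: "C2 > 0" by (simp add: C2_def)
  define C where "C = C1 * (C2 * (2 / \<kappa>))"
  have "C > 0" using C1 C2 \<kappa> by (simp add: C_def)
  moreover have "(\<integral>\<^sup>+z. ennreal (\<Psi> z powr p * (1 + norm z) powr (- \<beta>)) \<partial>lborel) \<le> ennreal C *
      (\<integral>\<^sup>+z. ennreal (gauss_abs f z powr p * (1 + norm z) powr (- \<beta>)) \<partial>lborel)"
    if f: "slice_holomorphic f" and dom: "gauss_dominated q \<Psi> f" for f :: "complex^'n \<Rightarrow> complex" and \<Psi>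
  proof -
    define u where "u w = ennreal (gauss_abs f w powr p)" for w
    have "gauss_abs f \<in> borel_measurable borel"
      by (intro borel_measurable_gauss_abs slice_holomorphic_cont f)
    then have um [measurable]: "u \<in> borel_measurable borel" unfolding u_def by measurable
    have snd_m: "snd \<in> measurable (borel :: (real \<times> (complex^'n)) measure) borel"
      by (intro borel_measurable_continuous_onI continuous_intros)
    have usm: "(\<lambda>x :: real \<times> (complex^'n). u (snd x)) \<in> borel_measurable borel"
      by (rule measurable_compose[OF snd_m um])
    have Km: "(\<lambda>(z, x). tube_kernel \<kappa> \<gamma> z x * u (snd x)) \<in> borel_measurable (lborel \<Otimes>\<^sub>M lborel)"
    proof -
      have [measurable]: "(\<lambda>x :: real \<times> (complex^'n). u (snd x)) \<in> borel_measurable borel" by (rule usm)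
      have [measurable]: "(\<lambda>y :: (complex^'n) \<times> (real \<times> (complex^'n)). tube_kernel \<kappa> \<gamma> (fst y) (snd y)) \<in> borel_measurable (borel \<Otimes>\<^sub>M borel)"
        using tube_kernel_measurable[of \<kappa> \<gamma>] by (simp add: case_prod_unfold)
      have "(\<lambda>y :: (complex^'n) \<times> (real \<times> (complex^'n)). u (snd (snd y))) \<in> borel_measurable (borel \<Otimes>\<^sub>M borel)"
        by (rule measurable_compose[OF measurable_snd usm])
      then have "(\<lambda>y. tube_kernel \<kappa> \<gamma> (fst y) (snd y) * u (snd (snd y))) \<in> borel_measurable (borel \<Otimes>\<^sub>M borel)"
        by measurable
      then show ?thesis by (simp add: case_prod_unfold cong: measurable_cong_sets sets_pair_measure_cong)
    qed
    define E where "E t w = ennreal (C2 * (1 + norm w) powr (\<gamma> - D)) * (u w * (ennreal (exp (- (\<kappa> * (1 + (norm w)\<^sup>2)) * (1 - t))) * indicator {1/4..1} t))"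
      for t :: real and w :: "complex^'n"
    have inner: "(\<integral>\<^sup>+z. tube_kernel \<kappa> \<gamma> z x * u (snd x) \<partial>lborel) \<le> E (fst x) (snd x)" for x
    proof (cases "1/4 \<le> fst x \<and> fst x \<le> 1")
      case True
      have "(\<lambda>z. tube_kernel \<kappa> \<gamma> z x) \<in> borel_measurable borel"
        using measurable_compose[OF measurable_Pair2'[of x borel borel] tube_kernel_measurable[of \<kappa> \<gamma>]]
        by simp
      then have "(\<integral>\<^sup>+z. tube_kernel \<kappa> \<gamma> z x * u (snd x) \<partial>lborel) =
          (\<integral>\<^sup>+z. tube_kernel \<kappa> \<gamma> z (fst x, snd x) \<partial>lborel) * u (snd x)"
        by (subst nn_integral_multc) auto
      also have "\<dots> \<le> ennreal (C2 * (1 + norm (snd x)) powr (\<gamma> - D) * exp (- \<kappa> * (1 - fst x) * (1 + (norm (snd x))\<^sup>2))) * u (snd x)"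
        unfolding C2_def D_def using tube_kernel_integral_bound[OF \<kappa>, of "fst x" \<gamma> "snd x"] True
        by (intro mult_right_mono) auto
      also have "\<dots> = E (fst x) (snd x)"
        using True C2 by (simp add: E_def ennreal_mult mult_ac)
      finally show ?thesis .
    next
      case False
      then show ?thesis by (auto simp: tube_kernel_def cong: if_cong)
    qed
    have Em: "(\<lambda>x. E (fst x) (snd x)) \<in> borel_measurable (borel \<Otimes>\<^sub>M borel)"
      unfolding E_def by measurable
    have "(\<integral>\<^sup>+z. ennreal (\<Psi> z powr p * (1 + norm z) powr (- \<beta>)) \<partial>lborel) \<le>
        (\<integral>\<^sup>+z. ennreal C1 * (\<integral>\<^sup>+x. tube_kernel \<kappa> \<gamma> z x * u (snd x) \<partial>lborel) \<partial>lborel)"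
      unfolding u_def by (intro nn_integral_mono C1' f dom)
    also have "\<dots> = ennreal C1 * (\<integral>\<^sup>+z. (\<integral>\<^sup>+x. tube_kernel \<kappa> \<gamma> z x * u (snd x) \<partial>lborel) \<partial>lborel)"
      using lborel.borel_measurable_nn_integral[OF Km] by (intro nn_integral_cmult) simp
    also have "(\<integral>\<^sup>+z. (\<integral>\<^sup>+x. tube_kernel \<kappa> \<gamma> z x * u (snd x) \<partial>lborel) \<partial>lborel) =
        (\<integral>\<^sup>+x. (\<integral>\<^sup>+z. tube_kernel \<kappa> \<gamma> z x * u (snd x) \<partial>lborel) \<partial>lborel)"
      by (rule lborel_pair.Fubini'[OF Km, symmetric])
    also have "\<dots> \<le> (\<integral>\<^sup>+x. E (fst x) (snd x) \<partial>lborel)"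
      by (intro nn_integral_mono inner)
    also have "\<dots> = (\<integral>\<^sup>+x. E (fst x) (snd x) \<partial>(lborel \<Otimes>\<^sub>M lborel))" by (simp add: lborel_prod)
    also have "\<dots> = (\<integral>\<^sup>+w. (\<integral>\<^sup>+t. E t w \<partial>lborel) \<partial>lborel)"
    proof -
      have "(\<lambda>x. E (fst x) (snd x)) \<in> borel_measurable (lborel \<Otimes>\<^sub>M lborel)"
        using Em by (simp cong: measurable_cong_sets sets_pair_measure_cong)
      from lborel_pair.nn_integral_snd[OF this]
      show ?thesis by simp
    qed
    also have "\<dots> \<le> (\<integral>\<^sup>+w. ennreal (C2 * (2 / \<kappa>)) * ennreal (gauss_abs f w powr p * (1 + norm w) powr (- \<beta>)) \<partial>lborel)"
    proof (rule nn_integral_mono)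
      fix w :: "complex^'n"
      let ?b = "norm w"
      have b0: "?b \<ge> 0" by simp
      then have b1: "1 + ?b > 0" by linarith
      have l: "\<kappa> * (1 + ?b\<^sup>2) > 0" using \<kappa> by (simp add: add_pos_nonneg)
      have "(\<integral>\<^sup>+t. E t w \<partial>lborel) = ennreal (C2 * (1 + ?b) powr (\<gamma> - D)) * (u w *
          (\<integral>\<^sup>+t. ennreal (exp (- (\<kappa> * (1 + ?b\<^sup>2)) * (1 - t))) * indicator {1/4..1} t \<partial>lborel))"
        unfolding E_def by (simp add: nn_integral_cmult)
      also have "\<dots> \<le> ennreal (C2 * (1 + ?b) powr (\<gamma> - D)) * (u w * ennreal (1 / (\<kappa> * (1 + ?b\<^sup>2))))"
        by (intro mult_left_mono nn_integral_exp_le l) auto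
      also have "\<dots> = ennreal (C2 * (1 + ?b) powr (\<gamma> - D) * (1 / (\<kappa> * (1 + ?b\<^sup>2))) * gauss_abs f w powr p)"
        using C2 l by (simp add: u_def ennreal_mult'[symmetric] mult_ac)
      also have "\<dots> \<le> ennreal (C2 * (2 / \<kappa>) * (1 + ?b) powr (- \<beta>) * gauss_abs f w powr p)"
      proof (intro ennreal_leI mult_right_mono)
        have sq: "(1 + ?b)\<^sup>2 \<le> 2 * (1 + ?b\<^sup>2)"
          using sum_squares_bound[of 1 ?b] by (simp add: power2_eq_square algebra_simps)
        have "(1 + ?b) powr (\<gamma> - D) = (1 + ?b) powr (- \<beta>) * (1 + ?b)\<^sup>2"
          using b1 powr_realpow[OF b1, of 2] by (simp add: \<gamma>_def powr_add[symmetric] algebra_simps flip: powr_numeral)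
        then have "(1 + ?b) powr (\<gamma> - D) * (1 / (\<kappa> * (1 + ?b\<^sup>2))) =
            (1 + ?b) powr (- \<beta>) * ((1 + ?b)\<^sup>2 / (\<kappa> * (1 + ?b\<^sup>2)))" by simp
        also have "\<dots> \<le> (1 + ?b) powr (- \<beta>) * (2 / \<kappa>)"
        proof (rule mult_left_mono)
          show "(1 + ?b)\<^sup>2 / (\<kappa> * (1 + ?b\<^sup>2)) \<le> 2 / \<kappa>"
            unfolding pos_divide_le_eq[OF l] using sq \<kappa> by (simp add: mult.assoc[symmetric])
        qed simp
        finally have "C2 * ((1 + ?b) powr (\<gamma> - D) * (1 / (\<kappa> * (1 + ?b\<^sup>2)))) \<le>
            C2 * ((1 + ?b) powr (- \<beta>) * (2 / \<kappa>))"
          using C2 by (intro mult_left_mono) auto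
        then show "C2 * (1 + ?b) powr (\<gamma> - D) * (1 / (\<kappa> * (1 + ?b\<^sup>2))) \<le> C2 * (2 / \<kappa>) * (1 + ?b) powr (- \<beta>)"
          by (simp only: mult_ac)
      qed simp
      also have "\<dots> = ennreal (C2 * (2 / \<kappa>)) * ennreal (gauss_abs f w powr p * (1 + ?b) powr (- \<beta>))"
        using C2 \<kappa> by (simp add: ennreal_mult'[symmetric] mult_ac)
      finally show "(\<integral>\<^sup>+t. E t w \<partial>lborel) \<le> \<dots>" .
    qed
    also have "\<dots> = ennreal (C2 * (2 / \<kappa>)) * (\<integral>\<^sup>+w. ennreal (gauss_abs f w powr p * (1 + norm w) powr (- \<beta>)) \<partial>lborel)"
    proof (rule nn_integral_cmult)
      have [measurable]: "gauss_abs f \<in> borel_measurable borel"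
        by (intro borel_measurable_gauss_abs slice_holomorphic_cont f)
      show "(\<lambda>w. ennreal (gauss_abs f w powr p * (1 + norm w) powr (- \<beta>))) \<in> borel_measurable lborel"
        by measurable
    qed
    also have "ennreal C1 * (ennreal (C2 * (2 / \<kappa>)) *
        (\<integral>\<^sup>+w. ennreal (gauss_abs f w powr p * (1 + norm w) powr (- \<beta>)) \<partial>lborel)) =
      ennreal C * (\<integral>\<^sup>+w. ennreal (gauss_abs f w powr p * (1 + norm w) powr (- \<beta>)) \<partial>lborel)"
    proof -
      have "ennreal C = ennreal C1 * ennreal (C2 * (2 / \<kappa>))"
        unfolding C_def using C1 C2 \<kappa> by (intro ennreal_mult) auto
      then show ?thesis by (simp only: mult.assoc)
    qed
    finally show ?thesis by (simp add: mult_left_mono)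
  qed
  ultimately show ?thesis by (rule that)
qed

section \<open>Weighted norms\<close>

lemma ennreal_powr_mono:
  assumes "x \<le> y" "0 < r"
  shows "ennreal_powr x r \<le> ennreal_powr y r"
proof (cases "y = \<infinity>")
  case False
  then have "x \<noteq> \<infinity>" using assms(1) by (auto simp: top_unique)
  with False show ?thesis
    unfolding ennreal_powr_def using assms
    by (auto intro!: ennreal_leI powr_mono2 enn2real_mono simp: top.not_eq_extremum)
qed (simp add: ennreal_powr_def)

lemma ennreal_powr_mult:
  assumes "0 < k" "0 < r"
  shows "ennreal_powr (ennreal k * x) r = ennreal (k powr r) * ennreal_powr x r"
  using assms
  by (cases x) (auto simp: ennreal_powr_def ennreal_mult_top ennreal_mult'[symmetric] powr_mult)

text \<open>Comparison with twice the maximum works for every \<open>r > 0\<close>, so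
  \<open>r = 1 / p\<close> is covered on both sides of 1.\<close>

lemma ennreal_powr_add:
  assumes "0 < r"
  shows "ennreal_powr (x + y) r \<le> ennreal (2 powr r) * (ennreal_powr x r + ennreal_powr y r)"
proof -
  have "x + y \<le> ennreal 2 * max x y"
    by (metis add_mono ennreal_numeral max.cobounded1 max.cobounded2 mult_2 zero_le_numeral)
  then have "ennreal_powr (x + y) r \<le> ennreal (2 powr r) * ennreal_powr (max x y) r"
    using ennreal_powr_mono[OF _ assms] ennreal_powr_mult[OF _ assms, of 2 "max x y"] by fastforce
  also have "ennreal_powr (max x y) r \<le> ennreal_powr x r + ennreal_powr y r"
    by (auto simp: max_def)
  finally show ?thesis by (simp add: mult_left_mono)
qed

text \<open>Combines \<open>ln (1 + x) \<le> x\<close> with completing the square in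
  \<open>\<bar>M\<bar> * x\<close>.\<close>

lemma powr_le_exp_sq:
  fixes x M \<kappa> :: real
  assumes "0 \<le> x" "0 < \<kappa>"
  shows "(1 + x) powr M \<le> exp (M\<^sup>2 / (4 * \<kappa>)) * exp (\<kappa> * x\<^sup>2)"
proof -
  have "M * ln (1 + x) \<le> \<bar>M\<bar> * x"
  proof -
    have "0 \<le> ln (1 + x)" "ln (1 + x) \<le> x" using assms ln_add_one_self_le_self[of x] by auto
    then have "\<bar>M\<bar> * ln (1 + x) \<le> \<bar>M\<bar> * x" by (intro mult_left_mono) auto
    moreover have "M * ln (1 + x) \<le> \<bar>M\<bar> * ln (1 + x)" using \<open>0 \<le> ln (1 + x)\<close> by (intro mult_right_mono) auto
    ultimately show ?thesis by linarith
  qed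
  also have "\<bar>M\<bar> * x \<le> M\<^sup>2 / (4 * \<kappa>) + \<kappa> * x\<^sup>2"
  proof -
    have "0 \<le> (\<bar>M\<bar> - 2 * \<kappa> * x)\<^sup>2 / (4 * \<kappa>)" using assms by simp
    also have "\<dots> = M\<^sup>2 / (4 * \<kappa>) + \<kappa> * x\<^sup>2 - \<bar>M\<bar> * x"
      using assms by (simp add: power2_eq_square field_simps)
    finally show ?thesis by simp
  qed
  finally show ?thesis using assms by (simp add: powr_def exp_add[symmetric])
qed

lemma nn_integral_gaussian_finite:
  assumes \<kappa>: "\<kappa> > 0"
  shows "(\<integral>\<^sup>+z. ennreal (exp (- \<kappa> * (norm (z :: complex^'n))\<^sup>2)) \<partial>lborel) < \<infinity>"
proof -
  define \<sigma> where "\<sigma> = sqrt (1 / (2 * \<kappa>))"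
  have \<sigma>: "\<sigma> > 0" "\<sigma>\<^sup>2 = 1 / (2 * \<kappa>)" using \<kappa> by (auto simp: \<sigma>_def)
  have one: "(\<integral>\<^sup>+x. ennreal (exp (- \<kappa> * x\<^sup>2)) \<partial>lborel) < \<infinity>"
  proof -
    have "exp (- \<kappa> * x\<^sup>2) = sqrt (2 * pi * \<sigma>\<^sup>2) * normal_density 0 \<sigma> x" for x
      using \<kappa> \<sigma> by (simp add: normal_density_def)
    moreover have "integrable lborel (\<lambda>x. sqrt (2 * pi * \<sigma>\<^sup>2) * normal_density 0 \<sigma> x)"
      using \<sigma> by (intro integrable_mult_right) auto
    ultimately have "integrable lborel (\<lambda>x. exp (- \<kappa> * x\<^sup>2))" by simp
    then show ?thesis by (simp add: integrable_iff_bounded)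
  qed
  have "(\<integral>\<^sup>+z. ennreal (exp (- \<kappa> * (norm (z :: complex^'n))\<^sup>2)) \<partial>lborel) =
      (\<integral>\<^sup>+z. (\<Prod>b\<in>Basis. ennreal (exp (- \<kappa> * (z \<bullet> b)\<^sup>2))) \<partial>(lborel :: (complex^'n) measure))"
  proof (rule nn_integral_cong)
    fix z :: "complex^'n"
    have "(norm z)\<^sup>2 = (\<Sum>b\<in>Basis. (z \<bullet> b)\<^sup>2)"
      by (subst power2_norm_eq_inner, subst euclidean_inner) (simp add: power2_eq_square)
    then show "ennreal (exp (- \<kappa> * (norm z)\<^sup>2)) = (\<Prod>b\<in>Basis. ennreal (exp (- \<kappa> * (z \<bullet> b)\<^sup>2)))"
      by (simp add: prod_ennreal exp_sum[symmetric] sum_distrib_left sum_negf)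
  qed
  also have "\<dots> = (\<Prod>b\<in>(Basis :: (complex^'n) set). (\<integral>\<^sup>+x. ennreal (exp (- \<kappa> * x\<^sup>2)) \<partial>lborel))"
    by (rule nn_integral_lborel_prod) auto
  also have "\<dots> < \<infinity>"
    using one by (auto simp: less_top[symmetric] power_eq_top_ennreal)
  finally show ?thesis .
qed

section \<open>Norms of continuous functions as Borel integrals and pointwise suprema\<close>

abbreviation weighted_integral :: "real \<Rightarrow> real \<Rightarrow> (complex^'n::finite \<Rightarrow> real) \<Rightarrow> ennreal" where
  "weighted_integral P \<alpha> u \<equiv> (\<integral>\<^sup>+z. ennreal (u z powr P * (1 + norm z) powr (- \<alpha>)) \<partial>lborel)"

definition dV_const :: "'n::finite itself \<Rightarrow> ennreal" where
  "dV_const _ = inverse (\<integral>\<^sup>+ z. ennreal (exp (- (norm z)\<^sup>2)) \<partial>(lebesgue :: (complex^'n::finite) measure))"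

lemma dV_eq: "dV = scale_measure (dV_const TYPE('n)) (lebesgue :: (complex^'n) measure)"
  by (simp add: dV_def dV_const_def)

lemma dV_const_pos_finite: "0 < dV_const TYPE('n::finite)" "dV_const TYPE('n) < \<infinity>"
proof -
  let ?G = "\<integral>\<^sup>+ z. ennreal (exp (- (norm z)\<^sup>2)) \<partial>(lborel :: (complex^'n) measure)"
  have "?G < \<infinity>" using nn_integral_gaussian_finite[of 1, where 'n='n] by simp
  moreover have "?G > 0"
  proof -
    have "0 < ennreal (exp (- 1)) * emeasure lborel (ball (0 :: complex^'n) 1)"
      unfolding ennreal_zero_less_mult_iff by (subst emeasure_ball_complex_vec) auto
    also have "\<dots> = (\<integral>\<^sup>+ z. ennreal (exp (- 1)) * indicator (ball 0 1) z \<partial>(lborel :: (complex^'n) measure))"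
      by (simp add: nn_integral_cmult_indicator)
    also have "\<dots> \<le> ?G"
      by (intro nn_integral_mono) (auto simp: indicator_def power_le_one intro!: ennreal_leI)
    finally show ?thesis .
  qed
  ultimately obtain g where "?G = ennreal g" "g > 0"
    by (cases ?G) (auto simp: ennreal_less_zero_iff)
  then have "dV_const TYPE('n) = ennreal (inverse g)"
    by (simp add: dV_const_def nn_integral_completion inverse_ennreal)
  then show "0 < dV_const TYPE('n)" "dV_const TYPE('n) < \<infinity>"
    using \<open>g > 0\<close> by auto
qed

text \<open>Continuity makes the integrand Borel, so completed Lebesgue measure can be exchanged for
  \<open>lborel\<close>, on which the kernel estimates are stated; the normalization survives only
  as a constant factor.\<close>

lemma L_norm_finite_exponent:
  fixes \<psi> :: "complex^'n \<Rightarrow> complex"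
  assumes "p \<noteq> \<infinity>" and cont: "continuous_on UNIV \<psi>"
  shows "L_norm p \<alpha> \<psi> = ennreal_powr (dV_const TYPE('n) *
    weighted_integral (enn2real p) \<alpha> (gauss_abs \<psi>)) (1 / enn2real p)"
proof -
  have eq: "cmod (\<psi> z * of_real (exp (- (norm z)\<^sup>2 / 2))) = gauss_abs \<psi> z" for z
    by (simp add: gauss_abs_def norm_mult)
  have [measurable]: "gauss_abs \<psi> \<in> borel_measurable borel"
    by (rule borel_measurable_gauss_abs[OF cont])
  have m1: "(\<lambda>z :: complex^'n. ennreal ((1 + norm z) powr (- \<alpha>))) \<in> borel_measurable lborel"
    "(\<lambda>z. ennreal (gauss_abs \<psi> z powr enn2real p)) \<in> borel_measurable lborel"
    by measurable
  then have m: "(\<lambda>z :: complex^'n. ennreal ((1 + norm z) powr (- \<alpha>))) \<in> borel_measurable lebesgue"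
    "(\<lambda>z. ennreal (gauss_abs \<psi> z powr enn2real p)) \<in> borel_measurable lebesgue"
    by (auto intro: measurable_completion)
  have "(\<integral>\<^sup>+ z. ennreal (gauss_abs \<psi> z powr enn2real p) \<partial>dV_weighted \<alpha>) =
      (\<integral>\<^sup>+ z. ennreal ((1 + norm z) powr (- \<alpha>)) * ennreal (gauss_abs \<psi> z powr enn2real p) \<partial>dV)"
    unfolding dV_weighted_def dV_eq
    by (rule nn_integral_density) (use m in \<open>simp_all cong: measurable_cong_sets\<close>)
  also have "\<dots> = dV_const TYPE('n) * (\<integral>\<^sup>+ z. ennreal ((1 + norm z) powr (- \<alpha>)) * ennreal (gauss_abs \<psi> z powr enn2real p) \<partial>lebesgue)"
    unfolding dV_eq by (rule nn_integral_scale_measure) (use m in auto)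
  finally show ?thesis
    using assms(1) unfolding L_norm_def eq
    by (simp add: nn_integral_completion ennreal_mult'[symmetric] mult.commute)
qed

text \<open>A closed set of full Lebesgue measure is the whole space, so an essential bound of a
  continuous function holds at every point. Describing all upper bounds \<open>K\<close> avoids
  handling the supremum itself.\<close>

lemma L_norm_infinity:
  fixes \<psi> :: "complex^'n \<Rightarrow> complex"
  assumes cont: "continuous_on UNIV \<psi>"
  shows "L_norm \<infinity> \<alpha> \<psi> \<le> K \<longleftrightarrow> (\<forall>z. ennreal (gauss_abs \<psi> z / (1 + norm z) powr \<alpha>) \<le> K)"
proof -
  define h where "h z = ennreal (gauss_abs \<psi> z / (1 + norm z) powr \<alpha>)" for z
  have hc: "continuous_on UNIV h"
    unfolding h_def using add_pos_nonneg[of 1 "norm (_ :: complex^'n)"]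
    by (intro continuous_on_ennreal continuous_intros continuous_on_gauss_abs cont)
       (auto simp: add_nonneg_eq_0_iff)
  have "h \<in> borel_measurable lborel"
    using borel_measurable_continuous_onI[OF hc] by simp
  then have hm: "h \<in> borel_measurable lebesgue" by (rule measurable_completion)
  then have hmV: "h \<in> borel_measurable dV" unfolding dV_eq by (simp cong: measurable_cong_sets)
  have L: "L_norm \<infinity> \<alpha> \<psi> = esssup dV h"
    by (simp add: L_norm_def h_def[abs_def] gauss_abs_def)
  \<comment> \<open>Scaling a measure by a constant strictly between 0 and infinity keeps its null
    sets.\<close>
  have AE: "(AE z in dV. P z) \<longleftrightarrow> (AE z in (lebesgue :: (complex^'n) measure). P z)" for P
    using dV_const_pos_finite[where 'n='n]
    by (auto simp: dV_eq eventually_ae_filter null_sets_def space_scale_measure)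
  show ?thesis
    unfolding L h_def[symmetric]
  proof
    assume "esssup dV h \<le> K"
    then have "AE z in dV. h z \<le> K" using esssup_AE[where M = dV and f = h] by (auto elim!: eventually_mono)
    then have ae: "AE z in lebesgue. z \<in> {z. h z \<le> K}" by (simp add: AE)
    have "closed {z. h z \<le> K}"
      by (rule closed_Collect_le[OF hc]) auto
    then show "\<forall>z. h z \<le> K" using mem_closed_if_AE_lebesgue[OF _ ae] by auto
  next
    assume "\<forall>z. h z \<le> K"
    then show "esssup dV h \<le> K" by (intro esssup_I hmV) auto
  qed
qed

lemma L_norm_infinity_ge:
  fixes \<psi> :: "complex^'n \<Rightarrow> complex"
  assumes "continuous_on UNIV \<psi>"
  shows "ennreal (gauss_abs \<psi> z / (1 + norm z) powr \<alpha>) \<le> L_norm \<infinity> \<alpha> \<psi>"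
  using L_norm_infinity[OF assms] by blast

lemma L_norm_mono:
  fixes \<phi> \<psi> :: "complex^'n \<Rightarrow> complex"
  assumes p: "0 < p" and cont: "continuous_on UNIV \<phi>" "continuous_on UNIV \<psi>"
    and K: "0 < K" and le: "\<And>z. gauss_abs \<phi> z \<le> K * gauss_abs \<psi> z"
  shows "L_norm p \<alpha> \<phi> \<le> ennreal K * L_norm p \<alpha> \<psi>"
proof (cases "p = \<infinity>")
  case True
  have "ennreal (gauss_abs \<phi> z / (1 + norm z) powr \<alpha>) \<le> ennreal K * L_norm \<infinity> \<alpha> \<psi>" for z
  proof -
    have "gauss_abs \<phi> z / (1 + norm z) powr \<alpha> \<le> K * (gauss_abs \<psi> z / (1 + norm z) powr \<alpha>)"
      using divide_right_mono[OF le[of z], of "(1 + norm z) powr \<alpha>"] by simp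
    then have "ennreal (gauss_abs \<phi> z / (1 + norm z) powr \<alpha>) \<le> ennreal K * ennreal (gauss_abs \<psi> z / (1 + norm z) powr \<alpha>)"
      using K by (subst ennreal_mult'[symmetric]) (auto intro!: ennreal_leI)
    also have "\<dots> \<le> ennreal K * L_norm \<infinity> \<alpha> \<psi>"
      by (intro mult_left_mono L_norm_infinity_ge cont) simp
    finally show ?thesis .
  qed
  then show ?thesis using True L_norm_infinity[OF cont(1)] by blast
next
  case False
  define P where "P = enn2real p"
  have P: "P > 0" using p False by (simp add: P_def enn2real_positive_iff less_top)
  have [measurable]: "gauss_abs \<psi> \<in> borel_measurable borel"
    by (rule borel_measurable_gauss_abs[OF cont(2)])
  have "weighted_integral P \<alpha> (gauss_abs \<phi>) \<le>
     (\<integral>\<^sup>+z. ennreal (K powr P) * ennreal (gauss_abs \<psi> z powr P * (1 + norm z) powr (- \<alpha>)) \<partial>lborel)"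
  proof (rule nn_integral_mono)
    fix z :: "complex^'n"
    have "gauss_abs \<phi> z powr P \<le> (K * gauss_abs \<psi> z) powr P"
      using le P by (intro powr_mono2) auto
    then have "gauss_abs \<phi> z powr P * (1 + norm z) powr (- \<alpha>) \<le> K powr P * (gauss_abs \<psi> z powr P * (1 + norm z) powr (- \<alpha>))"
      by (simp add: powr_mult mult.assoc[symmetric] mult_right_mono)
    then show "ennreal (gauss_abs \<phi> z powr P * (1 + norm z) powr (- \<alpha>)) \<le>
        ennreal (K powr P) * ennreal (gauss_abs \<psi> z powr P * (1 + norm z) powr (- \<alpha>))"
      by (subst ennreal_mult'[symmetric]) (auto intro!: ennreal_leI)
  qed
  also have "\<dots> = ennreal (K powr P) * weighted_integral P \<alpha> (gauss_abs \<psi>)"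
    by (rule nn_integral_cmult) measurable
  finally have "dV_const TYPE('n) * weighted_integral P \<alpha> (gauss_abs \<phi>) \<le>
     ennreal (K powr P) * (dV_const TYPE('n) * weighted_integral P \<alpha> (gauss_abs \<psi>))"
    by (subst mult.left_commute) (rule mult_left_mono, auto)
  from ennreal_powr_mono[OF this, of "1 / P"] P
  have "L_norm p \<alpha> \<phi> \<le> ennreal_powr (ennreal (K powr P) * (dV_const TYPE('n) *
      weighted_integral P \<alpha> (gauss_abs \<psi>))) (1 / P)"
    unfolding L_norm_finite_exponent[OF False cont(1)] P_def[symmetric] by simp
  also have "\<dots> = ennreal ((K powr P) powr (1 / P)) * L_norm p \<alpha> \<psi>"
    unfolding L_norm_finite_exponent[OF False cont(2)] P_def[symmetric]
    using P K by (intro ennreal_powr_mult) auto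
  finally show ?thesis using P K by (simp add: powr_powr)
qed

lemma gauss_dominated_L_norm:
  fixes p :: ennreal and q \<alpha> :: real
  assumes p: "0 < p" and q: "0 < q"
  obtains C where "C > 0"
    "\<And>(f :: complex^'n \<Rightarrow> complex) \<phi>. slice_holomorphic f \<Longrightarrow> continuous_on UNIV \<phi> \<Longrightarrow>
      gauss_dominated q (gauss_abs \<phi>) f \<Longrightarrow> L_norm p \<alpha> \<phi> \<le> ennreal C * L_norm p \<alpha> f"
proof (cases "p = \<infinity>")
  case True
  \<comment> \<open>For the supremum norm the value at \<open>w\<close> is used directly; 4 compares
    \<open>1 + norm w\<close> with \<open>1 + norm z\<close> when
    \<open>t \<ge> 1/2\<close>.\<close>
  have "L_norm p \<alpha> \<phi> \<le> ennreal (4 powr \<bar>\<alpha>\<bar>) * L_norm p \<alpha> f"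
    if f: "slice_holomorphic f" and \<phi>: "continuous_on UNIV \<phi>" and dom: "gauss_dominated q (gauss_abs \<phi>) f"
    for f \<phi> :: "complex^'n \<Rightarrow> complex"
  proof -
    have "ennreal (gauss_abs \<phi> z / (1 + norm z) powr \<alpha>) \<le> ennreal (4 powr \<bar>\<alpha>\<bar>) * L_norm \<infinity> \<alpha> f" for z
    proof -
      let ?a = "norm z"
      have a0: "?a \<ge> 0" by simp
      then have a1: "1 + ?a > 0" by linarith
      obtain t w where t: "1/2 \<le> t" "t \<le> 1" and w: "norm (w - t *\<^sub>R z) \<le> 1 / (1 + ?a)"
        and le: "gauss_abs \<phi> z \<le> exp (- q * (1 - t\<^sup>2) * ?a\<^sup>2) * gauss_abs f w"
        using dom unfolding gauss_dominated_def by (meson atLeastAtMost_iff)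
      have "t\<^sup>2 \<le> 1" using t by (simp add: power_le_one)
      then have "exp (- q * (1 - t\<^sup>2) * ?a\<^sup>2) \<le> 1" using q by simp
      then have le': "gauss_abs \<phi> z \<le> gauss_abs f w"
        using le mult_right_mono[of _ 1 "gauss_abs f w"] by fastforce
      have i1: "1 / (1 + ?a) \<le> 1" using a0 a1 by (simp add: field_simps)
      have ta: "t * ?a \<le> ?a" "1/2 * ?a \<le> t * ?a"
        using t a0 mult_right_mono[of "1/2" t ?a] by (auto simp: mult_left_le_one_le)
      have "norm w \<le> t * ?a + 1"
        using norm_triangle_ineq[of "t *\<^sub>R z" "w - t *\<^sub>R z"] w t i1 by simp
      then have c1: "1 + norm w \<le> 4 * (1 + ?a)" using ta a0 unfolding distrib_left by linarith
      have "t * ?a \<le> norm w + 1"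
        using norm_triangle_ineq[of w "t *\<^sub>R z - w"] w t i1 by (simp add: norm_minus_commute)
      moreover have "norm w \<ge> 0" by simp
      ultimately have c2: "1 + ?a \<le> 4 * (1 + norm w)" using ta unfolding distrib_left by linarith
      have w1: "1 + norm w > 0" by (simp add: add_pos_nonneg)
      have "(1 + norm w) powr \<alpha> \<le> 4 powr \<bar>\<alpha>\<bar> * (1 + ?a) powr \<alpha>"
        by (rule powr_le_of_comparable[OF w1 a1 _ c1 c2]) simp
      then have "gauss_abs f w * (1 + norm w) powr \<alpha> \<le> gauss_abs f w * (4 powr \<bar>\<alpha>\<bar> * (1 + ?a) powr \<alpha>)"
        by (intro mult_left_mono) auto
      then have "gauss_abs f w / (1 + ?a) powr \<alpha> \<le> 4 powr \<bar>\<alpha>\<bar> * (gauss_abs f w / (1 + norm w) powr \<alpha>)"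
        using a1 w1 by (simp add: field_simps)
      moreover have "gauss_abs \<phi> z / (1 + ?a) powr \<alpha> \<le> gauss_abs f w / (1 + ?a) powr \<alpha>"
        using le' by (intro divide_right_mono) auto
      ultimately have "gauss_abs \<phi> z / (1 + ?a) powr \<alpha> \<le> 4 powr \<bar>\<alpha>\<bar> * (gauss_abs f w / (1 + norm w) powr \<alpha>)"
        by linarith
      then have "ennreal (gauss_abs \<phi> z / (1 + ?a) powr \<alpha>) \<le> ennreal (4 powr \<bar>\<alpha>\<bar>) * ennreal (gauss_abs f w / (1 + norm w) powr \<alpha>)"
        by (subst ennreal_mult'[symmetric]) (auto intro!: ennreal_leI)
      also have "\<dots> \<le> ennreal (4 powr \<bar>\<alpha>\<bar>) * L_norm \<infinity> \<alpha> f"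
        by (intro mult_left_mono L_norm_infinity_ge slice_holomorphic_cont f) simp
      finally show ?thesis .
    qed
    then show ?thesis using True L_norm_infinity[OF \<phi>] by blast
  qed
  moreover have "4 powr \<bar>\<alpha>\<bar> > 0" by simp
  ultimately show ?thesis using that by blast
next
  case False
  define P where "P = enn2real p"
  have P: "P > 0" using p False by (simp add: P_def enn2real_positive_iff less_top)
  obtain C where C: "C > 0"
    "\<And>(f :: complex^'n \<Rightarrow> complex) \<Psi>. slice_holomorphic f \<Longrightarrow> gauss_dominated q \<Psi> f \<Longrightarrow>
      (\<integral>\<^sup>+z. ennreal (\<Psi> z powr P * (1 + norm z) powr (- \<alpha>)) \<partial>lborel) \<le> ennreal C *
      weighted_integral P \<alpha> (gauss_abs f)"
    using gauss_dominated_estimate[OF P q, where 'n='n and \<beta>=\<alpha>] by blast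
  have "L_norm p \<alpha> \<phi> \<le> ennreal (C powr (1 / P)) * L_norm p \<alpha> f"
    if f: "slice_holomorphic f" and \<phi>: "continuous_on UNIV \<phi>" and dom: "gauss_dominated q (gauss_abs \<phi>) f"
    for f \<phi> :: "complex^'n \<Rightarrow> complex"
  proof -
    have "dV_const TYPE('n) * weighted_integral P \<alpha> (gauss_abs \<phi>) \<le>
      ennreal C * (dV_const TYPE('n) * weighted_integral P \<alpha> (gauss_abs f))"
      by (subst mult.left_commute) (intro mult_left_mono C(2) f dom, auto)
    from ennreal_powr_mono[OF this, of "1 / P"] P
    have "L_norm p \<alpha> \<phi> \<le> ennreal_powr (ennreal C * (dV_const TYPE('n) *
        weighted_integral P \<alpha> (gauss_abs f))) (1 / P)"
      unfolding L_norm_finite_exponent[OF False \<phi>] P_def[symmetric] by simp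
    also have "\<dots> = ennreal (C powr (1 / P)) * L_norm p \<alpha> f"
      unfolding L_norm_finite_exponent[OF False slice_holomorphic_cont[OF f]] P_def[symmetric]
      using P C(1) by (intro ennreal_powr_mult) auto
    finally show ?thesis .
  qed
  moreover have "C powr (1 / P) > 0" using C(1) by simp
  ultimately show ?thesis using that by blast
qed

text \<open>The factor enters the integral for finite \<open>p\<close> with power
  \<open>\<sigma> * p\<close>, but the supremum with power \<open>\<sigma>\<close>; the two cases of
  \<open>shifted_weight\<close> make this one identity.\<close>

lemma L_norm_weight_shift:
  fixes \<psi> :: "complex^'n \<Rightarrow> complex"
  assumes cont: "continuous_on UNIV \<psi>"
  shows "L_norm p \<alpha> (\<lambda>z. of_real ((1 + norm z) powr \<sigma>) * \<psi> z) = L_norm p (shifted_weight p \<alpha> \<sigma>) \<psi>"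
proof -
  let ?\<phi> = "\<lambda>z. of_real ((1 + norm z) powr \<sigma>) * \<psi> z"
  have g: "gauss_abs ?\<phi> z = (1 + norm z) powr \<sigma> * gauss_abs \<psi> z" for z
    by (simp add: gauss_abs_def norm_mult)
  have cont': "continuous_on UNIV ?\<phi>"
    by (intro continuous_intros cont) (auto simp: add_nonneg_eq_0_iff)
  have pos: "1 + norm z > 0" for z :: "complex^'n" by (simp add: add_pos_nonneg)
  show ?thesis
  proof (cases "p = \<infinity>")
    case True
    have "gauss_abs ?\<phi> z / (1 + norm z) powr \<alpha> = gauss_abs \<psi> z / (1 + norm z) powr (\<alpha> - \<sigma>)" for z
      unfolding g powr_diff using pos[of z] by simp
    then have "L_norm p \<alpha> ?\<phi> \<le> K \<longleftrightarrow> L_norm p (shifted_weight p \<alpha> \<sigma>) \<psi> \<le> K" for K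
      using True L_norm_infinity[OF cont', of \<alpha> K] L_norm_infinity[OF cont, of "\<alpha> - \<sigma>" K]
      by (simp add: shifted_weight_def)
    then show ?thesis by (meson order.antisym order.refl)
  next
    case False
    have "gauss_abs ?\<phi> z powr enn2real p * (1 + norm z) powr - \<alpha> =
        gauss_abs \<psi> z powr enn2real p * (1 + norm z) powr - (\<alpha> - \<sigma> * enn2real p)" for z
    proof -
      have "(1 + norm z) powr - (\<alpha> - \<sigma> * enn2real p) = (1 + norm z) powr (\<sigma> * enn2real p) * (1 + norm z) powr - \<alpha>"
        by (simp add: powr_add[symmetric])
      then show ?thesis unfolding g powr_mult powr_powr by simp
    qed
    then show ?thesis
      using False
      by (simp add: L_norm_finite_exponent[OF False cont'] L_norm_finite_exponent[OF False cont] shifted_weight_def)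
  qed
qed

text \<open>For \<open>p < 1\<close> only a quasi-triangle inequality holds; comparing the sum with
  twice the maximum pointwise gives one for all finite \<open>p\<close> alike.\<close>

lemma L_norm_add:
  fixes p :: ennreal and \<alpha> :: real
  assumes p: "0 < p"
  obtains C where "C > 0"
    "\<And>\<phi> \<psi> :: complex^'n \<Rightarrow> complex. continuous_on UNIV \<phi> \<Longrightarrow> continuous_on UNIV \<psi> \<Longrightarrow>
      L_norm p \<alpha> (\<lambda>z. \<phi> z + \<psi> z) \<le> ennreal C * (L_norm p \<alpha> \<phi> + L_norm p \<alpha> \<psi>)"
proof -
  have tri: "gauss_abs (\<lambda>z. \<phi> z + \<psi> z) z \<le> gauss_abs \<phi> z + gauss_abs \<psi> z"
    for \<phi> \<psi> :: "complex^'n \<Rightarrow> complex" and z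
    unfolding gauss_abs_def distrib_right[symmetric]
    by (intro mult_right_mono norm_triangle_ineq) auto
  have contp: "continuous_on UNIV (\<lambda>z. \<phi> z + \<psi> z)" if "continuous_on UNIV \<phi>" "continuous_on UNIV \<psi>"
    for \<phi> \<psi> :: "complex^'n \<Rightarrow> complex"
    using that by (intro continuous_intros)
  show ?thesis
  proof (cases "p = \<infinity>")
    case True
    have "L_norm p \<alpha> (\<lambda>z. \<phi> z + \<psi> z) \<le> ennreal 1 * (L_norm p \<alpha> \<phi> + L_norm p \<alpha> \<psi>)"
      if c: "continuous_on UNIV \<phi>" "continuous_on UNIV \<psi>" for \<phi> \<psi> :: "complex^'n \<Rightarrow> complex"
    proof -
      have "ennreal (gauss_abs (\<lambda>z. \<phi> z + \<psi> z) z / (1 + norm z) powr \<alpha>) \<le> L_norm \<infinity> \<alpha> \<phi> + L_norm \<infinity> \<alpha> \<psi>" for z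
      proof -
        have "ennreal (gauss_abs (\<lambda>z. \<phi> z + \<psi> z) z / (1 + norm z) powr \<alpha>) \<le>
            ennreal (gauss_abs \<phi> z / (1 + norm z) powr \<alpha> + gauss_abs \<psi> z / (1 + norm z) powr \<alpha>)"
          unfolding add_divide_distrib[symmetric] by (intro ennreal_leI divide_right_mono tri) auto
        also have "\<dots> = ennreal (gauss_abs \<phi> z / (1 + norm z) powr \<alpha>) + ennreal (gauss_abs \<psi> z / (1 + norm z) powr \<alpha>)"
          by simp
        also have "\<dots> \<le> L_norm \<infinity> \<alpha> \<phi> + L_norm \<infinity> \<alpha> \<psi>"
          by (intro add_mono L_norm_infinity_ge c)
        finally show ?thesis .
      qed
      then show ?thesis using True L_norm_infinity[OF contp[OF c]] by simp
    qed
    then show ?thesis using that[of 1] by simp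
  next
    case False
    define P where "P = enn2real p"
    have P: "P > 0" using p False by (simp add: P_def enn2real_positive_iff less_top)
    have "L_norm p \<alpha> (\<lambda>z. \<phi> z + \<psi> z) \<le> ennreal (2 * 2 powr (1 / P)) * (L_norm p \<alpha> \<phi> + L_norm p \<alpha> \<psi>)"
      if c: "continuous_on UNIV \<phi>" "continuous_on UNIV \<psi>" for \<phi> \<psi> :: "complex^'n \<Rightarrow> complex"
    proof -
      define I where "I g = dV_const TYPE('n) *
        weighted_integral P \<alpha> (gauss_abs g)" for g :: "complex^'n \<Rightarrow> complex"
      have L: "L_norm p \<alpha> g = ennreal_powr (I g) (1 / P)" if "continuous_on UNIV g" for g
        unfolding I_def P_def by (rule L_norm_finite_exponent[OF False that])
      have [measurable]: "gauss_abs \<phi> \<in> borel_measurable borel" "gauss_abs \<psi> \<in> borel_measurable borel"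
        by (rule borel_measurable_gauss_abs[OF c(1)], rule borel_measurable_gauss_abs[OF c(2)])
      have "(\<integral>\<^sup>+z. ennreal (gauss_abs (\<lambda>z. \<phi> z + \<psi> z) z powr P * (1 + norm z) powr (- \<alpha>)) \<partial>lborel) \<le>
        (\<integral>\<^sup>+z. ennreal (2 powr P) * (ennreal (gauss_abs \<phi> z powr P * (1 + norm z) powr (- \<alpha>))
            + ennreal (gauss_abs \<psi> z powr P * (1 + norm z) powr (- \<alpha>))) \<partial>lborel)"
      proof (rule nn_integral_mono)
        fix z :: "complex^'n"
        let ?x = "gauss_abs \<phi> z" and ?y = "gauss_abs \<psi> z"
        have "gauss_abs (\<lambda>z. \<phi> z + \<psi> z) z powr P \<le> (2 * max ?x ?y) powr P"
          using tri[of \<phi> \<psi> z] P by (intro powr_mono2) auto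
        also have "\<dots> = 2 powr P * max ?x ?y powr P" by (rule powr_mult)
        also have "max ?x ?y powr P \<le> ?x powr P + ?y powr P" by (auto simp: max_def)
        finally have "gauss_abs (\<lambda>z. \<phi> z + \<psi> z) z powr P * (1 + norm z) powr (- \<alpha>) \<le>
            2 powr P * (?x powr P + ?y powr P) * (1 + norm z) powr (- \<alpha>)"
          by (intro mult_right_mono) auto
        then have "ennreal (gauss_abs (\<lambda>z. \<phi> z + \<psi> z) z powr P * (1 + norm z) powr (- \<alpha>)) \<le>
            ennreal (2 powr P * (?x powr P * (1 + norm z) powr (- \<alpha>) + ?y powr P * (1 + norm z) powr (- \<alpha>)))"
          by (intro ennreal_leI) (simp add: algebra_simps)
        also have "\<dots> = ennreal (2 powr P) * (ennreal (?x powr P * (1 + norm z) powr (- \<alpha>))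
            + ennreal (?y powr P * (1 + norm z) powr (- \<alpha>)))"
          by (subst ennreal_mult) auto
        finally show "ennreal (gauss_abs (\<lambda>z. \<phi> z + \<psi> z) z powr P * (1 + norm z) powr (- \<alpha>)) \<le> \<dots>" .
      qed
      also have "\<dots> = ennreal (2 powr P) * (weighted_integral P \<alpha> (gauss_abs \<phi>)
          + weighted_integral P \<alpha> (gauss_abs \<psi>))"
        by (subst nn_integral_cmult, measurable, subst nn_integral_add) auto
      finally have "I (\<lambda>z. \<phi> z + \<psi> z) \<le> dV_const TYPE('n) * \<dots>"
        unfolding I_def by (rule mult_left_mono) simp
      also have "\<dots> = ennreal (2 powr P) * (I \<phi> + I \<psi>)"
        unfolding I_def distrib_left[symmetric] by (rule mult.left_commute)
      finally have "ennreal_powr (I (\<lambda>z. \<phi> z + \<psi> z)) (1 / P) \<le> ennreal_powr (ennreal (2 powr P) * (I \<phi> + I \<psi>)) (1 / P)"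
        using P by (intro ennreal_powr_mono) auto
      also have "\<dots> = ennreal ((2 powr P) powr (1 / P)) * ennreal_powr (I \<phi> + I \<psi>) (1 / P)"
        using P by (intro ennreal_powr_mult) auto
      also have "(2 powr P) powr (1 / P) = (2 :: real)" using P by (simp add: powr_powr)
      also have "ennreal 2 * ennreal_powr (I \<phi> + I \<psi>) (1 / P) \<le>
          ennreal 2 * (ennreal (2 powr (1 / P)) * (ennreal_powr (I \<phi>) (1 / P) + ennreal_powr (I \<psi>) (1 / P)))"
        using P by (intro mult_left_mono ennreal_powr_add) auto
      also have "\<dots> = ennreal (2 * 2 powr (1 / P)) * (L_norm p \<alpha> \<phi> + L_norm p \<alpha> \<psi>)"
        unfolding L[OF c(1)] L[OF c(2)] by (subst ennreal_mult) (auto simp: mult.assoc)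
      finally show ?thesis unfolding L[OF contp[OF c]] .
    qed
    moreover have "2 * 2 powr (1 / P) > (0 :: real)" by simp
    ultimately show ?thesis using that by blast
  qed
qed

text \<open>Point evaluations are bounded with polynomially growing constants, by the local estimate
  on the ball of radius \<open>1 / (1 + norm z)\<close>. This is applied where a Gaussian gain
  absorbs any power \<open>M\<close>.\<close>

lemma gauss_abs_growth:
  fixes p :: ennreal and \<alpha> :: real
  assumes p: "0 < p"
  obtains C M where "C > 0"
    "\<And>(f :: complex^'n \<Rightarrow> complex) z. slice_holomorphic f \<Longrightarrow>
      ennreal (gauss_abs f z) \<le> ennreal (C * (1 + norm z) powr M) * L_norm p \<alpha> f"
proof (cases "p = \<infinity>")
  case True
  have "ennreal (gauss_abs f z) \<le> ennreal (1 * (1 + norm z) powr \<alpha>) * L_norm p \<alpha> f"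
    if f: "slice_holomorphic f" for f :: "complex^'n \<Rightarrow> complex" and z
  proof -
    have "1 + norm z > 0" by (simp add: add_pos_nonneg)
    then have "gauss_abs f z = (1 + norm z) powr \<alpha> * (gauss_abs f z / (1 + norm z) powr \<alpha>)" by simp
    then have "ennreal (gauss_abs f z) = ennreal ((1 + norm z) powr \<alpha>) * ennreal (gauss_abs f z / (1 + norm z) powr \<alpha>)"
      by (subst ennreal_mult[symmetric]) auto
    also have "\<dots> \<le> ennreal ((1 + norm z) powr \<alpha>) * L_norm \<infinity> \<alpha> f"
      by (intro mult_left_mono L_norm_infinity_ge slice_holomorphic_cont f) simp
    finally show ?thesis using True by simp
  qed
  then show ?thesis using that[of 1 \<alpha>] by auto
next
  case False
  define P where "P = enn2real p"
  have P: "P > 0" using p False by (simp add: P_def enn2real_positive_iff less_top)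
  let ?D = "2 * real CARD('n)"
  obtain C where C: "C > 0"
    "\<And>(f :: complex^'n \<Rightarrow> complex) z. slice_holomorphic f \<Longrightarrow>
      ennreal (gauss_abs f z powr P) \<le> ennreal (C * (1 + norm z) powr ?D) *
      (\<integral>\<^sup>+w. ennreal (gauss_abs f w powr P) * indicator (ball z (1 / (1 + norm z))) w \<partial>lborel)"
    using gauss_abs_local_estimate[OF P] by blast
  obtain c where c: "dV_const TYPE('n) = ennreal c" "c > 0"
    using dV_const_pos_finite[where 'n='n] by (cases "dV_const TYPE('n)") auto
  \<comment> \<open>The power of 2 compares the weights at \<open>z\<close> and on the small ball;
    dividing by \<open>c\<close> accounts for the normalizing constant inside the norm.\<close>
  define K where "K = C * 2 powr \<bar>\<alpha>\<bar> / c"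
  have K: "K > 0" using C(1) c(2) by (simp add: K_def)
  have "ennreal (gauss_abs f z) \<le> ennreal (K powr (1 / P) * (1 + norm z) powr ((?D + \<alpha>) / P)) * L_norm p \<alpha> f"
    if f: "slice_holomorphic f" for f :: "complex^'n \<Rightarrow> complex" and z
  proof -
    let ?a = "norm z"
    define I where "I = weighted_integral P \<alpha> (gauss_abs f)"
    have a0: "?a \<ge> 0" by simp
    then have a1: "1 + ?a > 0" by linarith
    have [measurable]: "gauss_abs f \<in> borel_measurable borel"
      by (intro borel_measurable_gauss_abs slice_holomorphic_cont f)
    have "(\<integral>\<^sup>+w. ennreal (gauss_abs f w powr P) * indicator (ball z (1 / (1 + ?a))) w \<partial>lborel) \<le>
      (\<integral>\<^sup>+w. ennreal (2 powr \<bar>\<alpha>\<bar> * (1 + ?a) powr \<alpha>) * ennreal (gauss_abs f w powr P * (1 + norm w) powr (- \<alpha>)) \<partial>lborel)"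
    proof (rule nn_integral_mono)
      fix w
      have "gauss_abs f w powr P \<le> 2 powr \<bar>\<alpha>\<bar> * (1 + ?a) powr \<alpha> * (gauss_abs f w powr P * (1 + norm w) powr (- \<alpha>))"
        if "w \<in> ball z (1 / (1 + ?a))"
      proof -
        have d: "norm (w - z) \<le> 1 / (1 + ?a)" using that by (simp add: dist_norm norm_minus_commute)
        have i1: "1 / (1 + ?a) \<le> 1" using a0 a1 by (simp add: field_simps)
        have "norm w \<le> ?a + 1" "?a \<le> norm w + 1"
          using norm_triangle_ineq[of z "w - z"] norm_triangle_ineq[of w "z - w"] d i1
          by (auto simp: norm_minus_commute)
        moreover have w0: "norm w \<ge> 0" by simp
        ultimately have cmp: "1 + norm w \<le> 2 * (1 + ?a)" "1 + ?a \<le> 2 * (1 + norm w)"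
          using a0 unfolding distrib_left by (linarith, linarith)
        have w1: "1 + norm w > 0" using w0 by linarith
        have "(1 + norm w) powr \<alpha> \<le> 2 powr \<bar>\<alpha>\<bar> * (1 + ?a) powr \<alpha>"
          by (rule powr_le_of_comparable[OF w1 a1 _ cmp]) simp
        then have "1 \<le> 2 powr \<bar>\<alpha>\<bar> * (1 + ?a) powr \<alpha> * (1 + norm w) powr (- \<alpha>)"
          using w1 by (simp add: powr_minus field_simps)
        then have "gauss_abs f w powr P * 1 \<le> gauss_abs f w powr P * (2 powr \<bar>\<alpha>\<bar> * (1 + ?a) powr \<alpha> * (1 + norm w) powr (- \<alpha>))"
          by (intro mult_left_mono) auto
        then show ?thesis by (simp add: mult_ac)
      qed
      then show "ennreal (gauss_abs f w powr P) * indicator (ball z (1 / (1 + ?a))) w \<le>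
        ennreal (2 powr \<bar>\<alpha>\<bar> * (1 + ?a) powr \<alpha>) * ennreal (gauss_abs f w powr P * (1 + norm w) powr (- \<alpha>))"
        by (subst ennreal_mult[symmetric]) (auto simp: indicator_def intro!: ennreal_leI)
    qed
    also have "\<dots> = ennreal (2 powr \<bar>\<alpha>\<bar> * (1 + ?a) powr \<alpha>) * I"
      unfolding I_def by (rule nn_integral_cmult) measurable
    finally have "ennreal (gauss_abs f z powr P) \<le>
        ennreal (C * (1 + ?a) powr ?D) * (ennreal (2 powr \<bar>\<alpha>\<bar> * (1 + ?a) powr \<alpha>) * I)"
      using C(2)[OF f, of z] by (meson mult_left_mono order_trans zero_le)
    also have "\<dots> = ennreal (K * (1 + ?a) powr (?D + \<alpha>)) * (ennreal c * I)"
    proof -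
      have "ennreal (C * (1 + ?a) powr ?D) * ennreal (2 powr \<bar>\<alpha>\<bar> * (1 + ?a) powr \<alpha>) =
          ennreal (C * (1 + ?a) powr ?D * (2 powr \<bar>\<alpha>\<bar> * (1 + ?a) powr \<alpha>))"
        using C(1) by (subst ennreal_mult) auto
      also have "C * (1 + ?a) powr ?D * (2 powr \<bar>\<alpha>\<bar> * (1 + ?a) powr \<alpha>) = K * (1 + ?a) powr (?D + \<alpha>) * c"
        using c(2) by (simp add: K_def powr_add)
      also have "ennreal \<dots> = ennreal (K * (1 + ?a) powr (?D + \<alpha>)) * ennreal c"
        using K c(2) by (subst ennreal_mult) auto
      finally show ?thesis by (simp only: mult.assoc[symmetric])
    qed
    finally have "ennreal_powr (ennreal (gauss_abs f z powr P)) (1 / P) \<le>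
        ennreal_powr (ennreal (K * (1 + ?a) powr (?D + \<alpha>)) * (ennreal c * I)) (1 / P)"
      using P by (intro ennreal_powr_mono) auto
    also have "\<dots> = ennreal ((K * (1 + ?a) powr (?D + \<alpha>)) powr (1 / P)) * ennreal_powr (ennreal c * I) (1 / P)"
      using P K a1 by (intro ennreal_powr_mult) auto
    also have "(K * (1 + ?a) powr (?D + \<alpha>)) powr (1 / P) = K powr (1 / P) * (1 + ?a) powr ((?D + \<alpha>) / P)"
      by (simp add: powr_mult powr_powr)
    also have "ennreal_powr (ennreal c * I) (1 / P) = L_norm p \<alpha> f"
      unfolding L_norm_finite_exponent[OF False slice_holomorphic_cont[OF f]] I_def P_def c(1) ..
    also have "ennreal_powr (ennreal (gauss_abs f z powr P)) (1 / P) = ennreal (gauss_abs f z)"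
      using P by (simp add: ennreal_powr_def powr_powr)
    finally show ?thesis .
  qed
  moreover have "K powr (1 / P) > 0" using K by simp
  ultimately show ?thesis using that by blast
qed

lemma L_norm_gaussian_decay:
  fixes p :: ennreal and \<alpha> \<kappa> M :: real
  assumes p: "0 < p" and \<kappa>: "0 < \<kappa>"
  obtains C where "C > 0"
    "\<And>(\<psi> :: complex^'n \<Rightarrow> complex) K. continuous_on UNIV \<psi> \<Longrightarrow> K \<ge> 0 \<Longrightarrow>
      (\<And>z. gauss_abs \<psi> z \<le> K * ((1 + norm z) powr M * exp (- \<kappa> * (norm z)\<^sup>2))) \<Longrightarrow>
      L_norm p \<alpha> \<psi> \<le> ennreal (C * K)"
proof (cases "p = \<infinity>")
  case True
  define E where "E = exp ((M - \<alpha>)\<^sup>2 / (4 * \<kappa>))"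
  have "L_norm p \<alpha> \<psi> \<le> ennreal (E * K)" if c: "continuous_on UNIV \<psi>" and K: "K \<ge> 0"
    and le: "\<And>z. gauss_abs \<psi> z \<le> K * ((1 + norm z) powr M * exp (- \<kappa> * (norm z)\<^sup>2))"
    for \<psi> :: "complex^'n \<Rightarrow> complex" and K
  proof -
    have "gauss_abs \<psi> z / (1 + norm z) powr \<alpha> \<le> E * K" for z
    proof -
      have "gauss_abs \<psi> z / (1 + norm z) powr \<alpha> \<le> K * ((1 + norm z) powr M * exp (- \<kappa> * (norm z)\<^sup>2)) / (1 + norm z) powr \<alpha>"
        by (intro divide_right_mono le) auto
      also have "\<dots> = K * ((1 + norm z) powr (M - \<alpha>) * exp (- \<kappa> * (norm z)\<^sup>2))" by (simp add: powr_diff)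
      also have "\<dots> \<le> K * (E * exp (\<kappa> * (norm z)\<^sup>2) * exp (- \<kappa> * (norm z)\<^sup>2))"
        unfolding E_def using K by (intro mult_left_mono mult_right_mono powr_le_exp_sq \<kappa>) auto
      also have "\<dots> = E * K" by (simp add: exp_minus)
      finally show ?thesis .
    qed
    then show ?thesis using True L_norm_infinity[OF c] by (simp add: ennreal_leI)
  qed
  moreover have "E > 0" by (simp add: E_def)
  ultimately show ?thesis using that by blast
next
  case False
  define P where "P = enn2real p"
  have P: "P > 0" using p False by (simp add: P_def enn2real_positive_iff less_top)
  \<comment> \<open>Half of the decay rate \<open>\<kappa> * P\<close> absorbs the power of
    \<open>1 + norm z\<close>, the other half keeps the integral finite.\<close>
  define \<mu> where "\<mu> = \<kappa> * P / 2"
  have \<mu>: "\<mu> > 0" using \<kappa> P by (simp add: \<mu>_def)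
  define E where "E = exp ((M * P - \<alpha>)\<^sup>2 / (4 * \<mu>))"
  obtain g where g: "(\<integral>\<^sup>+z. ennreal (exp (- \<mu> * (norm (z :: complex^'n))\<^sup>2)) \<partial>lborel) = ennreal g" "g \<ge> 0"
    using nn_integral_gaussian_finite[OF \<mu>, where 'n='n]
    by (cases "\<integral>\<^sup>+z. ennreal (exp (- \<mu> * (norm (z :: complex^'n))\<^sup>2)) \<partial>lborel") auto
  obtain c where c: "dV_const TYPE('n) = ennreal c" "c > 0"
    using dV_const_pos_finite[where 'n='n] by (cases "dV_const TYPE('n)") auto
  \<comment> \<open>Adding 1 guarantees \<open>C > 0\<close>, as only \<open>g \<ge> 0\<close> has
    been recorded.\<close>
  define C where "C = (c * E * g) powr (1 / P) + 1"
  have "L_norm p \<alpha> \<psi> \<le> ennreal (C * K)" if cont: "continuous_on UNIV \<psi>" and K: "K \<ge> 0"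
    and le: "\<And>z. gauss_abs \<psi> z \<le> K * ((1 + norm z) powr M * exp (- \<kappa> * (norm z)\<^sup>2))"
    for \<psi> :: "complex^'n \<Rightarrow> complex" and K
  proof -
    have "weighted_integral P \<alpha> (gauss_abs \<psi>) \<le>
        (\<integral>\<^sup>+z. ennreal (K powr P * E) * ennreal (exp (- \<mu> * (norm (z :: complex^'n))\<^sup>2)) \<partial>lborel)"
    proof (rule nn_integral_mono)
      fix z :: "complex^'n"
      have "gauss_abs \<psi> z powr P \<le> (K * ((1 + norm z) powr M * exp (- \<kappa> * (norm z)\<^sup>2))) powr P"
        using le P by (intro powr_mono2) auto
      also have "\<dots> = K powr P * ((1 + norm z) powr (M * P) * exp (- 2 * \<mu> * (norm z)\<^sup>2))"
        by (simp add: powr_mult powr_powr exp_powr_real \<mu>_def mult_ac)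
      finally have "gauss_abs \<psi> z powr P * (1 + norm z) powr (- \<alpha>) \<le>
          K powr P * ((1 + norm z) powr (M * P) * exp (- 2 * \<mu> * (norm z)\<^sup>2)) * (1 + norm z) powr (- \<alpha>)"
        by (intro mult_right_mono) auto
      also have "\<dots> = K powr P * ((1 + norm z) powr (M * P - \<alpha>) * exp (- 2 * \<mu> * (norm z)\<^sup>2))"
        by (simp add: powr_diff powr_minus field_simps)
      also have "\<dots> \<le> K powr P * (E * exp (\<mu> * (norm z)\<^sup>2) * exp (- 2 * \<mu> * (norm z)\<^sup>2))"
        unfolding E_def using K by (intro mult_left_mono mult_right_mono powr_le_exp_sq \<mu>) auto
      also have "\<dots> = K powr P * E * exp (- \<mu> * (norm z)\<^sup>2)"
        by (simp add: exp_add[symmetric] mult.assoc)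
      finally show "ennreal (gauss_abs \<psi> z powr P * (1 + norm z) powr (- \<alpha>)) \<le>
          ennreal (K powr P * E) * ennreal (exp (- \<mu> * (norm z)\<^sup>2))"
        by (subst ennreal_mult[symmetric]) (auto simp: E_def intro!: ennreal_leI)
    qed
    also have "\<dots> = ennreal (K powr P * E) * ennreal g"
      unfolding g(1)[symmetric] by (rule nn_integral_cmult) measurable
    finally have "dV_const TYPE('n) * weighted_integral P \<alpha> (gauss_abs \<psi>) \<le>
        ennreal c * (ennreal (K powr P * E) * ennreal g)"
      unfolding c(1) by (rule mult_left_mono) simp
    also have "\<dots> = ennreal (K powr P * (c * E * g))"
      using c(2) g(2) by (simp add: ennreal_mult'[symmetric] E_def mult_ac)
    finally have "L_norm p \<alpha> \<psi> \<le> ennreal_powr (ennreal (K powr P * (c * E * g))) (1 / P)"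
      unfolding L_norm_finite_exponent[OF False cont] P_def[symmetric]
      using P by (intro ennreal_powr_mono) auto
    also have "\<dots> = ennreal (K * (c * E * g) powr (1 / P))"
    proof -
      have "0 \<le> K powr P * (c * E * g)" using c(2) g(2) by (simp add: E_def)
      moreover have "(K powr P * (c * E * g)) powr (1 / P) = K * (c * E * g) powr (1 / P)"
        unfolding powr_mult[of "K powr P"] using K P by (simp add: powr_powr)
      ultimately show ?thesis by (simp add: ennreal_powr_def)
    qed
    also have "\<dots> \<le> ennreal (C * K)"
      using K by (intro ennreal_leI) (simp add: C_def algebra_simps)
    finally show ?thesis .
  qed
  moreover have "C > 0" by (simp add: C_def add_nonneg_pos)
  ultimately show ?thesis using that by blast
qed

lemma L_norm_zero: "0 < p \<Longrightarrow> L_norm p \<alpha> (\<lambda>z :: complex^'n. 0) = 0"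
proof -
  assume p: "0 < p"
  have g: "gauss_abs (\<lambda>z :: complex^'n. 0) z = 0" for z by (simp add: gauss_abs_def)
  show ?thesis
  proof (cases "p = \<infinity>")
    case True
    then show ?thesis using L_norm_infinity[of "\<lambda>z :: complex^'n. 0" \<alpha> 0] by (simp add: g)
  next
    case False
    then have "enn2real p > 0" using p by (simp add: enn2real_positive_iff less_top)
    then show ?thesis by (simp add: L_norm_finite_exponent[OF False] g ennreal_powr_def)
  qed
qed

section \<open>Multipliers of a given order\<close>

text \<open>Domination carries no constant, so a factor \<open>K\<close> is moved into the function
  by dividing \<open>\<phi>\<close> by it.\<close>

lemma gauss_dominated_L_norm_scaled:
  fixes p :: ennreal and q \<alpha> K :: real
  assumes p: "0 < p" and q: "0 < q" and K: "0 < K"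
  obtains C where "C > 0"
    "\<And>(f :: complex^'n \<Rightarrow> complex) \<phi>. slice_holomorphic f \<Longrightarrow> continuous_on UNIV \<phi> \<Longrightarrow>
      gauss_dominated q (\<lambda>z. gauss_abs \<phi> z / K) f \<Longrightarrow> L_norm p \<alpha> \<phi> \<le> ennreal C * L_norm p \<alpha> f"
proof -
  obtain C where C: "C > 0"
    "\<And>(f :: complex^'n \<Rightarrow> complex) \<phi>. slice_holomorphic f \<Longrightarrow> continuous_on UNIV \<phi> \<Longrightarrow>
      gauss_dominated q (gauss_abs \<phi>) f \<Longrightarrow> L_norm p \<alpha> \<phi> \<le> ennreal C * L_norm p \<alpha> f"
    using gauss_dominated_L_norm[OF p q, where 'n='n and \<alpha>=\<alpha>] by blast
  have "L_norm p \<alpha> \<phi> \<le> ennreal (K * C) * L_norm p \<alpha> f"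
    if f: "slice_holomorphic f" and \<phi>: "continuous_on UNIV \<phi>"
      and dom: "gauss_dominated q (\<lambda>z. gauss_abs \<phi> z / K) f" for f \<phi> :: "complex^'n \<Rightarrow> complex"
  proof -
    define \<psi> where "\<psi> z = \<phi> z / of_real K" for z
    have \<psi>: "continuous_on UNIV \<psi>" unfolding \<psi>_def using K by (intro continuous_intros \<phi>) auto
    have g: "gauss_abs \<psi> = (\<lambda>z. gauss_abs \<phi> z / K)"
      using K by (auto simp: gauss_abs_def \<psi>_def norm_divide)
    have "L_norm p \<alpha> \<phi> \<le> ennreal K * L_norm p \<alpha> \<psi>"
      using K by (intro L_norm_mono[OF p \<phi> \<psi> K]) (simp add: g)
    also have "\<dots> \<le> ennreal K * (ennreal C * L_norm p \<alpha> f)"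
      using C(2)[OF f \<psi>] dom by (intro mult_left_mono) (auto simp: g)
    also have "\<dots> = ennreal (K * C) * L_norm p \<alpha> f"
      using K C(1) by (simp add: ennreal_mult mult.assoc)
    finally show ?thesis .
  qed
  moreover have "K * C > 0" using K C(1) by simp
  ultimately show ?thesis using that by blast
qed

section \<open>Smoothing multipliers\<close>

definition smoothing :: "(nat \<Rightarrow> real) \<Rightarrow> bool" where
  "smoothing e \<longleftrightarrow> (\<exists>C. \<forall>k. \<bar>e k\<bar> \<le> C * (1/2) ^ k)"

lemma smoothing_exp_bounded: "smoothing e \<Longrightarrow> exp_bounded e"
proof -
  assume "smoothing e"
  then obtain C where C: "\<And>k. \<bar>e k\<bar> \<le> C * (1/2) ^ k" unfolding smoothing_def by blast
  have "C * (1/2) ^ k \<le> (\<bar>C\<bar> + 1) * (1/2) ^ k" for k by (intro mult_right_mono) auto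
  then have "\<bar>e k\<bar> \<le> (\<bar>C\<bar> + 1) * (1/2) ^ k" for k using C order_trans by blast
  then show ?thesis by (intro exp_boundedI[of "\<bar>C\<bar> + 1" "1/2"]) auto
qed

text \<open>Covers both the projection onto low degrees and every change of a sequence at finitely
  many indices.\<close>

lemma smoothing_finite_support:
  assumes "\<And>k. k \<ge> N \<Longrightarrow> e k = 0"
  shows "smoothing e"
  unfolding smoothing_def
proof (intro exI allI)
  fix k
  show "\<bar>e k\<bar> \<le> (\<Sum>j<N. \<bar>e j\<bar> * 2 ^ j) * (1/2) ^ k"
  proof (cases "k < N")
    case True
    then have "\<bar>e k\<bar> * 2 ^ k \<le> (\<Sum>j<N. \<bar>e j\<bar> * 2 ^ j)"
      by (intro member_le_sum) auto
    then show ?thesis by (simp add: field_simps)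
  qed (use assms in \<open>auto intro!: mult_nonneg_nonneg sum_nonneg\<close>)
qed

text \<open>The Cauchy estimate at 3/4 of the radius costs \<open>(4/3) ^ k\<close>; the resulting
  ratio \<open>1/2 * 4/3 = 2/3\<close> is still summable, with sum 3. Any fraction strictly between
  1/2 and 1 would do: above 1/2 for convergence, below 1 for a Gaussian gain.\<close>

lemma multiplier_smoothing_bound:
  assumes f: "expansion f F" and e: "\<And>k. \<bar>e k\<bar> \<le> C * (1/2) ^ k" and C: "C \<ge> 0"
    and B: "\<And>w. norm w = 3/4 * norm z \<Longrightarrow> cmod (f w) \<le> B"
  shows "cmod (multiplier e F z) \<le> 3 * C * B"
proof -
  have tm: "cmod (of_real (e k) * F k z) \<le> C * B * (2/3) ^ k" for k
  proof -
    have "cmod (F k z) * (3/4) ^ k \<le> B"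
      by (rule expansion_coeff_bound[OF f]) (use B in auto)
    then have "cmod (F k z) \<le> B * (4/3) ^ k" by (simp add: field_simps power_divide)
    then have "\<bar>e k\<bar> * cmod (F k z) \<le> C * (1/2) ^ k * (B * (4/3) ^ k)"
      using e C by (intro mult_mono) auto
    also have "\<dots> = C * B * (2/3) ^ k"
      by (simp add: power_mult_distrib[symmetric] mult_ac flip: mult.assoc)
    finally show ?thesis by (simp add: norm_mult)
  qed
  have eb: "exp_bounded e" using e smoothing_exp_bounded unfolding smoothing_def by blast
  have "(\<lambda>k. C * B * (2/3) ^ k) sums (C * B * (1 / (1 - 2/3)))"
    by (intro sums_mult geometric_sums) auto
  then have "cmod (multiplier e F z) \<le> C * B * (1 / (1 - 2/3))"
    by (rule norm_sums_le[OF multiplier_sums[OF f eb] _ tm])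
  then show ?thesis by simp
qed

text \<open>The value at \<open>z\<close> is controlled by \<open>f\<close> at radius
  \<open>3/4 * norm z\<close>, where the Gaussian growth has exponent \<open>9/32\<close> instead of
  \<open>1/2\<close>. The surplus \<open>7/32\<close> beats every power, hence the weights
  \<open>\<alpha>\<close> and \<open>\<beta>\<close> are unrelated.\<close>

lemma smoothing_L_norm:
  fixes p :: ennreal and \<alpha> \<beta> :: real
  assumes p: "0 < p" and e: "smoothing e"
  obtains C where "C > 0"
    "\<And>(f :: complex^'n \<Rightarrow> complex) F. expansion f F \<Longrightarrow>
      L_norm p \<alpha> (multiplier e F) \<le> ennreal C * L_norm p \<beta> f"
proof -
  obtain C0' where C0': "\<And>k. \<bar>e k\<bar> \<le> C0' * (1/2) ^ k" using e unfolding smoothing_def by blast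
  define C0 where "C0 = \<bar>C0'\<bar> + 1"
  have C0: "C0 > 0" "\<bar>e k\<bar> \<le> C0 * (1/2) ^ k" for k
  proof -
    have "C0' * (1/2) ^ k \<le> C0 * (1/2) ^ k" unfolding C0_def by (intro mult_right_mono) auto
    then show "\<bar>e k\<bar> \<le> C0 * (1/2) ^ k" using C0'[of k] by linarith
  qed (simp add: C0_def)
  obtain C1 M where C1: "C1 > 0" "\<And>(f :: complex^'n \<Rightarrow> complex) z. slice_holomorphic f \<Longrightarrow>
      ennreal (gauss_abs f z) \<le> ennreal (C1 * (1 + norm z) powr M) * L_norm p \<beta> f"
    using gauss_abs_growth[OF p, where 'n='n and \<alpha>=\<beta>] by blast
  obtain C2 where C2: "C2 > 0"
    "\<And>(\<psi> :: complex^'n \<Rightarrow> complex) K. continuous_on UNIV \<psi> \<Longrightarrow> K \<ge> 0 \<Longrightarrow>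
      (\<And>z. gauss_abs \<psi> z \<le> K * ((1 + norm z) powr \<bar>M\<bar> * exp (- (7/32) * (norm z)\<^sup>2))) \<Longrightarrow>
      L_norm p \<alpha> \<psi> \<le> ennreal (C2 * K)"
    using L_norm_gaussian_decay[OF p, where 'n='n and \<alpha>=\<alpha> and \<kappa>="7/32" and M="\<bar>M\<bar>"] by auto
  define C where "C = C2 * (3 * C0 * C1)"
  have Cpos: "C > 0" using C0(1) C1(1) C2(1) by (simp add: C_def)
  have "L_norm p \<alpha> (multiplier e F) \<le> ennreal C * L_norm p \<beta> f" if fF: "expansion f F"
    for f :: "complex^'n \<Rightarrow> complex" and F
  proof (cases "L_norm p \<beta> f")
    case top
    then show ?thesis using Cpos by (simp add: ennreal_mult_top)
  next
    case (real N)
    have f: "slice_holomorphic f" using fF by (simp add: expansion_def)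
    have eb: "exp_bounded e" by (rule smoothing_exp_bounded[OF e])
    have "gauss_abs (multiplier e F) z \<le>
        3 * C0 * C1 * N * ((1 + norm z) powr \<bar>M\<bar> * exp (- (7/32) * (norm z)\<^sup>2))" for z
    proof -
      define B where "B = C1 * (1 + norm z) powr \<bar>M\<bar> * N * exp ((9/32) * (norm z)\<^sup>2)"
      have "cmod (f w) \<le> B" if w: "norm w = 3/4 * norm z" for w
      proof -
        have "ennreal (gauss_abs f w) \<le> ennreal (C1 * (1 + norm w) powr M * N)"
          using C1(2)[OF f, of w] real C1(1) by (simp add: ennreal_mult'[symmetric])
        then have "gauss_abs f w \<le> C1 * (1 + norm w) powr M * N"
          using real(1) C1(1) by (simp add: ennreal_le_iff)
        also have "(1 + norm w) powr M \<le> (1 + norm w) powr \<bar>M\<bar>" by (intro powr_mono) auto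
        also have "\<dots> \<le> (1 + norm z) powr \<bar>M\<bar>" using w norm_ge_zero[of z] by (intro powr_mono2) linarith+
        finally have "gauss_abs f w \<le> C1 * (1 + norm z) powr \<bar>M\<bar> * N"
          using C1(1) real(1) by (simp add: mult_left_mono mult_right_mono)
        then have "gauss_abs f w * exp ((norm w)\<^sup>2 / 2) \<le> C1 * (1 + norm z) powr \<bar>M\<bar> * N * exp ((norm w)\<^sup>2 / 2)"
          by (intro mult_right_mono) auto
        moreover have "gauss_abs f w * exp ((norm w)\<^sup>2 / 2) = cmod (f w)"
          by (simp add: gauss_abs_def exp_minus)
        moreover have "(norm w)\<^sup>2 / 2 = (9/32) * (norm z)\<^sup>2"
          unfolding w by (simp add: power2_eq_square)
        ultimately show ?thesis unfolding B_def by (simp only:)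
      qed
      then have "cmod (multiplier e F z) \<le> 3 * C0 * B"
        using C0 by (intro multiplier_smoothing_bound[OF fF]) auto
      then have "gauss_abs (multiplier e F) z \<le> 3 * C0 * B * exp (- (norm z)\<^sup>2 / 2)"
        unfolding gauss_abs_def by (intro mult_right_mono) auto
      also have "\<dots> = 3 * C0 * C1 * N * ((1 + norm z) powr \<bar>M\<bar> * (exp ((9/32) * (norm z)\<^sup>2) * exp (- (norm z)\<^sup>2 / 2)))"
        by (simp add: B_def mult_ac)
      also have "exp ((9/32) * (norm z)\<^sup>2) * exp (- (norm z)\<^sup>2 / 2) = exp (- (7/32) * (norm z)\<^sup>2)"
        by (simp add: exp_add[symmetric])
      finally show ?thesis .
    qed
    then have "L_norm p \<alpha> (multiplier e F) \<le> ennreal (C2 * (3 * C0 * C1 * N))"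
      using C0(1) C1(1) real(1) by (intro C2(2) multiplier_cont[OF fF eb]) auto
    then show ?thesis using real Cpos by (simp add: C_def ennreal_mult'[symmetric] mult_ac)
  qed
  with Cpos show ?thesis by (rule that)
qed

text \<open>Quantifying over all weights \<open>\<beta>\<close> is what makes orders add under
  composition. The factor 2 reflects that multiplying by the degree costs |z|^2 on functions of
  Gaussian size; the \<open>itself\<close> argument fixes the dimension.\<close>

definition mult_order :: "'n::finite itself \<Rightarrow> ennreal \<Rightarrow> real \<Rightarrow> (nat \<Rightarrow> real) \<Rightarrow> bool" where
  "mult_order _ p \<sigma> c \<longleftrightarrow> exp_bounded c \<and>
     (\<forall>\<beta>. \<exists>C>0. \<forall>(f :: complex^'n \<Rightarrow> complex) F. expansion f F \<longrightarrow>
        L_norm p (shifted_weight p \<beta> (- 2 * \<sigma>)) (multiplier c F) \<le> ennreal C * L_norm p \<beta> f)"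

lemma shifted_weight_add:
  "shifted_weight p (shifted_weight p \<beta> \<sigma>) \<tau> = shifted_weight p \<beta> (\<sigma> + \<tau>)"
  by (simp add: shifted_weight_def algebra_simps)

lemma shifted_weight_0 [simp]: "shifted_weight p \<beta> 0 = \<beta>"
  by (simp add: shifted_weight_def)

lemma mult_order_exp_bounded: "mult_order T p \<sigma> c \<Longrightarrow> exp_bounded c"
  by (simp add: mult_order_def)

lemma mult_orderD:
  assumes "mult_order TYPE('n::finite) p \<sigma> c"
  obtains C where "C > 0" "\<And>(f :: complex^'n \<Rightarrow> complex) F. expansion f F \<Longrightarrow>
    L_norm p (shifted_weight p \<beta> (- 2 * \<sigma>)) (multiplier c F) \<le> ennreal C * L_norm p \<beta> f"
  using assms unfolding mult_order_def by blast

lemma mult_order_mult: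
  assumes c: "mult_order TYPE('n::finite) p \<sigma> c" and d: "mult_order TYPE('n) p \<tau> d"
  shows "mult_order TYPE('n) p (\<sigma> + \<tau>) (\<lambda>k. c k * d k)"
  unfolding mult_order_def
proof (intro conjI allI)
  show "exp_bounded (\<lambda>k. c k * d k)" by (intro exp_bounded_mult mult_order_exp_bounded[OF c] mult_order_exp_bounded[OF d])
  fix \<beta>
  obtain D where D: "D > 0" "\<And>(f :: complex^'n \<Rightarrow> complex) F. expansion f F \<Longrightarrow>
      L_norm p (shifted_weight p \<beta> (- 2 * \<tau>)) (multiplier d F) \<le> ennreal D * L_norm p \<beta> f"
    using mult_orderD[OF d, of \<beta>] by blast
  \<comment> \<open>The bound for \<open>c\<close> is taken at the weight already shifted by
    \<open>d\<close>, so that the two shifts combine.\<close>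
  obtain C where C: "C > 0" "\<And>(f :: complex^'n \<Rightarrow> complex) F. expansion f F \<Longrightarrow>
      L_norm p (shifted_weight p (shifted_weight p \<beta> (- 2 * \<tau>)) (- 2 * \<sigma>)) (multiplier c F)
      \<le> ennreal C * L_norm p (shifted_weight p \<beta> (- 2 * \<tau>)) f"
    using mult_orderD[OF c, of "shifted_weight p \<beta> (- 2 * \<tau>)"] by blast
  have "L_norm p (shifted_weight p \<beta> (- 2 * (\<sigma> + \<tau>))) (multiplier (\<lambda>k. c k * d k) F) \<le> ennreal (C * D) * L_norm p \<beta> f"
    if f: "expansion f F" for f :: "complex^'n \<Rightarrow> complex" and F
  proof -
    have "L_norm p (shifted_weight p \<beta> (- 2 * (\<sigma> + \<tau>))) (multiplier (\<lambda>k. c k * d k) F) \<le>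
        ennreal C * L_norm p (shifted_weight p \<beta> (- 2 * \<tau>)) (multiplier d F)"
    proof -
      have "- 2 * \<tau> + - 2 * \<sigma> = - 2 * (\<sigma> + \<tau>)" by simp
      then show ?thesis
        using C(2)[OF multiplier_expansion[OF f mult_order_exp_bounded[OF d]]]
        by (simp only: multiplier_multiplier shifted_weight_add)
    qed
    also have "\<dots> \<le> ennreal C * (ennreal D * L_norm p \<beta> f)"
      by (intro mult_left_mono D f) simp
    finally show ?thesis using C(1) D(1) by (simp add: ennreal_mult mult.assoc)
  qed
  moreover have "C * D > 0" using C(1) D(1) by simp
  ultimately show "\<exists>C>0. \<forall>(f :: complex^'n \<Rightarrow> complex) F. expansion f F \<longrightarrow>
      L_norm p (shifted_weight p \<beta> (- 2 * (\<sigma> + \<tau>))) (multiplier (\<lambda>k. c k * d k) F) \<le> ennreal C * L_norm p \<beta> f"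
    by blast
qed

lemma mult_order_add:
  assumes p: "0 < p" and c: "mult_order TYPE('n::finite) p \<sigma> c" and d: "mult_order TYPE('n) p \<sigma> d"
  shows "mult_order TYPE('n) p \<sigma> (\<lambda>k. c k + d k)"
  unfolding mult_order_def
proof (intro conjI allI)
  note eb = mult_order_exp_bounded[OF c] mult_order_exp_bounded[OF d]
  show "exp_bounded (\<lambda>k. c k + d k)" by (intro exp_bounded_add eb)
  fix \<beta>
  let ?\<gamma> = "shifted_weight p \<beta> (- 2 * \<sigma>)"
  obtain D where D: "D > 0" "\<And>(f :: complex^'n \<Rightarrow> complex) F. expansion f F \<Longrightarrow>
      L_norm p ?\<gamma> (multiplier d F) \<le> ennreal D * L_norm p \<beta> f"
    using mult_orderD[OF d, of \<beta>] by blast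
  obtain C where C: "C > 0" "\<And>(f :: complex^'n \<Rightarrow> complex) F. expansion f F \<Longrightarrow>
      L_norm p ?\<gamma> (multiplier c F) \<le> ennreal C * L_norm p \<beta> f"
    using mult_orderD[OF c, of \<beta>] by blast
  obtain A where A: "A > 0" "\<And>\<phi> \<psi> :: complex^'n \<Rightarrow> complex. continuous_on UNIV \<phi> \<Longrightarrow> continuous_on UNIV \<psi> \<Longrightarrow>
      L_norm p ?\<gamma> (\<lambda>z. \<phi> z + \<psi> z) \<le> ennreal A * (L_norm p ?\<gamma> \<phi> + L_norm p ?\<gamma> \<psi>)"
    using L_norm_add[OF p, where 'n='n and \<alpha>="?\<gamma>"] by blast
  have bd: "L_norm p ?\<gamma> (multiplier (\<lambda>k. c k + d k) F) \<le> ennreal (A * (C + D)) * L_norm p \<beta> f"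
    if f: "expansion f F" for f :: "complex^'n \<Rightarrow> complex" and F
  proof -
    have "L_norm p ?\<gamma> (multiplier (\<lambda>k. c k + d k) F) \<le> ennreal A * (L_norm p ?\<gamma> (multiplier c F) + L_norm p ?\<gamma> (multiplier d F))"
    proof -
      have "multiplier (\<lambda>k. c k + d k) F = (\<lambda>z. multiplier c F z + multiplier d F z)"
        by (rule ext) (rule multiplier_add[OF f eb])
      then show ?thesis
        using A(2)[OF multiplier_cont[OF f eb(1)] multiplier_cont[OF f eb(2)]] by (simp only:)
    qed
    also have "\<dots> \<le> ennreal A * (ennreal C * L_norm p \<beta> f + ennreal D * L_norm p \<beta> f)"
      by (rule mult_left_mono[OF add_mono[OF C(2)[OF f] D(2)[OF f]]]) simp
    also have "\<dots> = ennreal (A * (C + D)) * L_norm p \<beta> f"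
    proof -
      have "ennreal (A * (C + D)) = ennreal A * (ennreal C + ennreal D)"
        using A(1) C(1) D(1) ennreal_mult[of A "C + D"] by simp
      then show ?thesis by (simp only: distrib_right mult.assoc)
    qed
    finally show ?thesis .
  qed
  have pos: "A * (C + D) > 0" using A(1) C(1) D(1) by simp
  show "\<exists>C>0. \<forall>(f :: complex^'n \<Rightarrow> complex) F. expansion f F \<longrightarrow>
      L_norm p ?\<gamma> (multiplier (\<lambda>k. c k + d k) F) \<le> ennreal C * L_norm p \<beta> f"
  proof (intro exI[of _ "A * (C + D)"] conjI allI impI pos)
    fix f :: "complex^'n \<Rightarrow> complex" and F
    assume "expansion f F"
    then show "L_norm p ?\<gamma> (multiplier (\<lambda>k. c k + d k) F) \<le> ennreal (A * (C + D)) * L_norm p \<beta> f"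
      by (rule bd)
  qed
qed

lemma mult_order_smoothing:
  assumes "0 < p" "smoothing e"
  shows "mult_order TYPE('n::finite) p \<sigma> e"
  unfolding mult_order_def
proof (intro conjI allI)
  show "exp_bounded e" by (rule smoothing_exp_bounded[OF assms(2)])
  fix \<beta>
  show "\<exists>C>0. \<forall>(f :: complex^'n \<Rightarrow> complex) F. expansion f F \<longrightarrow>
        L_norm p (shifted_weight p \<beta> (- 2 * \<sigma>)) (multiplier e F) \<le> ennreal C * L_norm p \<beta> f"
    by (rule smoothing_L_norm[OF assms, where 'n='n and \<alpha>="shifted_weight p \<beta> (- 2 * \<sigma>)" and \<beta>=\<beta>])
       blast
qed

text \<open>A pointwise bound of \<open>(1 + |z|)\<^bsup>-2\<sigma>\<^esup> |T f z|\<close> by a nearby value of the weighted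
  \<open>|f|\<close> is all that has to be checked for a multiplier operator \<open>T\<close> of order \<open>\<sigma>\<close>.\<close>

lemma mult_orderI_dominated:
  assumes p: "0 < p" and q: "0 < q" and K: "0 < K" and c: "exp_bounded c"
    and dom: "\<And>(f :: complex^'n::finite \<Rightarrow> complex) F. expansion f F \<Longrightarrow>
      gauss_dominated q (\<lambda>z. (1 + norm z) powr (- 2 * \<sigma>) * gauss_abs (multiplier c F) z / K) f"
  shows "mult_order TYPE('n) p \<sigma> c"
  unfolding mult_order_def
proof (intro conjI allI c)
  fix \<beta>
  obtain C where C: "C > 0"
    "\<And>(f :: complex^'n \<Rightarrow> complex) \<phi>. slice_holomorphic f \<Longrightarrow> continuous_on UNIV \<phi> \<Longrightarrow>
      gauss_dominated q (\<lambda>z. gauss_abs \<phi> z / K) f \<Longrightarrow> L_norm p \<beta> \<phi> \<le> ennreal C * L_norm p \<beta> f"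
    using gauss_dominated_L_norm_scaled[OF p q K, where 'n='n and \<alpha>=\<beta>] by blast
  have "L_norm p (shifted_weight p \<beta> (- 2 * \<sigma>)) (multiplier c F) \<le> ennreal C * L_norm p \<beta> f"
    if f: "expansion f F" for f :: "complex^'n \<Rightarrow> complex" and F
  proof -
    let ?\<phi> = "\<lambda>z. of_real ((1 + norm z) powr (- 2 * \<sigma>)) * multiplier c F z"
    have cont: "continuous_on UNIV (multiplier c F)" by (rule multiplier_cont[OF f c])
    have "gauss_abs ?\<phi> z = (1 + norm z) powr (- 2 * \<sigma>) * gauss_abs (multiplier c F) z" for z
      by (simp add: gauss_abs_def norm_mult)
    moreover have "continuous_on UNIV ?\<phi>"
      by (intro continuous_intros cont) (auto simp: add_nonneg_eq_0_iff)
    ultimately have "L_norm p \<beta> ?\<phi> \<le> ennreal C * L_norm p \<beta> f"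
      using f dom[OF f] by (intro C(2)) (auto simp: expansion_def)
    then show ?thesis by (simp only: L_norm_weight_shift[OF cont])
  qed
  then show "\<exists>C>0. \<forall>(f :: complex^'n \<Rightarrow> complex) F. expansion f F \<longrightarrow>
        L_norm p (shifted_weight p \<beta> (- 2 * \<sigma>)) (multiplier c F) \<le> ennreal C * L_norm p \<beta> f"
    using C(1) by blast
qed

lemma mult_order_const:
  assumes p: "0 < p"
  shows "mult_order TYPE('n::finite) p 0 (\<lambda>_. x)"
proof -
  have "exp_bounded (\<lambda>_. x)" by (rule exp_boundedI[of "\<bar>x\<bar> + 1" 1]) auto
  \<comment> \<open>\<open>\<bar>x\<bar> + 1\<close> rather than \<open>\<bar>x\<bar>\<close>, so
    that the scaling constant is positive also for \<open>x = 0\<close>.\<close>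
  moreover have "gauss_dominated 1 (\<lambda>z. (1 + norm z) powr (- 2 * 0) * gauss_abs (multiplier (\<lambda>_. x) F) z / (\<bar>x\<bar> + 1)) f"
    if f: "expansion f F" for f :: "complex^'n \<Rightarrow> complex" and F
    unfolding gauss_dominated_def
  proof (intro allI bexI[of _ 1] exI conjI)
    fix z
    have s: "(\<lambda>k. F k z) sums f z" using f by (simp add: expansion_def)
    have "multiplier (\<lambda>_. x) F z = of_real x * f z"
      using sums_unique[OF sums_mult[OF s, of "of_real x"]] by (simp add: multiplier_def)
    then have "gauss_abs (multiplier (\<lambda>_. x) F) z = \<bar>x\<bar> * gauss_abs f z"
      by (simp add: gauss_abs_def norm_mult)
    also have "\<dots> \<le> (\<bar>x\<bar> + 1) * gauss_abs f z" by (intro mult_right_mono) auto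
    finally show "(1 + norm z) powr (- 2 * 0) * gauss_abs (multiplier (\<lambda>_. x) F) z / (\<bar>x\<bar> + 1)
        \<le> exp (- 1 * (1 - 1\<^sup>2) * (norm z)\<^sup>2) * gauss_abs f z"
      by (simp add: field_simps add_nonneg_eq_0_iff)
  qed auto
  ultimately show ?thesis
    using p by (intro mult_orderI_dominated[where q=1 and K="\<bar>x\<bar> + 1"]) auto
qed

section \<open>Multipliers given by Gamma quotients\<close>

lemma exp_bounded_linear: "exp_bounded (\<lambda>k. real k + \<gamma>)"
proof (rule exp_boundedI[of "1 + \<bar>\<gamma>\<bar>" 2])
  fix k
  have "real k \<le> 2 ^ k" using of_nat_less_two_power[of k, where 'a=real] by simp
  moreover have "\<bar>\<gamma>\<bar> * 1 \<le> \<bar>\<gamma>\<bar> * 2 ^ k" by (intro mult_left_mono) auto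
  ultimately have "real k + \<bar>\<gamma>\<bar> \<le> (1 + \<bar>\<gamma>\<bar>) * 2 ^ k" unfolding distrib_right by linarith
  then show "\<bar>real k + \<gamma>\<bar> \<le> (1 + \<bar>\<gamma>\<bar>) * 2 ^ k" by linarith
qed auto

text \<open>Termwise differentiation, at 1, of the power series on the line through
  \<open>z\<close>.\<close>

lemma expansion_sums_radial_deriv:
  assumes f: "expansion f F"
  shows "(\<lambda>k. of_nat k * F k z) sums deriv (\<lambda>\<zeta>. f (\<zeta> *s z)) 1"
proof -
  have s: "(\<lambda>k. F k z * \<zeta> ^ k) sums f (\<zeta> *s z)" for \<zeta> by (rule expansion_slice_sums[OF f])
  then have eq: "(\<lambda>\<zeta>. f (\<zeta> *s z)) = (\<lambda>\<zeta>. \<Sum>k. F k z * \<zeta> ^ k)"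
    by (auto simp: sums_iff)
  have sm: "summable (\<lambda>k. F k z * \<zeta> ^ k)" for \<zeta> using s[of \<zeta>] by (simp add: sums_iff)
  have "((\<lambda>\<zeta>. \<Sum>k. F k z * \<zeta> ^ k) has_field_derivative (\<Sum>k. diffs (\<lambda>k. F k z) k * 1 ^ k)) (at 1)"
    by (rule termdiffs_strong[OF sm[of 2]]) simp
  then have "deriv (\<lambda>\<zeta>. f (\<zeta> *s z)) 1 = (\<Sum>k. diffs (\<lambda>k. F k z) k * 1 ^ k)"
    unfolding eq by (rule DERIV_imp_deriv)
  moreover have "summable (\<lambda>k. diffs (\<lambda>k. F k z) k * 1 ^ k)"
    by (rule termdiff_converges[of 1 2]) (auto intro: sm)
  from diffs_equiv[OF this] have "(\<lambda>k. of_nat k * F k z * 1 ^ (k - Suc 0)) sums (\<Sum>k. diffs (\<lambda>k. F k z) k * 1 ^ k)" .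
  ultimately show ?thesis by simp
qed

text \<open>A disc of radius \<open>r = 1 / (1 + norm z)\<^sup>2\<close> in \<open>\<zeta>\<close>
  moves \<open>\<zeta> z\<close> by at most \<open>1 / (1 + norm z)\<close>, where the Gaussian
  changes by at most \<open>exp (3/2)\<close>, while Cauchy's inequality costs \<open>1 / r\<close>,
  exactly one order. The maximum point on the disc is the single comparison point, with
  \<open>t = 1\<close>.\<close>

lemma mult_order_linear:
  assumes p: "0 < p"
  shows "mult_order TYPE('n::finite) p 1 (\<lambda>k. real k + \<gamma>)"
proof (rule mult_orderI_dominated[where q = 1 and K = "(\<bar>\<gamma>\<bar> + 1) * exp (3/2)"])
  fix f :: "complex^'n \<Rightarrow> complex" and F
  assume fF: "expansion f F"
  then have f: "slice_holomorphic f" by (simp add: expansion_def)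
  show "gauss_dominated 1 (\<lambda>z. (1 + norm z) powr (- 2 * 1) *
      gauss_abs (multiplier (\<lambda>k. real k + \<gamma>) F) z / ((\<bar>\<gamma>\<bar> + 1) * exp (3/2))) f"
    unfolding gauss_dominated_def
  proof
    fix z :: "complex^'n"
    let ?a = "norm z"
    let ?T = "multiplier (\<lambda>k. real k + \<gamma>) F z"
    define g where "g = (\<lambda>\<zeta>. f (\<zeta> *s z))"
    define r where "r = 1 / (1 + ?a)\<^sup>2"
    have a0: "?a \<ge> 0" by simp
    then have a1: "1 + ?a > 0" by linarith
    have r: "r > 0" using a1 by (simp add: r_def)
    have ra: "r * ?a \<le> 1 / (1 + ?a)"
      using step_size_bounds(3)[OF a0] a1 by (simp add: r_def field_simps)
    have gh: "g holomorphic_on S" for S unfolding g_def by (rule slice_holomorphic_slice0[OF f])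
    have gc: "continuous_on S g" for S by (rule holomorphic_on_imp_continuous_on[OF gh])
    obtain \<zeta> where \<zeta>: "\<zeta> \<in> cball 1 r" "\<And>\<eta>. \<eta> \<in> cball 1 r \<Longrightarrow> cmod (g \<eta>) \<le> cmod (g \<zeta>)"
    proof -
      have "\<exists>x\<in>cball 1 r. \<forall>y\<in>cball 1 r. cmod (g y) \<le> cmod (g x)"
        using r by (intro continuous_attains_sup continuous_on_norm gc) auto
      then show ?thesis using that by blast
    qed
    define w where "w = \<zeta> *s z"
    have d: "norm (w - 1 *\<^sub>R z) \<le> 1 / (1 + ?a)"
    proof -
      have "w - 1 *\<^sub>R z = (\<zeta> - 1) *s z" by (simp add: w_def vec_eq_iff algebra_simps)
      then have "norm (w - 1 *\<^sub>R z) = cmod (\<zeta> - 1) * ?a" by (simp only: norm_smult_complex)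
      also have "\<dots> \<le> r * ?a" using \<zeta>(1) by (intro mult_right_mono) (auto simp: dist_norm norm_minus_commute)
      finally show ?thesis using ra by linarith
    qed
    have T: "?T = deriv g 1 + of_real \<gamma> * g 1"
    proof -
      have "(\<lambda>k. of_nat k * F k z + of_real \<gamma> * F k z) sums (deriv g 1 + of_real \<gamma> * g 1)"
        unfolding g_def
        by (intro sums_add sums_mult expansion_sums_radial_deriv[OF fF])
           (use fF in \<open>simp add: expansion_def\<close>)
      then have "(\<lambda>k. of_real (real k + \<gamma>) * F k z) sums (deriv g 1 + of_real \<gamma> * g 1)"
        by (simp add: algebra_simps)
      then show ?thesis unfolding multiplier_def by (rule sums_unique[symmetric])
    qed
    have "cmod ((deriv ^^ 1) g 1) \<le> fact 1 * cmod (g \<zeta>) / r ^ 1"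
      by (intro Cauchy_inequality gh gc r \<zeta>(2)) (auto simp: dist_norm)
    then have "cmod (deriv g 1) \<le> (1 + ?a)\<^sup>2 * cmod (g \<zeta>)" by (simp add: r_def mult.commute)
    moreover have "cmod (g 1) \<le> cmod (g \<zeta>)" using r by (intro \<zeta>(2)) auto
    then have "\<bar>\<gamma>\<bar> * cmod (g 1) \<le> \<bar>\<gamma>\<bar> * ((1 + ?a)\<^sup>2 * cmod (g \<zeta>))"
    proof (intro mult_left_mono)
      have "1 \<le> (1 + ?a)\<^sup>2" using a0 by (simp add: one_le_power)
      then have "1 * cmod (g \<zeta>) \<le> (1 + ?a)\<^sup>2 * cmod (g \<zeta>)" by (intro mult_right_mono) auto
      then show "cmod (g 1) \<le> cmod (g \<zeta>) \<Longrightarrow> cmod (g 1) \<le> (1 + ?a)\<^sup>2 * cmod (g \<zeta>)" by linarith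
    qed auto
    moreover have "cmod ?T \<le> cmod (deriv g 1) + \<bar>\<gamma>\<bar> * cmod (g 1)"
      unfolding T using norm_triangle_ineq[of "deriv g 1" "of_real \<gamma> * g 1"] by (simp add: norm_mult)
    ultimately have Tb: "cmod ?T \<le> (\<bar>\<gamma>\<bar> + 1) * (1 + ?a)\<^sup>2 * cmod (f w)"
      by (simp add: algebra_simps g_def w_def)
    have "(norm w)\<^sup>2 \<le> ?a\<^sup>2 + 3" using norm_sq_near[of w z 1] d by simp
    then have "exp (- ?a\<^sup>2 / 2) \<le> exp (3/2 + - (norm w)\<^sup>2 / 2)" by simp
    then have E: "exp (- ?a\<^sup>2 / 2) \<le> exp (3/2) * exp (- (norm w)\<^sup>2 / 2)" by (simp only: exp_add)
    have "gauss_abs (multiplier (\<lambda>k. real k + \<gamma>) F) z \<le>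
        ((\<bar>\<gamma>\<bar> + 1) * (1 + ?a)\<^sup>2 * cmod (f w)) * (exp (3/2) * exp (- (norm w)\<^sup>2 / 2))"
      unfolding gauss_abs_def using Tb E by (intro mult_mono) auto
    also have "\<dots> = (1 + ?a)\<^sup>2 * (((\<bar>\<gamma>\<bar> + 1) * exp (3/2)) * gauss_abs f w)"
      by (simp add: gauss_abs_def mult_ac)
    finally have "(1 + ?a) powr (- 2) * gauss_abs (multiplier (\<lambda>k. real k + \<gamma>) F) z \<le>
        (1 + ?a) powr (- 2) * ((1 + ?a)\<^sup>2 * (((\<bar>\<gamma>\<bar> + 1) * exp (3/2)) * gauss_abs f w))"
      by (intro mult_left_mono) auto
    also have "\<dots> = ((\<bar>\<gamma>\<bar> + 1) * exp (3/2)) * gauss_abs f w"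
    proof -
      have "(1 + ?a) powr (- 2) * (1 + ?a)\<^sup>2 = 1"
        using a1 powr_realpow[OF a1, of 2] by (simp add: powr_minus)
      then show ?thesis by (simp only: mult.assoc[symmetric] mult_1)
    qed
    finally have le: "(1 + ?a) powr (- 2 * 1) * gauss_abs (multiplier (\<lambda>k. real k + \<gamma>) F) z / ((\<bar>\<gamma>\<bar> + 1) * exp (3/2))
        \<le> exp (- 1 * (1 - 1\<^sup>2) * ?a\<^sup>2) * gauss_abs f w"
      by (simp add: pos_divide_le_eq mult.commute add_nonneg_pos)
    show "\<exists>t\<in>{1/2..1}. \<exists>w. norm (w - t *\<^sub>R z) \<le> 1 / (1 + ?a) \<and>
        0 \<le> (1 + ?a) powr (- 2 * 1) * gauss_abs (multiplier (\<lambda>k. real k + \<gamma>) F) z / ((\<bar>\<gamma>\<bar> + 1) * exp (3/2)) \<and>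
        (1 + ?a) powr (- 2 * 1) * gauss_abs (multiplier (\<lambda>k. real k + \<gamma>) F) z / ((\<bar>\<gamma>\<bar> + 1) * exp (3/2))
        \<le> exp (- 1 * (1 - t\<^sup>2) * ?a\<^sup>2) * gauss_abs f w"
    proof (intro bexI[of _ "1::real"] exI[of _ w] conjI d le)
    qed auto
  qed
qed (use p exp_bounded_linear in \<open>auto intro!: mult_pos_pos add_nonneg_pos\<close>)

text \<open>The part of the Beta integral near \<open>t = 1\<close>; the rest of it is a smoothing multiplier.\<close>

definition beta_coeff :: "real \<Rightarrow> real \<Rightarrow> nat \<Rightarrow> real" where
  "beta_coeff a d k = integral {1/2..1} (\<lambda>t. t powr (a + real k - 1) * (1 - t) powr (d - 1))"

lemma powr_le_two_powr:
  fixes t b :: real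
  assumes "1/2 \<le> t" "t \<le> 1"
  shows "t powr b \<le> 2 powr \<bar>b\<bar>"
  using powr_le_of_comparable[of t 1 2 b] assms by simp

lemma continuous_on_beta_integrand:
  assumes "1 < d"
  shows "continuous_on {1/2..1} (\<lambda>t::real. t powr b * (1 - t) powr (d - 1))"
  using assms by (intro continuous_intros continuous_on_powr') auto

lemma beta_coeff_has_integral:
  assumes "1 < d"
  shows "((\<lambda>t. t powr (a + real k - 1) * (1 - t) powr (d - 1)) has_integral beta_coeff a d k) {1/2..1}"
  unfolding beta_coeff_def
  by (intro integrable_integral integrable_continuous_real continuous_on_beta_integrand assms)

lemma beta_integrand_bound:
  fixes t :: real
  assumes "1 < d" "1/2 \<le> t" "t \<le> 1"
  shows "t powr (a - 1) * (1 - t) powr (d - 1) \<le> 2 powr \<bar>a - 1\<bar>"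
proof -
  have "(1 - t) powr (d - 1) \<le> 1" using assms by (intro powr_le1) auto
  then have "t powr (a - 1) * (1 - t) powr (d - 1) \<le> 2 powr \<bar>a - 1\<bar> * 1"
    using assms by (intro mult_mono powr_le_two_powr) auto
  then show ?thesis by simp
qed

lemma exp_bounded_beta_coeff:
  assumes d: "1 < d"
  shows "exp_bounded (beta_coeff a d)"
proof (rule exp_boundedI[of "2 powr \<bar>a - 1\<bar>" 1])
  fix k
  let ?h = "\<lambda>t::real. t powr (a + real k - 1) * (1 - t) powr (d - 1)"
  have "norm (beta_coeff a d k) \<le> 2 powr \<bar>a - 1\<bar> * (1 - 1/2)"
    unfolding beta_coeff_def
  proof (rule integral_bound)
    show "continuous_on {1/2..1} ?h" by (rule continuous_on_beta_integrand[OF d])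
    fix t :: real assume t: "t \<in> {1/2..1}"
    have "?h t = t ^ k * (t powr (a - 1) * (1 - t) powr (d - 1))"
      using t powr_realpow[of t k] by (simp add: powr_add[symmetric] algebra_simps flip: powr_realpow)
    also have "\<dots> \<le> 1 * 2 powr \<bar>a - 1\<bar>"
      using t by (intro mult_mono beta_integrand_bound d power_le_one) auto
    finally show "norm (?h t) \<le> 2 powr \<bar>a - 1\<bar>" by simp
  qed simp
  also have "2 powr \<bar>a - 1\<bar> * (1 - 1/2) \<le> 2 powr \<bar>a - 1\<bar> * 1 ^ k" by simp
  finally show "\<bar>beta_coeff a d k\<bar> \<le> 2 powr \<bar>a - 1\<bar> * 1 ^ k" by simp
qed auto

text \<open>Termwise integration of the homogeneous expansion of \<open>f (t z)\<close>, whose k-th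
  term carries \<open>t ^ k\<close>, turns the multiplier into an average over dilations.\<close>

lemma multiplier_beta_coeff_has_integral:
  assumes d: "1 < d" and fF: "expansion f F"
  shows "((\<lambda>t. of_real (t powr (a - 1) * (1 - t) powr (d - 1)) * f (of_real t *s z))
    has_integral multiplier (beta_coeff a d) F z) {1/2..1}"
proof -
  have f: "slice_holomorphic f" using fF by (simp add: expansion_def)
  let ?h = "\<lambda>t::real. t powr (a - 1) * (1 - t) powr (d - 1)"
  let ?G = "\<lambda>m t. \<Sum>k<m. of_real (?h t) * (F k z * of_real t ^ k)"
  let ?g = "\<lambda>t. of_real (?h t) * f (of_real t *s z)"
  \<comment> \<open>Bounding \<open>f\<close> on twice the ball makes the terms decay like
    \<open>(1/2) ^ k\<close>, a majorant valid for all \<open>t \<le> 1\<close> at once.\<close>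
  obtain B where B: "B > 0" "\<And>w. norm w \<le> 2 * 1 * norm z \<Longrightarrow> cmod (f w) \<le> B"
    using slice_holomorphic_bounded[OF f] by blast
  have Fb: "cmod (F k z) \<le> B * (1/2) ^ k" for k
    using multiplier_terms_bound[OF fF, of "\<lambda>_. 1" 1 1 "norm z" B z k] B by simp
  have "uniform_limit {1/2..1} ?G (\<lambda>t. \<Sum>k. of_real (?h t) * (F k z * of_real t ^ k)) sequentially"
  proof (rule Weierstrass_m_test)
    fix k and t :: real assume t: "t \<in> {1/2..1}"
    have "cmod (of_real (?h t) * (F k z * of_real t ^ k)) = ?h t * (cmod (F k z) * t ^ k)"
      using t by (simp add: norm_mult norm_power)
    also have "\<dots> \<le> 2 powr \<bar>a - 1\<bar> * (B * (1/2) ^ k * 1)"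
      using t B(1) by (intro mult_mono beta_integrand_bound d Fb power_le_one) auto
    finally show "cmod (of_real (?h t) * (F k z * of_real t ^ k)) \<le> 2 powr \<bar>a - 1\<bar> * B * (1/2) ^ k"
      by simp
  qed (intro summable_mult summable_geometric, simp)
  moreover have "(\<Sum>k. of_real (?h t) * (F k z * of_real t ^ k)) = ?g t" for t
    using sums_unique[OF sums_mult[OF expansion_slice_sums[OF fF, of z "of_real t"], of "of_real (?h t)"]] by simp
  ultimately have ul: "uniform_limit {1/2..1} ?G ?g sequentially" by simp
  have "continuous_on {1/2..1} (?G m)" for m
    by (intro continuous_intros continuous_on_of_real continuous_on_beta_integrand d)
  from uniform_limit_integral[OF ul this] obtain I J where
    IJ: "\<And>m. (?G m has_integral I m) {1/2..1}" "(?g has_integral J) {1/2..1}" "I \<longlonglongrightarrow> J" by auto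
  have "(?G m has_integral (\<Sum>k<m. of_real (beta_coeff a d k) * F k z)) {1/2..1}" for m
  proof (rule has_integral_sum)
    fix k
    have "((\<lambda>t. of_real (t powr (a + real k - 1) * (1 - t) powr (d - 1)) * F k z)
        has_integral of_real (beta_coeff a d k) * F k z) {1/2..1}"
      by (intro has_integral_mult_left has_integral_of_real beta_coeff_has_integral d)
    then show "((\<lambda>t. of_real (?h t) * (F k z * of_real t ^ k)) has_integral of_real (beta_coeff a d k) * F k z) {1/2..1}"
    proof (rule has_integral_eq[rotated])
      fix t :: real assume t: "t \<in> {1/2..1}"
      have "t powr (a + real k - 1) = t powr (a - 1) * t ^ k"
        using t by (simp add: powr_add[symmetric] algebra_simps flip: powr_realpow)
      then show "of_real (t powr (a + real k - 1) * (1 - t) powr (d - 1)) * F k z =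
          of_real (?h t) * (F k z * of_real t ^ k)"
        by (simp add: mult_ac)
    qed
  qed auto
  then have "I = (\<lambda>m. \<Sum>k<m. of_real (beta_coeff a d k) * F k z)"
    using IJ(1) has_integral_unique by blast
  then have "(\<lambda>k. of_real (beta_coeff a d k) * F k z) sums J"
    using IJ(3) by (simp add: sums_def)
  then have "multiplier (beta_coeff a d) F z = J"
    unfolding multiplier_def by (rule sums_unique[symmetric])
  then show ?thesis using IJ(2) by simp
qed

text \<open>The inequality \<open>x \<le> exp x\<close> at \<open>x = y / (2 * D)\<close>, raised to
  the power \<open>D\<close>.\<close>

lemma powr_mult_exp_le:
  fixes y D :: real
  assumes "0 \<le> y" "0 < D"
  shows "y powr D * exp (- y / 2) \<le> (2 * D) powr D"
proof -
  have "y / (2 * D) \<le> exp (y / (2 * D))" using exp_ge_add_one_self[of "y / (2 * D)"] by linarith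
  then have "(y / (2 * D)) powr D \<le> exp (y / (2 * D)) powr D"
    using assms by (intro powr_mono2) auto
  also have "\<dots> = exp (y / 2)" using assms by (simp add: exp_powr_real)
  finally have "y powr D \<le> (2 * D) powr D * exp (y / 2)"
    using assms by (simp add: powr_divide field_simps)
  then show ?thesis by (simp add: exp_minus field_simps)
qed

text \<open>The integrand carries \<open>exp (- l * (1 - t))\<close> with \<open>l\<close>
  comparable to \<open>(1 + norm z)\<^sup>2\<close>. Half of it against
  \<open>(1 - t) powr (d - 1)\<close> yields \<open>l powr (- (d - 1))\<close>, the other half
  integrates to at most \<open>2 / l\<close>; together this is \<open>l powr (- d)\<close> up to a
  constant, hence order \<open>- d\<close>.\<close>

lemma mult_order_beta_coeff:
  assumes p: "0 < p" and d: "2 \<le> d"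
  shows "mult_order TYPE('n::finite) p (- d) (beta_coeff a d)"
proof -
  define D where "D = d - 1"
  have D: "D > 0" using d by (simp add: D_def)
  have d1: "1 < d" using d by simp
  define Q where "Q = 2 powr \<bar>a - 1\<bar> * (exp (1/4) * (2 * D) powr D)"
  have Q: "Q > 0" using D by (simp add: Q_def)
  define K where "K = Q * 2 * 8 powr d"
  have K: "K > 0" using Q by (simp add: K_def)
  show ?thesis
  proof (rule mult_orderI_dominated[where q = "1/4" and K = K])
    fix f :: "complex^'n \<Rightarrow> complex" and F
    assume fF: "expansion f F"
    then have f: "slice_holomorphic f" by (simp add: expansion_def)
    let ?T = "multiplier (beta_coeff a d) F"
    show "gauss_dominated (1/4) (\<lambda>z. (1 + norm z) powr (- 2 * (- d)) * gauss_abs ?T z / K) f"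
      unfolding gauss_dominated_def
    proof
      fix z :: "complex^'n"
      let ?a = "norm z"
      have a0: "?a \<ge> 0" by simp
      then have a1: "1 + ?a > 0" by linarith
      define l where "l = (1 + ?a\<^sup>2) / 4"
      have l: "l > 0" by (simp add: l_def add_pos_nonneg)
      \<comment> \<open>The right-hand side of domination with \<open>q = 1/4\<close> and
        \<open>w = t z\<close>; its maximum point \<open>t0\<close> serves as the single
        witness.\<close>
      define m where "m t = exp (- (1/4) * (1 - t\<^sup>2) * ?a\<^sup>2) * gauss_abs f (t *\<^sub>R z)" for t
      have "continuous_on UNIV (\<lambda>t. gauss_abs f (t *\<^sub>R z))"
        by (rule continuous_on_compose2[OF continuous_on_gauss_abs[OF slice_holomorphic_cont[OF f, of UNIV]]])
           (auto intro!: continuous_intros)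
      then have "continuous_on {1/2..1} m"
        unfolding m_def by (auto intro!: continuous_intros intro: continuous_on_subset)
      then obtain t0 where t0: "t0 \<in> {1/2..1}" "\<And>t. t \<in> {1/2..1} \<Longrightarrow> m t \<le> m t0"
        using continuous_attains_sup[of "{1/2..1::real}" m] by auto
      have m0: "m t0 \<ge> 0" by (simp add: m_def)
      define G where "G t = Q * l powr (- D) * m t0 * exp (?a\<^sup>2 / 2) * exp (- (l/2) * (1 - t))" for t
      have pt: "norm (of_real (t powr (a - 1) * (1 - t) powr (d - 1)) * f (of_real t *s z)) \<le> G t"
        if t: "t \<in> {1/2..1}" for t
      proof -
        have "cmod (f (t *\<^sub>R z)) = gauss_abs f (t *\<^sub>R z) * exp (t\<^sup>2 * ?a\<^sup>2 / 2)"
          by (simp add: gauss_abs_def power_mult_distrib exp_minus)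
        \<comment> \<open>Of the decay \<open>(1 - t\<^sup>2) * ?a\<^sup>2 / 2\<close>, one half
          goes into \<open>m\<close> and the other half remains for the integral over
          \<open>t\<close>.\<close>
        also have "exp (t\<^sup>2 * ?a\<^sup>2 / 2) = exp (- (1/4) * (1 - t\<^sup>2) * ?a\<^sup>2) * (exp (?a\<^sup>2 / 2) * exp (- (1/4) * (1 - t\<^sup>2) * ?a\<^sup>2))"
          unfolding exp_add[symmetric] by (simp add: field_simps)
        also have "gauss_abs f (t *\<^sub>R z) * \<dots> = m t * (exp (?a\<^sup>2 / 2) * exp (- (1/4) * (1 - t\<^sup>2) * ?a\<^sup>2))"
          by (simp add: m_def mult_ac)
        also have "\<dots> \<le> m t0 * (exp (?a\<^sup>2 / 2) * (exp (1/4) * exp (- l * (1 - t))))"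
        proof (intro mult_mono mult_left_mono t0 t)
          \<comment> \<open>The factor \<open>exp (1/4)\<close> pays for having
            \<open>1 + ?a\<^sup>2\<close> instead of \<open>?a\<^sup>2\<close> in \<open>l\<close>,
            which keeps \<open>l\<close> positive at \<open>z = 0\<close>.\<close>
          have "t\<^sup>2 \<le> t" using t by (simp add: power2_eq_square mult_left_le_one_le)
          then have "(1 - t) * ?a\<^sup>2 \<le> (1 - t\<^sup>2) * ?a\<^sup>2" by (intro mult_right_mono) auto
          then have "- (1/4) * (1 - t\<^sup>2) * ?a\<^sup>2 \<le> 1/4 + - l * (1 - t)"
            using t by (simp add: l_def field_simps)
          then show "exp (- (1/4) * (1 - t\<^sup>2) * ?a\<^sup>2) \<le> exp (1/4) * exp (- l * (1 - t))"
            unfolding exp_add[symmetric] by (simp only: exp_le_cancel_iff)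
        qed (use m0 in auto)
        finally have fb: "cmod (f (t *\<^sub>R z)) \<le> m t0 * (exp (?a\<^sup>2 / 2) * (exp (1/4) * exp (- l * (1 - t))))" .
        have "(l * (1 - t)) powr D * exp (- (l * (1 - t)) / 2) \<le> (2 * D) powr D"
          using t l D by (intro powr_mult_exp_le) auto
        then have "l powr (- D) * (l powr D * ((1 - t) powr D * exp (- (l/2) * (1 - t)))) \<le> l powr (- D) * (2 * D) powr D"
          by (intro mult_left_mono) (simp_all add: powr_mult mult.assoc)
        moreover have "l powr (- D) * l powr D = 1" using l by (simp add: powr_minus)
        ultimately have pb: "(1 - t) powr D * exp (- (l/2) * (1 - t)) \<le> l powr (- D) * (2 * D) powr D"
          by (simp only: mult.assoc[symmetric] mult_1)
        have ex: "exp (- l * (1 - t)) = exp (- (l/2) * (1 - t)) * exp (- (l/2) * (1 - t))"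
          unfolding exp_add[symmetric] by (simp add: field_simps)
        have "norm (of_real (t powr (a - 1) * (1 - t) powr (d - 1)) * f (of_real t *s z)) =
            t powr (a - 1) * ((1 - t) powr D * cmod (f (t *\<^sub>R z)))"
          by (simp add: norm_mult of_real_smult D_def)
        also have "\<dots> \<le> 2 powr \<bar>a - 1\<bar> * ((1 - t) powr D * (m t0 * (exp (?a\<^sup>2 / 2) * (exp (1/4) * exp (- l * (1 - t))))))"
          using t fb by (intro mult_mono mult_left_mono powr_le_two_powr) auto
        also have "\<dots> = 2 powr \<bar>a - 1\<bar> * m t0 * exp (?a\<^sup>2 / 2) * exp (1/4) * exp (- (l/2) * (1 - t))
            * ((1 - t) powr D * exp (- (l/2) * (1 - t)))"
          unfolding ex by (simp only: mult_ac)
        also have "\<dots> \<le> 2 powr \<bar>a - 1\<bar> * m t0 * exp (?a\<^sup>2 / 2) * exp (1/4) * exp (- (l/2) * (1 - t))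
            * (l powr (- D) * (2 * D) powr D)"
          using m0 by (intro mult_left_mono pb) auto
        also have "\<dots> = G t" by (simp only: G_def Q_def mult_ac)
        finally show ?thesis .
      qed
      let ?P = "Q * l powr (- D) * m t0 * exp (?a\<^sup>2 / 2)"
      have Gi: "(G has_integral (?P * (2 / l) * exp (- (l/2) * (1 - 1)) - ?P * (2 / l) * exp (- (l/2) * (1 - 1/2)))) {1/2..1}"
        unfolding G_def using l
        by (intro fundamental_theorem_of_calculus)
           (auto intro!: derivative_eq_intros simp: has_real_derivative_iff_has_vector_derivative[symmetric])
      have "norm (?T z) \<le> integral {1/2..1} G"
        unfolding integral_unique[OF multiplier_beta_coeff_has_integral[OF d1 fF], symmetric]
        by (rule integral_norm_bound_integral[OF has_integral_integrable[OF multiplier_beta_coeff_has_integral[OF d1 fF]] has_integral_integrable[OF Gi] pt])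
      also have "\<dots> \<le> ?P * (2 / l)"
        unfolding integral_unique[OF Gi] using Q l m0 by simp
      finally have Tb: "cmod (?T z) \<le> ?P * (2 / l)" .
      have lb: "l powr (- D) * (2 / l) \<le> 2 * (8 powr d * (1 + ?a) powr (- 2 * d))"
      proof -
        have "l powr (- D) * (2 / l) = 2 * l powr (- d)"
        proof -
          have "l powr (- d) = l powr (- D) * l powr (- 1)" unfolding powr_add[symmetric] by (simp add: D_def)
          then show ?thesis using l by (simp add: powr_minus field_simps)
        qed
        \<comment> \<open>The 8 is the 4 in \<open>l\<close> times the 2 in
          \<open>(1 + ?a)\<^sup>2 \<le> 2 * (1 + ?a\<^sup>2)\<close>.\<close>
        also have "l powr (- d) \<le> ((1 + ?a)\<^sup>2 / 8) powr (- d)"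
        proof (rule powr_mono2')
          show "(1 + ?a)\<^sup>2 / 8 \<le> l"
            using sum_squares_bound[of 1 ?a] by (simp add: l_def power2_eq_square algebra_simps)
        qed (use a1 d in auto)
        also have "((1 + ?a)\<^sup>2 / 8) powr (- d) = 8 powr d * (1 + ?a) powr (- 2 * d)"
        proof -
          have "(1 + ?a)\<^sup>2 = (1 + ?a) powr 2" using powr_realpow[OF a1, of 2] by simp
          then show ?thesis
            unfolding powr_divide by (simp only: powr_powr) (simp add: powr_minus field_simps)
        qed
        finally show ?thesis by simp
      qed
      have "gauss_abs ?T z \<le> ?P * (2 / l) * exp (- ?a\<^sup>2 / 2)"
        unfolding gauss_abs_def using Tb by (intro mult_right_mono) auto
      also have "\<dots> = Q * m t0 * (l powr (- D) * (2 / l)) * (exp (?a\<^sup>2 / 2) * exp (- ?a\<^sup>2 / 2))"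
        by (simp only: mult_ac)
      also have "exp (?a\<^sup>2 / 2) * exp (- ?a\<^sup>2 / 2) = 1" unfolding exp_add[symmetric] by simp
      also have "Q * m t0 * (l powr (- D) * (2 / l)) * 1 \<le> Q * m t0 * (2 * (8 powr d * (1 + ?a) powr (- 2 * d))) * 1"
        using Q m0 by (intro mult_left_mono mult_right_mono lb) auto
      also have "\<dots> = K * m t0 * (1 + ?a) powr (- 2 * d)" by (simp add: K_def mult_ac)
      finally have "(1 + ?a) powr (- 2 * (- d)) * gauss_abs ?T z \<le> (1 + ?a) powr (- 2 * (- d)) * (K * m t0 * (1 + ?a) powr (- 2 * d))"
        by (intro mult_left_mono) auto
      also have "\<dots> = K * m t0"
        using a1 by (simp add: powr_minus field_simps)
      finally have le: "(1 + ?a) powr (- 2 * (- d)) * gauss_abs ?T z / K \<le> m t0"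
        unfolding pos_divide_le_eq[OF K] by (simp only: mult.commute)
      show "\<exists>t\<in>{1/2..1}. \<exists>w. norm (w - t *\<^sub>R z) \<le> 1 / (1 + ?a) \<and>
          0 \<le> (1 + ?a) powr (- 2 * (- d)) * gauss_abs ?T z / K \<and>
          (1 + ?a) powr (- 2 * (- d)) * gauss_abs ?T z / K \<le> exp (- (1/4) * (1 - t\<^sup>2) * ?a\<^sup>2) * gauss_abs f w"
        using t0(1) le K a1 unfolding m_def by (intro bexI[of _ t0] exI[of _ "t0 *\<^sub>R z"] conjI) auto
    qed
  qed (use p K exp_bounded_beta_coeff[OF d1] in auto)
qed

text \<open>From the cutoff \<open>K\<close> on, \<open>x = a + k\<close> is at least 1, so the Beta
  integral converges at 0 and \<open>t powr (x - 1)\<close> is at most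
  \<open>(1/2) powr (x - 1)\<close> on the discarded half; this is the geometric decay in
  \<open>k\<close>.\<close>

lemma mult_order_Gamma_ratio_tail:
  fixes a d :: real and K :: nat
  assumes p: "0 < p" and d: "2 \<le> d" and K: "1 \<le> a + real K"
  shows "mult_order TYPE('n::finite) p (- d)
    (\<lambda>k. if K \<le> k then Gamma (a + real k) / Gamma (a + d + real k) else 0)"
proof -
  define r where "r k = (if K \<le> k then Gamma (a + real k) / Gamma (a + d + real k) else 0)" for k
  define b where "b k = 1 / Gamma d * beta_coeff a d k" for k
  have Gd: "Gamma d > 0" using d by (intro Gamma_real_pos) auto
  have e: "smoothing (\<lambda>k. r k - b k)"
  proof -
    \<comment> \<open>\<open>c1\<close> serves the indices \<open>k \<ge> K\<close>,
      \<open>c2\<close> the finitely many below.\<close>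
    define c1 where "c1 = 1 / Gamma d * (1/2) powr (a - 1)"
    define c2 where "c2 = (\<Sum>k<K. \<bar>r k - b k\<bar> * 2 ^ k)"
    have c2: "c2 \<ge> 0" unfolding c2_def by (intro sum_nonneg) auto
    have c1: "c1 \<ge> 0" using Gd by (simp add: c1_def)
    have "\<bar>r k - b k\<bar> \<le> (c1 + c2) * (1/2) ^ k" for k
    proof (cases "K \<le> k")
      case False
      then have "\<bar>r k - b k\<bar> * 2 ^ k \<le> c2" unfolding c2_def by (intro member_le_sum) auto
      also have "\<dots> \<le> c1 + c2" using c1 by simp
      finally show ?thesis by (simp add: field_simps)
    next
      case True
      define x where "x = a + real k"
      have x: "x \<ge> 1" using K True by (simp add: x_def)
      let ?h = "\<lambda>t::real. t powr (x - 1) * (1 - t) powr (d - 1)"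
      have B: "(?h has_integral Beta x d) {0..1}" using x d by (intro has_integral_Beta_real) auto
      have i1: "?h integrable_on {0..1/2}"
        by (rule integrable_subinterval_real[OF has_integral_integrable[OF B]]) auto
      have "integral {0..1/2} ?h + integral {1/2..1} ?h = Beta x d"
        using Henstock_Kurzweil_Integration.integral_combine[of 0 "1/2" 1 ?h] has_integral_integrable[OF B] integral_unique[OF B] by simp
      moreover have "integral {1/2..1} ?h = beta_coeff a d k" by (simp add: beta_coeff_def x_def)
      moreover have "Gamma x / Gamma (x + d) = 1 / Gamma d * Beta x d"
        using Gd by (simp add: Beta_def)
      moreover have "r k = Gamma x / Gamma (x + d)" using True by (simp add: r_def x_def add_ac)
      ultimately have eq: "r k - b k = 1 / Gamma d * integral {0..1/2} ?h"
        by (simp add: b_def distrib_left[symmetric] flip: diff_divide_distrib)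
      have "norm (integral {0..1/2} ?h) \<le> (1/2) powr (x - 1) * measure lborel {0..1/2::real}"
      proof (rule has_integral_bound_real[OF _ finite.emptyI integrable_integral[OF i1]])
        fix t :: real assume t: "t \<in> {0..1/2} - {}"
        have "t powr (x - 1) * (1 - t) powr (d - 1) \<le> (1/2) powr (x - 1) * 1"
          using t x d by (intro mult_mono powr_mono2 powr_le1) auto
        then show "norm (?h t) \<le> (1/2) powr (x - 1)" by simp
      qed simp
      also have "\<dots> \<le> (1/2) powr (x - 1)" by simp
      also have "(1/2) powr (x - 1) = (1/2) powr (a - 1) * (1/2) ^ k"
        by (simp add: x_def powr_add[symmetric] algebra_simps flip: powr_realpow)
      finally have "1 / Gamma d * \<bar>integral {0..1/2} ?h\<bar> \<le> 1 / Gamma d * ((1/2) powr (a - 1) * (1/2) ^ k)"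
        using Gd by (intro mult_left_mono) auto
      then have "\<bar>r k - b k\<bar> \<le> c1 * (1/2) ^ k"
        unfolding eq abs_mult c1_def using Gd by (simp add: mult.assoc)
      also have "\<dots> \<le> (c1 + c2) * (1/2) ^ k" using c2 by (intro mult_right_mono) auto
      finally show ?thesis .
    qed
    then show ?thesis unfolding smoothing_def by blast
  qed
  have "mult_order TYPE('n) p (0 + - d) b"
    unfolding b_def by (intro mult_order_mult mult_order_const p mult_order_beta_coeff d)
  then have "mult_order TYPE('n) p (- d) b" by simp
  then have "mult_order TYPE('n) p (- d) (\<lambda>k. b k + (r k - b k))"
    by (rule mult_order_add[OF p _ mult_order_smoothing[OF p e]])
  then show ?thesis by (simp add: r_def[symmetric])
qed

lemma mult_order_pochhammer:
  assumes p: "0 < p"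
  shows "mult_order TYPE('n::finite) p (real m) (\<lambda>k. pochhammer (b + real k) m)"
proof (induction m)
  case 0
  then show ?case using mult_order_const[OF p, where x = 1] by simp
next
  case (Suc m)
  have "(\<lambda>k. pochhammer (b + real k) (Suc m)) = (\<lambda>k. (real k + (b + real m)) * pochhammer (b + real k) m)"
    by (auto simp: pochhammer_Suc algebra_simps)
  then show ?case using mult_order_mult[OF mult_order_linear[OF p, of "b + real m"] Suc] by simp
qed

text \<open>The integer \<open>m\<close> is so large that \<open>d = b + m - a\<close> is at least
  2. Since \<open>a + d = b + m\<close>, the quotient factors into
  \<open>Gamma (a + k) / Gamma (a + d + k)\<close> of order \<open>- d\<close> and a product of
  \<open>m\<close> linear factors. Agreement from \<open>N\<close> on is enough, because finitely
  many values change \<open>c\<close> by a smoothing sequence, which has every order.\<close>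

lemma mult_order_Gamma_ratio:
  fixes a b :: real
  assumes p: "0 < p" and c: "\<And>k. k \<ge> N \<Longrightarrow> c k = Gamma (a + real k) / Gamma (b + real k)"
  shows "mult_order TYPE('n::finite) p (a - b) c"
proof -
  define m where "m = nat \<lceil>\<bar>a - b\<bar> + 2\<rceil>"
  define d where "d = b + real m - a"
  have "real m \<ge> \<bar>a - b\<bar> + 2" unfolding m_def by linarith
  then have d: "2 \<le> d" by (simp add: d_def)
  \<comment> \<open>From this index on both \<open>a + k\<close> and \<open>b + k\<close> are
    positive, so no Gamma factor meets a pole.\<close>
  define K where "K = max N (nat \<lceil>\<bar>a\<bar> + \<bar>b\<bar> + 1\<rceil>)"
  have K: "N \<le> K" "real K \<ge> \<bar>a\<bar> + \<bar>b\<bar> + 1" unfolding K_def by (simp, linarith)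
  define r where "r k = (if K \<le> k then Gamma (a + real k) / Gamma (a + d + real k) else 0)" for k
  define q where "q k = r k * pochhammer (b + real k) m" for k
  have r: "mult_order TYPE('n) p (- d) r"
    unfolding r_def using K by (intro mult_order_Gamma_ratio_tail p d) linarith
  have "- d + real m = a - b" by (simp add: d_def)
  then have q: "mult_order TYPE('n) p (a - b) q"
    unfolding q_def using mult_order_mult[OF r mult_order_pochhammer[OF p, of m b]] by simp
  have "c k - q k = 0" if k: "K \<le> k" for k
  proof -
    have y: "b + real k > 0" using K k by linarith
    then have "b + real k \<notin> \<int>\<^sub>\<le>\<^sub>0" by (auto dest: nonpos_Ints_nonpos)
    then have "pochhammer (b + real k) m = Gamma (b + real k + real m) / Gamma (b + real k)"
      by (rule pochhammer_Gamma)
    moreover have "r k = Gamma (a + real k) / Gamma (b + real k + real m)"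
      using k by (simp add: r_def d_def add_ac)
    moreover have "Gamma (b + real k + real m) > 0" using y by (intro Gamma_real_pos) linarith
    ultimately show ?thesis using k K(1) by (simp add: q_def c)
  qed
  then have "smoothing (\<lambda>k. c k - q k)" by (rule smoothing_finite_support)
  from mult_order_add[OF p q mult_order_smoothing[OF p this]] show ?thesis by simp
qed

section \<open>From orders of multipliers to equality of spaces\<close>

lemma equivalent_norms_onI:
  assumes "C > 0" "C' > 0" "\<And>f. f \<in> X \<Longrightarrow> N f \<le> ennreal C * M f" "\<And>f. f \<in> X \<Longrightarrow> M f \<le> ennreal C' * N f"
  shows "equivalent_norms_on X N M"
  using assms unfolding equivalent_norms_on_def by blast

lemma equivalent_norms_on_trans_sym:
  assumes "equivalent_norms_on X N M" "equivalent_norms_on X N' M"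
  shows "equivalent_norms_on X N N'"
proof -
  obtain A A' where A: "A > 0" "A' > 0" "\<And>f. f \<in> X \<Longrightarrow> N f \<le> ennreal A * M f" "\<And>f. f \<in> X \<Longrightarrow> M f \<le> ennreal A' * N f"
    using assms(1) unfolding equivalent_norms_on_def by blast
  obtain B B' where B: "B > 0" "B' > 0" "\<And>f. f \<in> X \<Longrightarrow> N' f \<le> ennreal B * M f" "\<And>f. f \<in> X \<Longrightarrow> M f \<le> ennreal B' * N' f"
    using assms(2) unfolding equivalent_norms_on_def by blast
  have 1: "N f \<le> ennreal (A * B') * N' f" if "f \<in> X" for f
    using order.trans[OF A(3)[OF that] mult_left_mono[OF B(4)[OF that], of "ennreal A"]] A(1) B(2)
    by (simp add: ennreal_mult mult.assoc)
  have 2: "N' f \<le> ennreal (B * A') * N f" if "f \<in> X" for f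
    using order.trans[OF B(3)[OF that] mult_left_mono[OF A(4)[OF that], of "ennreal B"]] A(2) B(1)
    by (simp add: ennreal_mult mult.assoc)
  show ?thesis
    using A(1,2) B(1,2) by (intro equivalent_norms_onI[of "A * B'" "B * A'"] 1 2) auto
qed

text \<open>Polynomials lie in every weighted space. Hence membership can depend on
  \<open>R f\<close> alone although the norm may also contain the low-degree part.\<close>

lemma L_norm_finite_support_multiplier:
  assumes p: "0 < p" and l: "\<And>k. k \<ge> N \<Longrightarrow> l k = 0" and fF: "expansion (f :: complex^'n \<Rightarrow> complex) F"
  shows "L_norm p \<alpha> (multiplier l F) < \<infinity>"
proof -
  have hom: "slice_holomorphic (F k)" "F k (t *s z) = t ^ k * F k z" for k t z
    using fF by (auto simp: expansion_def)
  have "\<exists>B. \<forall>z. cmod (F k z) \<le> B * norm z ^ k \<and> B > 0" for k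
    using homogeneous_growth[OF hom(1,2), of k] by metis
  then obtain B where B: "\<And>k z. cmod (F k z) \<le> B k * norm z ^ k" "\<And>k. B k > 0" by metis
  define A where "A = (\<Sum>k<N. \<bar>l k\<bar> * B k)"
  have A: "A \<ge> 0" unfolding A_def using B(2) by (intro sum_nonneg mult_nonneg_nonneg) (auto simp: less_imp_le)
  have eb: "exp_bounded l" by (intro smoothing_exp_bounded smoothing_finite_support l)
  obtain C where C: "C > 0"
    "\<And>(\<psi> :: complex^'n \<Rightarrow> complex) K. continuous_on UNIV \<psi> \<Longrightarrow> K \<ge> 0 \<Longrightarrow>
      (\<And>z. gauss_abs \<psi> z \<le> K * ((1 + norm z) powr real N * exp (- (1/2) * (norm z)\<^sup>2))) \<Longrightarrow>
      L_norm p \<alpha> \<psi> \<le> ennreal (C * K)"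
    using L_norm_gaussian_decay[OF p, where 'n='n and \<alpha>=\<alpha> and \<kappa>="1/2" and M="real N"] by auto
  have "gauss_abs (multiplier l F) z \<le> A * ((1 + norm z) powr real N * exp (- (1/2) * (norm z)\<^sup>2))" for z
  proof -
    have "multiplier l F z = (\<Sum>k<N. of_real (l k) * F k z)"
      unfolding multiplier_def by (intro suminf_finite) (auto simp: l)
    then have "cmod (multiplier l F z) \<le> (\<Sum>k<N. cmod (of_real (l k) * F k z))" by (simp add: norm_sum)
    also have "\<dots> \<le> (\<Sum>k<N. \<bar>l k\<bar> * B k * (1 + norm z) ^ N)"
    proof (rule sum_mono)
      fix k assume k: "k \<in> {..<N}"
      have "norm z ^ k \<le> (1 + norm z) ^ k" by (intro power_mono) auto
      also have "\<dots> \<le> (1 + norm z) ^ N" using k by (intro power_increasing) auto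
      finally have "B k * norm z ^ k \<le> B k * (1 + norm z) ^ N" using B(2)[of k] by (intro mult_left_mono) auto
      then have "cmod (F k z) \<le> B k * (1 + norm z) ^ N" using B(1)[of k z] by linarith
      then have "\<bar>l k\<bar> * cmod (F k z) \<le> \<bar>l k\<bar> * (B k * (1 + norm z) ^ N)" by (intro mult_left_mono) auto
      then show "cmod (of_real (l k) * F k z) \<le> \<bar>l k\<bar> * B k * (1 + norm z) ^ N" by (simp add: norm_mult mult.assoc)
    qed
    also have "\<dots> = A * (1 + norm z) powr real N"
      using powr_realpow[of "1 + norm z" N] by (simp add: A_def sum_distrib_right add_pos_nonneg)
    finally have "gauss_abs (multiplier l F) z \<le> A * (1 + norm z) powr real N * exp (- (norm z)\<^sup>2 / 2)"
      unfolding gauss_abs_def by (intro mult_right_mono) auto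
    then show ?thesis by (simp add: mult.assoc)
  qed
  then have "L_norm p \<alpha> (multiplier l F) \<le> ennreal (C * A)"
    using A by (intro C(2) multiplier_cont[OF fF eb]) auto
  also have "\<dots> < \<infinity>" by simp
  finally show ?thesis .
qed

text \<open>Here \<open>e\<close> inverts \<open>c\<close> outside the finite support of the projection \<open>l\<close>.\<close>

lemma multiplier_space_eq_fock:
  fixes p :: ennreal and \<alpha> s :: real
  assumes p: "0 < p"
    and c: "mult_order TYPE('n::finite) p s c" and e: "mult_order TYPE('n) p (- s) e"
    and l: "\<And>k. k \<ge> N \<Longrightarrow> l k = 0" and inv: "\<And>k. e k * c k + l k = 1" and idem: "\<And>k. l k * l k = l k"
  defines "R \<equiv> \<lambda>f z. of_real ((1 + norm z) powr (- s)) * multiplier c (hom_part f) z"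
  shows "{f :: complex^'n \<Rightarrow> complex. entire f \<and> R f \<in> L_space p \<alpha>} = fock p (shifted_weight p \<alpha> s)"
    and "equivalent_norms_on (fock p (shifted_weight p \<alpha> s) :: (complex^'n \<Rightarrow> complex) set)
      (\<lambda>f. L_norm p \<alpha> (R f) + L_norm p \<alpha> (multiplier l (hom_part f))) (L_norm p (shifted_weight p \<alpha> s))"
proof -
  define \<beta> where "\<beta> = shifted_weight p \<alpha> s"
  define \<gamma> where "\<gamma> = shifted_weight p \<alpha> (- s)"
  \<comment> \<open>\<open>c\<close> maps weight \<open>\<beta>\<close> to \<open>\<gamma>\<close>
    and \<open>e\<close> maps back; \<open>\<gamma>\<close> is the weight at which the multiplied
    function has the same norm as \<open>R f\<close> at \<open>\<alpha>\<close>.\<close>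
  have bg: "shifted_weight p \<beta> (- 2 * s) = \<gamma>" "shifted_weight p \<gamma> (- 2 * (- s)) = \<beta>"
    by (simp_all add: \<beta>_def \<gamma>_def shifted_weight_add)
  note cb = mult_order_exp_bounded[OF c] and eb = mult_order_exp_bounded[OF e]
  have ls: "smoothing l" by (rule smoothing_finite_support[OF l])
  note lb = smoothing_exp_bounded[OF ls]
  obtain C1 where C1: "C1 > 0" "\<And>(f :: complex^'n \<Rightarrow> complex) F. expansion f F \<Longrightarrow>
      L_norm p \<gamma> (multiplier c F) \<le> ennreal C1 * L_norm p \<beta> f"
    using mult_orderD[OF c, of \<beta>] unfolding bg by blast
  obtain C2 where C2: "C2 > 0" "\<And>(f :: complex^'n \<Rightarrow> complex) F. expansion f F \<Longrightarrow>
      L_norm p \<beta> (multiplier e F) \<le> ennreal C2 * L_norm p \<gamma> f"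
    using mult_orderD[OF e, of \<gamma>] unfolding bg by blast
  obtain C3 where C3: "C3 > 0" "\<And>(f :: complex^'n \<Rightarrow> complex) F. expansion f F \<Longrightarrow>
      L_norm p \<alpha> (multiplier l F) \<le> ennreal C3 * L_norm p \<beta> f"
    using smoothing_L_norm[OF p ls, where 'n='n and \<alpha>=\<alpha> and \<beta>=\<beta>] by blast
  obtain C4 where C4: "C4 > 0" "\<And>(f :: complex^'n \<Rightarrow> complex) F. expansion f F \<Longrightarrow>
      L_norm p \<beta> (multiplier l F) \<le> ennreal C4 * L_norm p \<alpha> f"
    using smoothing_L_norm[OF p ls, where 'n='n and \<alpha>=\<beta> and \<beta>=\<alpha>] by blast
  obtain C5 where C5: "C5 > 0" "\<And>\<phi> \<psi> :: complex^'n \<Rightarrow> complex. continuous_on UNIV \<phi> \<Longrightarrow> continuous_on UNIV \<psi> \<Longrightarrow>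
      L_norm p \<beta> (\<lambda>z. \<phi> z + \<psi> z) \<le> ennreal C5 * (L_norm p \<beta> \<phi> + L_norm p \<beta> \<psi>)"
    using L_norm_add[OF p, where 'n='n and \<alpha>=\<beta>] by blast
  define M where "M = max C2 C4"
  have M: "M > 0" using C2(1) by (simp add: M_def)
  let ?N = "\<lambda>f. L_norm p \<alpha> (R f) + L_norm p \<alpha> (multiplier l (hom_part f))"
  have main: "continuous_on UNIV (R f)" "continuous_on UNIV f"
      "?N f \<le> ennreal (C1 + C3) * L_norm p \<beta> f" "L_norm p \<beta> f \<le> ennreal (C5 * M) * ?N f"
      "L_norm p \<alpha> (multiplier l (hom_part f)) < \<infinity>"
    if ent: "entire f" for f :: "complex^'n \<Rightarrow> complex"
  proof -
    define F where "F = hom_part f"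
    have fF: "expansion f F" unfolding F_def by (rule expansion_hom_part[OF ent])
    have cont: "continuous_on UNIV (multiplier c F)" by (rule multiplier_cont[OF fF cb])
    show "continuous_on UNIV (R f)"
      unfolding R_def F_def[symmetric]
      by (intro continuous_intros cont) (auto simp: add_nonneg_eq_0_iff)
    show "continuous_on UNIV f" using fF slice_holomorphic_cont unfolding expansion_def by blast
    have RL: "L_norm p \<alpha> (R f) = L_norm p \<gamma> (multiplier c F)"
      unfolding R_def F_def[symmetric] \<gamma>_def by (rule L_norm_weight_shift[OF cont])
    have "?N f \<le> ennreal C1 * L_norm p \<beta> f + ennreal C3 * L_norm p \<beta> f"
      unfolding RL F_def[symmetric] by (intro add_mono C1(2)[OF fF] C3(2)[OF fF])
    also have "\<dots> = ennreal (C1 + C3) * L_norm p \<beta> f"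
      using C1(1) C3(1) by (simp add: distrib_right)
    finally show "?N f \<le> ennreal (C1 + C3) * L_norm p \<beta> f" .
    \<comment> \<open>Applying \<open>e\<close> after \<open>c\<close> recovers everything except
      the projection \<open>l\<close>, which is added back.\<close>
    have feq: "f = (\<lambda>z. multiplier (\<lambda>k. e k * c k) F z + multiplier l F z)"
    proof
      fix z
      have "multiplier (\<lambda>k. e k * c k) F z + multiplier l F z = multiplier (\<lambda>k. e k * c k + l k) F z"
        by (rule multiplier_add[OF fF exp_bounded_mult[OF eb cb] lb, symmetric])
      also have "\<dots> = (\<Sum>k. F k z)" by (simp add: multiplier_def inv)
      also have "\<dots> = f z" using fF unfolding expansion_def by (simp add: sums_iff)
      finally show "f z = multiplier (\<lambda>k. e k * c k) F z + multiplier l F z" by simp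
    qed
    have 1: "L_norm p \<beta> (multiplier (\<lambda>k. e k * c k) F) \<le> ennreal M * L_norm p \<gamma> (multiplier c F)"
    proof -
      have "L_norm p \<beta> (multiplier (\<lambda>k. e k * c k) F) \<le> ennreal C2 * L_norm p \<gamma> (multiplier c F)"
        using C2(2)[OF multiplier_expansion[OF fF cb]] unfolding multiplier_multiplier .
      also have "\<dots> \<le> ennreal M * L_norm p \<gamma> (multiplier c F)"
        by (intro mult_right_mono ennreal_leI) (auto simp: M_def)
      finally show ?thesis .
    qed
    \<comment> \<open>Idempotence lets the estimate for \<open>l\<close> be applied to the projected
      function, so that its own norm, and not that of \<open>f\<close>, stands on the right.\<close>
    have 2: "L_norm p \<beta> (multiplier l F) \<le> ennreal M * L_norm p \<alpha> (multiplier l F)"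
    proof -
      have "L_norm p \<beta> (multiplier l F) \<le> ennreal C4 * L_norm p \<alpha> (multiplier l F)"
        using C4(2)[OF multiplier_expansion[OF fF lb]] unfolding multiplier_multiplier idem .
      also have "\<dots> \<le> ennreal M * L_norm p \<alpha> (multiplier l F)"
        by (intro mult_right_mono ennreal_leI) (auto simp: M_def)
      finally show ?thesis .
    qed
    have "L_norm p \<beta> f \<le> ennreal C5 * (L_norm p \<beta> (multiplier (\<lambda>k. e k * c k) F) + L_norm p \<beta> (multiplier l F))"
      by (subst feq) (intro C5(2) multiplier_cont[OF fF] exp_bounded_mult eb cb lb)
    also have "\<dots> \<le> ennreal C5 * (ennreal M * L_norm p \<gamma> (multiplier c F) + ennreal M * L_norm p \<alpha> (multiplier l F))"
      by (rule mult_left_mono[OF add_mono[OF 1 2]]) simp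
    also have "\<dots> = ennreal (C5 * M) * ?N f"
    proof -
      have "ennreal (C5 * M) = ennreal C5 * ennreal M" using C5(1) M by (intro ennreal_mult) auto
      then show ?thesis unfolding RL F_def[symmetric] by (simp only: distrib_left mult.assoc)
    qed
    finally show "L_norm p \<beta> f \<le> ennreal (C5 * M) * ?N f" .
    show "L_norm p \<alpha> (multiplier l (hom_part f)) < \<infinity>"
      using L_norm_finite_support_multiplier[OF p l fF] unfolding F_def .
  qed
  have meas: "g \<in> borel_measurable lebesgue" if "continuous_on UNIV g" for g :: "complex^'n \<Rightarrow> complex"
    using borel_measurable_continuous_onI[OF that] by (intro measurable_completion) simp
  have "f \<in> {f. entire f \<and> R f \<in> L_space p \<alpha>} \<longleftrightarrow> f \<in> fock p \<beta>" for f :: "complex^'n \<Rightarrow> complex"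
  proof (cases "entire f")
    case True
    have "L_norm p \<alpha> (R f) < \<infinity> \<longleftrightarrow> L_norm p \<beta> f < \<infinity>"
    proof
      assume "L_norm p \<alpha> (R f) < \<infinity>"
      \<comment> \<open>The low-degree part always has finite norm, so finiteness for
        \<open>R f\<close> gives finiteness of the whole sum.\<close>
      then have "?N f < \<infinity>" using main(5)[OF True] by simp
      then have "ennreal (C5 * M) * ?N f < \<infinity>" by (simp add: ennreal_mult_less_top)
      then show "L_norm p \<beta> f < \<infinity>" using main(4)[OF True] by (rule le_less_trans[rotated])
    next
      assume "L_norm p \<beta> f < \<infinity>"
      then have "ennreal (C1 + C3) * L_norm p \<beta> f < \<infinity>" by (simp add: ennreal_mult_less_top)
      then have "?N f < \<infinity>" using main(3)[OF True] by (rule le_less_trans[rotated])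
      then show "L_norm p \<alpha> (R f) < \<infinity>" by simp
    qed
    then show ?thesis
      using True meas main(1,2)[OF True] by (simp add: fock_def L_space_def)
  qed (simp add: fock_def)
  then show "{f :: complex^'n \<Rightarrow> complex. entire f \<and> R f \<in> L_space p \<alpha>} = fock p (shifted_weight p \<alpha> s)"
    unfolding \<beta>_def by blast
  have "entire f" if "f \<in> fock p \<beta>" for f :: "complex^'n \<Rightarrow> complex"
    using that by (simp add: fock_def)
  then show "equivalent_norms_on (fock p (shifted_weight p \<alpha> s) :: (complex^'n \<Rightarrow> complex) set)
      ?N (L_norm p (shifted_weight p \<alpha> s))"
    unfolding \<beta>_def[symmetric] using C1(1) C3(1) C5(1) M
    by (intro equivalent_norms_onI[of "C1 + C3" "C5 * M"] main(3,4)) auto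
qed

text \<open>Both families of Fock-Sobolev spaces are instances: \<open>t = s\<close> for the first one and
  \<open>t = - s\<close> for the second one.\<close>

lemma Gamma_multiplier_space_eq_fock:
  fixes p :: ennreal and \<alpha> s t x y :: real
  assumes p: "0 < p" and xy: "x - y = s"
    and pos: "\<And>k. k \<in> frac_indices t \<Longrightarrow> x + real k > 0 \<and> y + real k > 0"
  defines "c \<equiv> \<lambda>k. if k \<in> frac_indices t then Gamma (x + real k) / Gamma (y + real k) else 0"
  defines "R \<equiv> \<lambda>f z. of_real ((1 + norm z) powr (- s)) * multiplier c (hom_part f) z"
  defines "N \<equiv> \<lambda>f. if t \<ge> 0 then L_norm p \<alpha> (R f) else L_norm p \<alpha> (R f) + L_norm p \<alpha> (low_part t f)"
  shows "{f :: complex^'n \<Rightarrow> complex. entire f \<and> R f \<in> L_space p \<alpha>} = fock p (shifted_weight p \<alpha> s)"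
    and "equivalent_norms_on (fock p (shifted_weight p \<alpha> s) :: (complex^'n \<Rightarrow> complex) set)
      N (L_norm p (shifted_weight p \<alpha> s))"
proof -
  \<comment> \<open>\<open>e\<close> inverts \<open>c\<close> on the retained indices, and
    \<open>l\<close> projects onto the dropped ones.\<close>
  define e where "e k = (if k \<in> frac_indices t then Gamma (y + real k) / Gamma (x + real k) else 0)" for k
  define l where "l k = (if k \<in> frac_indices t then 0 else 1 :: real)" for k
  define K where "K = nat \<lceil>\<bar>t\<bar>\<rceil> + 1"
  have K: "k \<in> frac_indices t" if "k \<ge> K" for k
  proof -
    have "real k > \<bar>t\<bar>" using that unfolding K_def by linarith
    then show ?thesis by (simp add: frac_indices_def)
  qed
  have c_ord: "mult_order TYPE('n) p s c"
    using mult_order_Gamma_ratio[OF p, of K c x y, where 'n='n] K by (simp add: c_def xy)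
  have "y - x = - s" using xy by simp
  then have e_ord: "mult_order TYPE('n) p (- s) e"
    using mult_order_Gamma_ratio[OF p, of K e y x, where 'n='n] K by (simp add: e_def)
  have inv: "e k * c k + l k = 1" for k
  proof (cases "k \<in> frac_indices t")
    case True
    then have "Gamma (x + real k) > 0" "Gamma (y + real k) > 0" using pos by (auto intro: Gamma_real_pos)
    then show ?thesis using True by (simp add: e_def c_def l_def)
  qed (simp add: e_def c_def l_def)
  have l0: "l k = 0" if "k \<ge> K" for k using K[OF that] by (simp add: l_def)
  have idem: "l k * l k = l k" for k by (simp add: l_def)
  have low: "multiplier l (hom_part f) = (if t \<ge> 0 then (\<lambda>z. 0) else low_part t f)" for f :: "complex^'n \<Rightarrow> complex"
  proof
    fix z
    show "multiplier l (hom_part f) z = (if t \<ge> 0 then (\<lambda>z. 0) else low_part t f) z"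
    proof (cases "t \<ge> 0")
      case True
      then show ?thesis by (simp add: multiplier_def l_def frac_indices_def)
    next
      case False
      have "finite {k. real k \<le> \<bar>t\<bar>}"
        by (rule finite_subset[of _ "{..nat \<lceil>\<bar>t\<bar>\<rceil>}"]) (auto, linarith)
      then have "multiplier l (hom_part f) z = (\<Sum>k | real k \<le> \<bar>t\<bar>. of_real (l k) * hom_part f k z)"
        unfolding multiplier_def using False
        by (intro suminf_finite) (auto simp: l_def frac_indices_def)
      also have "\<dots> = low_part t f z"
        unfolding low_part_def using False by (intro sum.cong) (auto simp: l_def frac_indices_def)
      finally show ?thesis using False by simp
    qed
  qed
  note eq = multiplier_space_eq_fock[OF p c_ord e_ord l0 inv idem, where \<alpha>=\<alpha>]
  show "{f :: complex^'n \<Rightarrow> complex. entire f \<and> R f \<in> L_space p \<alpha>} = fock p (shifted_weight p \<alpha> s)"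
    unfolding R_def by (rule eq(1))
  \<comment> \<open>For \<open>t \<ge> 0\<close> no index is dropped, so \<open>l\<close> is zero
    and the second summand vanishes.\<close>
  have "(\<lambda>f :: complex^'n \<Rightarrow> complex. L_norm p \<alpha> (R f) + L_norm p \<alpha> (multiplier l (hom_part f))) = N"
    by (auto simp: N_def low L_norm_zero[OF p])
  then show "equivalent_norms_on (fock p (shifted_weight p \<alpha> s) :: (complex^'n \<Rightarrow> complex) set)
      N (L_norm p (shifted_weight p \<alpha> s))"
    using eq(2) unfolding R_def by simp
qed

theorem theorem4p2:
  fixes s \<alpha> :: real and p :: ennreal
  assumes "0 < p"
  shows "(fock_sobolev p \<alpha> s :: (complex^'n \<Rightarrow> complex) set) = fock_sobolev_tilde p \<alpha> s \<and>
    (fock_sobolev_tilde p \<alpha> s :: (complex^'n \<Rightarrow> complex) set) = fock p (shifted_weight p \<alpha> s) \<and>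
    equivalent_norms_on (fock p (shifted_weight p \<alpha> s) :: (complex^'n \<Rightarrow> complex) set)
      (fock_sobolev_norm p \<alpha> s) (L_norm p (shifted_weight p \<alpha> s)) \<and>
    equivalent_norms_on (fock p (shifted_weight p \<alpha> s) :: (complex^'n \<Rightarrow> complex) set)
      (fock_sobolev_tilde_norm p \<alpha> s) (L_norm p (shifted_weight p \<alpha> s)) \<and>
    equivalent_norms_on (fock p (shifted_weight p \<alpha> s) :: (complex^'n \<Rightarrow> complex) set)
      (fock_sobolev_norm p \<alpha> s) (fock_sobolev_tilde_norm p \<alpha> s)"
proof -
  let ?n = "real CARD('n)"
  have n: "?n \<ge> 1" by (simp add: Suc_leI)
  \<comment> \<open>For negative \<open>r\<close> the retained indices satisfy
    \<open>k > \<bar>r\<bar>\<close>, so \<open>r + k\<close> is positive and no pole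
    occurs.\<close>
  have pos: "?n + real k > 0" "?n + r + real k > 0" if "k \<in> frac_indices r" for k r
  proof -
    have "r \<ge> 0 \<or> real k > \<bar>r\<bar>" using that by (simp add: frac_indices_def)
    then show "?n + real k > 0" "?n + r + real k > 0" using n by linarith+
  qed
  define c where "c k = (if k \<in> frac_indices s then Gamma (?n + s + real k) / Gamma (?n + real k) else 0)" for k
  define c' where "c' k = (if k \<in> frac_indices (- s) then Gamma (?n + real k) / Gamma (?n + (- s) + real k) else 0)" for k
  have R: "R_op s f = (\<lambda>z. of_real ((1 + norm z) powr (- s)) * multiplier c (hom_part f) z)"
    for f :: "complex^'n \<Rightarrow> complex"
    unfolding R_op_def frac_D_def multiplier_def c_def
    by (intro ext arg_cong2[where f = "(*)"] refl suminf_cong) auto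
  have R': "R_tilde_op s f = (\<lambda>z. of_real ((1 + norm z) powr (- s)) * multiplier c' (hom_part f) z)"
    for f :: "complex^'n \<Rightarrow> complex"
    unfolding R_tilde_op_def frac_I_def multiplier_def c'_def
    by (intro ext arg_cong2[where f = "(*)"] refl suminf_cong) auto
  have c_eq: "c = (\<lambda>k. if k \<in> frac_indices s then Gamma (?n + s + real k) / Gamma (?n + real k) else 0)"
    by (simp add: c_def fun_eq_iff)
  have c'_eq: "c' = (\<lambda>k. if k \<in> frac_indices (- s) then Gamma (?n + real k) / Gamma (?n + (- s) + real k) else 0)"
    by (simp add: c'_def fun_eq_iff)
  \<comment> \<open>Only \<open>\<bar>s\<bar>\<close> enters, so the change of sign between the two
    families leaves the low-degree part alone.\<close>
  have low: "low_part (- s) = (low_part s :: (complex^'n \<Rightarrow> complex) \<Rightarrow> _)"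
    by (simp add: low_part_def fun_eq_iff)
  have N: "fock_sobolev_norm p \<alpha> s = (\<lambda>f :: complex^'n \<Rightarrow> complex. if s \<ge> 0 then L_norm p \<alpha> (R_op s f)
      else L_norm p \<alpha> (R_op s f) + L_norm p \<alpha> (low_part s f))"
    by (simp add: fock_sobolev_norm_def fun_eq_iff)
  have N': "fock_sobolev_tilde_norm p \<alpha> s = (\<lambda>f :: complex^'n \<Rightarrow> complex. if - s \<ge> 0 then L_norm p \<alpha> (R_tilde_op s f)
      else L_norm p \<alpha> (R_tilde_op s f) + L_norm p \<alpha> (low_part (- s) f))"
    by (simp add: fock_sobolev_tilde_norm_def fun_eq_iff low)
  \<comment> \<open>The instance \<open>x = ?n + s\<close>, \<open>y = ?n\<close>,
    \<open>t = s\<close>.\<close>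
  have 1: "(fock_sobolev p \<alpha> s :: (complex^'n \<Rightarrow> complex) set) = fock p (shifted_weight p \<alpha> s)"
    "equivalent_norms_on (fock p (shifted_weight p \<alpha> s) :: (complex^'n \<Rightarrow> complex) set)
      (fock_sobolev_norm p \<alpha> s) (L_norm p (shifted_weight p \<alpha> s))"
    unfolding fock_sobolev_def N R c_eq
    using pos by (intro Gamma_multiplier_space_eq_fock[OF assms]; simp)+
  \<comment> \<open>The instance \<open>x = ?n\<close>, \<open>y = ?n - s\<close>,
    \<open>t = - s\<close>; the difference \<open>x - y\<close> is again \<open>s\<close>, hence the
    same target space.\<close>
  have 2: "(fock_sobolev_tilde p \<alpha> s :: (complex^'n \<Rightarrow> complex) set) = fock p (shifted_weight p \<alpha> s)"
    "equivalent_norms_on (fock p (shifted_weight p \<alpha> s) :: (complex^'n \<Rightarrow> complex) set)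
      (fock_sobolev_tilde_norm p \<alpha> s) (L_norm p (shifted_weight p \<alpha> s))"
    unfolding fock_sobolev_tilde_def N' R' c'_eq
    using pos[of _ "- s"] by (intro Gamma_multiplier_space_eq_fock[OF assms]; simp)+
  show ?thesis
    using 1 2 equivalent_norms_on_trans_sym[OF 1(2) 2(2)] by simp
qed

end
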